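(* Let $(P_t)_{t\ge0}$ be a Markov transition semi-group on $\mathbb R^d$ and let $\nu$ be a Borel probability measure on $\mathbb R^d$. Let $\mu_0\in\mathcal P_q(\mathbb R^d)$ for some $q>1$ and let $\psi:\mathbb R^d\to[0,+\infty)$ and $e\in\mathbb L^1([0,+\infty))$ (with values in $[0,+\infty)$) be Borel functions such that (i) $\forall\,t\ge0$, $\forall\,x\in\mathbb R^d$, $\ \|P_t(x,dy)-\nu\|_{TV}\le\psi(x)\,e(t)$; (ii) $\sup_{t\ge0}\mu_0P_t\big(\psi^q+|\cdot|^q\big)<+\infty$. Then $\nu$ is the unique invariant distribution of $(P_t)_{t\ge0}$, $\nu\in\mathcal P_q(\mathbb R^d)$, and, for the occupation measures $\nu_t$ of a right continuous Markov process $(X_t)_{t\ge0}$ with semi-group $(P_t)_{t\ge0}$ and $X_0\sim\mu_0$, Property $\mathbf A_{\beta,q,\frac12}$ (see context) holds true for every $t_0>0$ with $\beta=\frac12(1-\frac1q)$ and $\pi_t=\frac12(\bar\nu_t+\nu)$. Hence for every $p\in(0,q)$ and $t_0>0$ there is a positive constant $K$ such that for every $t\ge t_0$, $\mathbb E\,\mathcal W_p^p(\nu_t,\nu)\le K\,\mathsf M_{\pi,q}\,r(t)$ where, with $d_-:=\frac{d+\sqrt{d^2+8d}}4$ and $d_+:=\frac{d+1+\sqrt{(d+1)^2+4d}}2$, - if $p<\frac d2(1+\frac1q)$: $r(t)=t^{-\frac{pq}{(q+1)d}}$ when $p<\frac{dq}{d+q}$, and $r(t)=t^{-\frac{q-p}{q+1}}$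 when $\frac{dq}{d+q}<p<q$; - if $p=\frac d2(1+\frac1q)$: $r(t)=t^{-\frac{q-p}{q+1}}$ when $d_-<q<d_+$, and $r(t)=t^{-\frac12}\log(1+t)$ when $q>d_+$; - if $p>\frac d2(1+\frac1q)$: $r(t)=t^{-\frac12}$ when $p<\frac{q-1}2$, and $r(t)=t^{-\frac{q-p}{q+1}}$ when $\frac{q-1}2<p<q$.
   Context: $\nu_t(\omega,d\xi)=\frac1t\int_0^t\delta_{X_s(\omega)}(d\xi)\,ds$ and $\bar\nu_t(f)=\frac1t\int_0^t\mathbb E f(X_s)\,ds$. $\mathcal P_q(\mathbb R^d)$: Borel probability measures with finite $q$-th moment. $\|\mu-\mu'\|_{TV}=\sup\{|\mu(f)-\mu'(f)|: f$ Borel, $|f|\le1\}$. $|\cdot|$ is the Euclidean norm, $M_\mu(q)=\int|\xi|^q\mu(d\xi)$; for $p>0$, $\mathcal W_p(\mu,\nu)=\inf_\varpi(\int|x-y|^p\varpi(dx,dy))^{1/p}$ over couplings $\varpi$ of $\mu$ and $\nu$; $a\vee b=\max(a,b)$. Property $\mathbf A_{\beta,q,\gamma}$ (for a given $t_0>0$ and a family $(\pi_t)_{t\ge t_0}$ of probability measures): there is a constant $C_0\in(0,\infty)$ with $\mathbb E|\nu_t(A)-\nu(A)|\le C_0\min\big(\pi_t(A),\pi_t(A)^\beta t^{-\gamma}\big)$ for every $t\ge t_0$ and every Borel $A$, and $\mathsf M_{\pi,q}:=1\vee\sup_{t\ge t_0}M_{\pi_t}(q)<+\infty$. *)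

theory Defs
  imports "HOL-Probability.Probability"
begin

definition markov_semigroup :: "(real \<Rightarrow> 'a::euclidean_space \<Rightarrow> 'a measure) \<Rightarrow> bool" where
  "markov_semigroup P \<longleftrightarrow>
     (\<forall>t\<ge>0. P t \<in> borel \<rightarrow>\<^sub>M prob_algebra borel) \<and>
     (\<forall>x. P 0 x = return borel x) \<and>
     (\<forall>s\<ge>0. \<forall>t\<ge>0. \<forall>x. P (s + t) x = bind (P s x) (P t))"

definition invariant_distribution ::
  "(real \<Rightarrow> 'a::euclidean_space \<Rightarrow> 'a measure) \<Rightarrow> 'a measure \<Rightarrow> bool" where
  "invariant_distribution P \<mu> \<longleftrightarrow>
     \<mu> \<in> space (prob_algebra borel) \<and> (\<forall>t\<ge>0. bind \<mu> (P t) = \<mu>)"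

definition tv_norm :: "'a::euclidean_space measure \<Rightarrow> 'a measure \<Rightarrow> real" where
  "tv_norm \<mu> \<mu>' =
     (SUP f \<in> {f \<in> borel_measurable borel. \<forall>x. \<bar>f x :: real\<bar> \<le> 1}.
        \<bar>(\<integral>x. f x \<partial>\<mu>) - (\<integral>x. f x \<partial>\<mu>')\<bar>)"

definition moment :: "'a::euclidean_space measure \<Rightarrow> real \<Rightarrow> ennreal" where
  "moment \<mu> q = (\<integral>\<^sup>+\<xi>. ennreal (norm \<xi> powr q) \<partial>\<mu>)"

definition prob_moment :: "real \<Rightarrow> 'a::euclidean_space measure set" where
  "prob_moment q = {\<mu> \<in> space (prob_algebra borel). moment \<mu> q < \<infinity>}"

text \<open>Real powers on \<open>[0, \<infinity>]\<close>, meant for positive exponents.\<close>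

definition ennreal_powr :: "ennreal \<Rightarrow> real \<Rightarrow> ennreal" where
  "ennreal_powr x a = (if x = \<infinity> then \<infinity> else ennreal (enn2real x powr a))"

definition couplings ::
  "'a::euclidean_space measure \<Rightarrow> 'a measure \<Rightarrow> ('a \<times> 'a) measure set" where
  "couplings \<mu> \<nu> =
     {\<pi> \<in> space (prob_algebra (borel \<Otimes>\<^sub>M borel)). distr \<pi> borel fst = \<mu> \<and> distr \<pi> borel snd = \<nu>}"

definition wasserstein ::
  "real \<Rightarrow> 'a::euclidean_space measure \<Rightarrow> 'a measure \<Rightarrow> ennreal" where
  "wasserstein p \<mu> \<nu> =
     (INF \<pi> \<in> couplings \<mu> \<nu>.
        ennreal_powr (\<integral>\<^sup>+z. ennreal (norm (fst z - snd z) powr p) \<partial>\<pi>) (1 / p))"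

definition natural_sigma_algebra ::
  "'w measure \<Rightarrow> (real \<Rightarrow> 'w \<Rightarrow> 'a::euclidean_space) \<Rightarrow> real \<Rightarrow> 'w measure" where
  "natural_sigma_algebra M X s =
     sigma (space M) {X u -` A \<inter> space M | u A. 0 \<le> u \<and> u \<le> s \<and> A \<in> sets borel}"

text \<open>
  The Markov property is required with respect to the natural filtration only; it follows from
  the Markov property with respect to any larger filtration to which the process is adapted.
\<close>

definition rc_markov_process ::
  "(real \<Rightarrow> 'a::euclidean_space \<Rightarrow> 'a measure) \<Rightarrow> 'a measure \<Rightarrow>
   'w measure \<Rightarrow> (real \<Rightarrow> 'w \<Rightarrow> 'a) \<Rightarrow> bool" where
  "rc_markov_process P \<mu>\<^sub>0 M X \<longleftrightarrow>
     prob_space M \<and>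
     (\<forall>t\<ge>0. X t \<in> borel_measurable M) \<and>
     (\<forall>\<omega>\<in>space M. \<forall>t\<ge>0. continuous (at_right t) (\<lambda>s. X s \<omega>)) \<and>
     distr M borel (X 0) = \<mu>\<^sub>0 \<and>
     (\<forall>s\<ge>0. \<forall>t\<ge>0. \<forall>A\<in>sets borel. AE \<omega> in M.
        real_cond_exp M (natural_sigma_algebra M X s) (\<lambda>\<omega>'. indicator A (X (s + t) \<omega>')) \<omega>
          = measure (P t (X s \<omega>)) A)"

text \<open>
  \<open>occupation X t \<omega>\<close> is the measure \<open>(1/t) \<integral>\<^sub>0\<^sup>t \<delta>\<^bsub>X\<^sub>s(\<omega>)\<^esub> ds\<close>.
  The restriction to \<open>{0..t}\<close> is needed since nothing is assumed about the path at negative times.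
\<close>

definition occupation :: "(real \<Rightarrow> 'w \<Rightarrow> 'a::euclidean_space) \<Rightarrow> real \<Rightarrow> 'w \<Rightarrow> 'a measure" where
  "occupation X t \<omega> =
     scale_measure (ennreal (1 / t)) (distr (restrict_space lborel {0..t}) borel (\<lambda>s. X s \<omega>))"

text \<open>
  For right continuous paths \<open>(s, \<omega>) \<mapsto> X\<^sub>s(\<omega>)\<close> is jointly measurable, so the set function below
  is countably additive and \<open>measure_of\<close> yields the measure with these values.
\<close>

definition mean_occupation ::
  "'w measure \<Rightarrow> (real \<Rightarrow> 'w \<Rightarrow> 'a::euclidean_space) \<Rightarrow> real \<Rightarrow> 'a measure" where
  "mean_occupation M X t =
     measure_of UNIV (sets borel)
       (\<lambda>A. ennreal (1 / t) * (\<integral>\<^sup>+s\<in>{0..t}. (\<integral>\<^sup>+\<omega>. indicator A (X s \<omega>) \<partial>M) \<partial>lborel))"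

definition average_measure ::
  "'a::euclidean_space measure \<Rightarrow> 'a measure \<Rightarrow> 'a measure" where
  "average_measure \<mu> \<nu> =
     measure_of UNIV (sets borel) (\<lambda>A. ennreal (1 / 2) * (emeasure \<mu> A + emeasure \<nu> A))"

definition sup_moment :: "(real \<Rightarrow> 'a::euclidean_space measure) \<Rightarrow> real \<Rightarrow> real \<Rightarrow> ennreal" where
  "sup_moment \<pi> t\<^sub>0 q = max 1 (SUP t\<in>{t\<^sub>0..}. moment (\<pi> t) q)"

text \<open>
  Expectations of nonnegative quantities are nonnegative Lebesgue integrals, so that no
  integrability side condition is hidden in the bounds.
\<close>

definition property_A ::
  "'w measure \<Rightarrow> (real \<Rightarrow> 'w \<Rightarrow> 'a::euclidean_space measure) \<Rightarrow> 'a measure \<Rightarrow>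
   (real \<Rightarrow> 'a measure) \<Rightarrow> real \<Rightarrow> real \<Rightarrow> real \<Rightarrow> real \<Rightarrow> bool" where
  "property_A M \<nu>\<^sub>t \<nu> \<pi> t\<^sub>0 \<beta> q \<gamma> \<longleftrightarrow>
     (\<forall>t\<ge>t\<^sub>0. \<pi> t \<in> space (prob_algebra borel)) \<and>
     (\<exists>C\<^sub>0>0. \<forall>t\<ge>t\<^sub>0. \<forall>A\<in>sets borel.
        (\<integral>\<^sup>+\<omega>. ennreal \<bar>measure (\<nu>\<^sub>t t \<omega>) A - measure \<nu> A\<bar> \<partial>M)
          \<le> ennreal (C\<^sub>0 * min (measure (\<pi> t) A) (measure (\<pi> t) A powr \<beta> * t powr (- \<gamma>)))) \<and>
     sup_moment \<pi> t\<^sub>0 q < \<infinity>"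

end

theory Submission
  imports Defs
begin

text \<open>
  The proof has two independent halves: a variance estimate for occupation measures, and an upper bound of Wasserstein distances
  by the masses of dyadic cells.

  Since \<open>e\<close> is integrable it takes arbitrarily small values, so \<open>P\<^sub>t(x, \<cdot>)\<close> comes
  arbitrarily close to \<open>\<nu>\<close> in total variation. At such times the Chapman--Kolmogorov equation gives invariance
  (\<open>kernel_invariant\<close>), and a limit along them gives uniqueness (\<open>kernel_invariant_unique\<close>) and
  transfers the moment bound from \<open>\<mu>\<^sub>0P\<^sub>t\<close> to \<open>\<nu>\<close>
  (\<open>kernel_limit_moment\<close>). By the Markov property the covariance of \<open>1\<^sub>A(X\<^sub>s)\<close> and
  \<open>1\<^sub>A(X\<^sub>u)\<close> around \<open>\<nu>(A)\<close> is at most \<open>e(u - s)\<close> times a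
  \<open>\<psi>\<close>-weighted mass of \<open>A\<close> (\<open>indicator_covariance_le\<close>). Integrating over \<open>s, u
  \<le> t\<close> costs one factor \<open>t\<close> and the integral of \<open>e\<close>, so the variance of
  \<open>\<nu>\<^sub>t(A)\<close> is of order \<open>1/t\<close> times that weighted mass. Truncating \<open>\<psi>\<close> at the
  level \<open>\<pi>\<^sub>t(A)\<close> to the power \<open>-1/q\<close> shows that the weighted mass is at most a constant times
  \<open>\<pi>\<^sub>t(A)\<close> to the power \<open>1 - 1/q\<close>; taking a square root yields Property A
  (\<open>occupation_deviation\<close>).

  For the second half, two probability measures always have a coupling that is simultaneously optimal for all sets of a given
  finite laminar family, that is, a family in which any two sets are nested or disjoint (\<open>laminar_coupling\<close>). Cut
  space into the shells where the norm is of order \<open>2\<close> to the power \<open>n\<close>, and shell \<open>n\<close> at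
  level \<open>l\<close> into about \<open>2\<close> to the power \<open>dl\<close> cubes of side \<open>2\<close> to the power
  \<open>n - l\<close>. These cells form a laminar family, and a point and its partner pay the diameter of the coarsest cell that
  separates them. Hence, up to a remainder that vanishes when more shells and levels are taken, \<open>W\<^sub>p\<close> to the
  power \<open>p\<close> is at most a multiple of the sum over \<open>n\<close> and \<open>l\<close> of \<open>2\<close> to the
  power \<open>p(n - l)\<close> times the total discrepancy of the cells of level \<open>l\<close> in shell \<open>n\<close>
  (\<open>wasserstein_le_dyadic\<close>).

  In expectation, Property A, the moment of order \<open>q\<close> and concavity of \<open>x \<mapsto> x\<close> to the power
  \<open>\<beta>\<close> bound each of these discrepancies by a minimum of two exponentials in \<open>n\<close> and
  \<open>l\<close> (\<open>expected_wasserstein_le_multiscale\<close>). All rates of the theorem come from summing this one double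
  series. The regimes differ in which of the two exponentials has a convergent sum in which index: a sum of \<open>min (A
  2^(\<alpha> l)) (B 2^(-\<delta> l))\<close> is comparable to the value where the two sequences cross
  (\<open>sum_min_two_powr_le\<close>), and only when one of the sequences is constant does counting the terms before the crossing
  produce a logarithm.
\<close>

section \<open>Sums of minima of exponentials\<close>

lemma geometric_sum_le:
  fixes x :: real
  assumes "0 \<le> x" "x < 1" "finite S"
  shows "(\<Sum>l\<in>S. x ^ l) \<le> 1 / (1 - x)"
proof -
  have "(\<Sum>l\<in>S. x ^ l) \<le> (\<Sum>l. x ^ l)"
    by (rule sum_le_suminf) (use assms in \<open>auto intro!: summable_geometric\<close>)
  also have "\<dots> = 1 / (1 - x)"
    using assms by (intro suminf_geometric) auto
  finally show ?thesis .
qed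

lemma sum_two_powr_le:
  fixes \<delta> :: real
  assumes "\<delta> > 0" "finite S"
  shows "(\<Sum>l\<in>S. 2 powr (- \<delta> * real l)) \<le> 1 / (1 - 2 powr - \<delta>)"
proof -
  have "(\<Sum>l\<in>S. 2 powr (- \<delta> * real l)) = (\<Sum>l\<in>S. (2 powr - \<delta>) ^ l)"
    by (intro sum.cong refl) (simp add: powr_realpow[symmetric] powr_powr)
  also have "\<dots> \<le> 1 / (1 - 2 powr - \<delta>)"
    using assms powr_less_one[of 2 "- \<delta>"] by (intro geometric_sum_le) auto
  finally show ?thesis .
qed

text \<open>
  The bound does not depend on \<open>z\<close>: after rounding \<open>z\<close> up, the exponents are distinct natural numbers.
\<close>

lemma sum_two_powr_above_le:
  fixes \<delta> z :: real
  assumes "\<delta> > 0" "finite S" and "\<And>l. l \<in> S \<Longrightarrow> z \<le> real l"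
  shows "(\<Sum>l\<in>S. 2 powr (- \<delta> * (real l - z))) \<le> 1 / (1 - 2 powr - \<delta>)"
proof -
  define m where "m = nat \<lceil>z\<rceil>"
  have m: "m \<le> l" if "l \<in> S" for l
    using assms(3)[OF that] unfolding m_def by (simp add: nat_le_iff ceiling_le_iff)
  have mz: "z \<le> real m" unfolding m_def by linarith
  have "(\<Sum>l\<in>S. 2 powr (- \<delta> * (real l - z))) \<le> (\<Sum>l\<in>S. 2 powr (- \<delta> * real (l - m)))"
  proof (intro sum_mono)
    fix l assume "l \<in> S"
    then show "2 powr (- \<delta> * (real l - z)) \<le> 2 powr (- \<delta> * real (l - m))"
      using m[of l] mz assms(1) by (intro powr_mono) (auto simp: of_nat_diff)
  qed
  also have "\<dots> = (\<Sum>k\<in>(\<lambda>l. l - m) ` S. 2 powr (- \<delta> * real k))"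
    proof (subst sum.reindex)
    show "inj_on (\<lambda>l. l - m) S"
      by (rule inj_onI) (metis m le_add_diff_inverse)
  qed (simp add: o_def)
  also have "\<dots> \<le> 1 / (1 - 2 powr - \<delta>)"
    using assms by (intro sum_two_powr_le) auto
  finally show ?thesis .
qed

lemma sum_two_powr_below_le:
  fixes \<alpha> z :: real
  assumes "\<alpha> > 0" "finite S" and "\<And>l. l \<in> S \<Longrightarrow> real l \<le> z"
  shows "(\<Sum>l\<in>S. 2 powr (\<alpha> * (real l - z))) \<le> 1 / (1 - 2 powr - \<alpha>)"
proof (cases "S = {}")
  case True
  then show ?thesis using assms(1) powr_less_one[of 2 "- \<alpha>"] by simp
next
  case False
  define m where "m = nat \<lfloor>z\<rfloor>"
  have z0: "0 \<le> z" using False assms(3) by (metis all_not_in_conv of_nat_0_le_iff order_trans)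
  have m: "l \<le> m" if "l \<in> S" for l
    using assms(3)[OF that] unfolding m_def by (simp add: le_nat_floor)
  have mz: "real m \<le> z" unfolding m_def using z0 by linarith
  have "(\<Sum>l\<in>S. 2 powr (\<alpha> * (real l - z))) \<le> (\<Sum>l\<in>S. 2 powr (- \<alpha> * real (m - l)))"
  proof (intro sum_mono)
    fix l assume "l \<in> S"
    then have "\<alpha> * (real l - z) \<le> \<alpha> * (- real (m - l))"
      using m[of l] mz assms(1) by (intro mult_left_mono) (auto simp: of_nat_diff)
    then show "2 powr (\<alpha> * (real l - z)) \<le> 2 powr (- \<alpha> * real (m - l))"
      by (intro powr_mono) auto
  qed
  also have "\<dots> = (\<Sum>k\<in>(\<lambda>l. m - l) ` S. 2 powr (- \<alpha> * real k))"
  proof (subst sum.reindex)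
    show "inj_on (\<lambda>l. m - l) S"
      by (rule inj_onI) (metis m diff_diff_cancel)
  qed (simp add: o_def)
  also have "\<dots> \<le> 1 / (1 - 2 powr - \<alpha>)"
    using assms by (intro sum_two_powr_le) auto
  finally show ?thesis .
qed

definition two_sided_const :: "real \<Rightarrow> real \<Rightarrow> real" where
  "two_sided_const \<alpha> \<delta> = 1 / (1 - 2 powr - \<alpha>) + 1 / (1 - 2 powr - \<delta>)"

text \<open>
  The increasing and the decreasing sequence take the same value \<open>V = A powr (\<delta> / (\<alpha> + \<delta>)) * B powr
  (\<alpha> / (\<alpha> + \<delta>))\<close> at the real index \<open>z = log 2 (B / A) / (\<alpha> + \<delta>)\<close>. The
  minimum decays geometrically from \<open>V\<close> on both sides of \<open>z\<close>.
\<close>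

lemma sum_min_two_powr_le:
  fixes \<alpha> \<delta> A B :: real
  assumes "\<alpha> > 0" "\<delta> > 0" "A > 0" "B > 0" "finite S"
  shows "(\<Sum>l\<in>S. min (A * 2 powr (\<alpha> * real l)) (B * 2 powr (- \<delta> * real l)))
           \<le> two_sided_const \<alpha> \<delta> * (A powr (\<delta> / (\<alpha> + \<delta>)) * B powr (\<alpha> / (\<alpha> + \<delta>)))"
proof -
  define z where "z = log 2 (B / A) / (\<alpha> + \<delta>)"
  define V where "V = A powr (\<delta> / (\<alpha> + \<delta>)) * B powr (\<alpha> / (\<alpha> + \<delta>))"
  define a b where "a = log 2 A" and "b = log 2 B"
  have pw: "C powr s = 2 powr (s * log 2 C)" if "C > 0" for C s :: real
    using that by (simp add: powr_def log_def)
  have V: "V = 2 powr ((\<delta> * a + \<alpha> * b) / (\<alpha> + \<delta>))"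
    unfolding V_def pw[OF \<open>A > 0\<close>] pw[OF \<open>B > 0\<close>] powr_add[symmetric]
    by (simp add: a_def b_def add_divide_distrib)
  have z: "z = (b - a) / (\<alpha> + \<delta>)"
    using assms by (simp add: z_def a_def b_def log_divide)
  have n: "\<alpha> + \<delta> \<noteq> 0" using assms by auto
  have ab: "(\<delta> * a + \<alpha> * b) / (\<alpha> + \<delta>) + - \<alpha> * z = a"
           "(\<delta> * a + \<alpha> * b) / (\<alpha> + \<delta>) + \<delta> * z = b"
  proof -
    have "(\<delta> * a + \<alpha> * b) / (\<alpha> + \<delta>) + - \<alpha> * z = (a * (\<alpha> + \<delta>)) / (\<alpha> + \<delta>)"
      unfolding z times_divide_eq_right add_divide_distrib[symmetric] by (simp add: algebra_simps)
    then show "(\<delta> * a + \<alpha> * b) / (\<alpha> + \<delta>) + - \<alpha> * z = a" using n by simp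
    have "(\<delta> * a + \<alpha> * b) / (\<alpha> + \<delta>) + \<delta> * z = (b * (\<alpha> + \<delta>)) / (\<alpha> + \<delta>)"
      unfolding z times_divide_eq_right add_divide_distrib[symmetric] by (simp add: algebra_simps)
    then show "(\<delta> * a + \<alpha> * b) / (\<alpha> + \<delta>) + \<delta> * z = b" using n by simp
  qed
  have *: "A = V * 2 powr (- \<alpha> * z)" "B = V * 2 powr (\<delta> * z)"
    unfolding V powr_add[symmetric] ab using assms by (simp_all add: a_def b_def)
  have V0: "V > 0" using assms by (simp add: V_def)
  let ?f = "\<lambda>l. min (A * 2 powr (\<alpha> * real l)) (B * 2 powr (- \<delta> * real l))"
  have A': "A * 2 powr (\<alpha> * real l) = V * 2 powr (\<alpha> * (real l - z))" for l
    unfolding *(1) mult.assoc powr_add[symmetric] by (simp add: algebra_simps)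
  have B': "B * 2 powr (- \<delta> * real l) = V * 2 powr (- \<delta> * (real l - z))" for l
    unfolding *(2) mult.assoc powr_add[symmetric] by (simp add: algebra_simps)
  let ?S1 = "{l\<in>S. real l \<le> z}" and ?S2 = "{l\<in>S. \<not> real l \<le> z}"
  have "(\<Sum>l\<in>S. ?f l) = (\<Sum>l\<in>?S1. ?f l) + (\<Sum>l\<in>?S2. ?f l)"
    using assms(5) by (subst sum.union_disjoint[symmetric]) (auto intro!: sum.cong)
  also have "\<dots> \<le> (\<Sum>l\<in>?S1. V * 2 powr (\<alpha> * (real l - z)))
                    + (\<Sum>l\<in>?S2. V * 2 powr (- \<delta> * (real l - z)))"
    by (intro add_mono sum_mono) (simp_all only: A'[symmetric] B'[symmetric] min.cobounded1 min.cobounded2)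
  also have "\<dots> \<le> V * (1 / (1 - 2 powr - \<alpha>)) + V * (1 / (1 - 2 powr - \<delta>))"
    unfolding sum_distrib_left[symmetric] using assms V0
    by (intro add_mono mult_left_mono sum_two_powr_below_le sum_two_powr_above_le) auto
  finally show ?thesis by (simp add: V_def two_sided_const_def algebra_simps)
qed


lemma two_sided_const_pos: "\<alpha> > 0 \<Longrightarrow> \<delta> > 0 \<Longrightarrow> two_sided_const \<alpha> \<delta> > 0"
  using powr_less_one[of 2 "- \<alpha>"] powr_less_one[of 2 "- \<delta>"]
  by (auto simp: two_sided_const_def intro!: add_pos_pos)

text \<open>
  For each \<open>j\<close> the sum over \<open>i\<close> is comparable to the value at the crossing, which is a power of
  \<open>2\<close> linear in \<open>j\<close>. The hypothesis \<open>\<alpha>' * \<delta> < \<alpha> * \<delta>'\<close> says that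
  this power decays.
\<close>

lemma double_sum_min_two_powr_le:
  fixes \<alpha> \<alpha>' \<delta> \<delta>' h :: real
  assumes "\<alpha> > 0" "\<delta> > 0" "\<alpha>' * \<delta> < \<alpha> * \<delta>'" "h > 0" "finite S" "finite S'"
  shows "(\<Sum>j\<in>S'. \<Sum>i\<in>S. min (2 powr (- \<delta> * real i - \<delta>' * real j)) (2 powr (\<alpha> * real i + \<alpha>' * real j) * h))
    \<le> two_sided_const \<alpha> \<delta> * (1 / (1 - 2 powr - ((\<alpha> * \<delta>' - \<alpha>' * \<delta>) / (\<alpha> + \<delta>)))) * h powr (\<delta> / (\<alpha> + \<delta>))"
proof -
  define \<eta> where "\<eta> = (\<alpha> * \<delta>' - \<alpha>' * \<delta>) / (\<alpha> + \<delta>)"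
  have \<eta>: "\<eta> > 0" using assms unfolding \<eta>_def by (intro divide_pos_pos) auto
  let ?c = "two_sided_const \<alpha> \<delta> * h powr (\<delta> / (\<alpha> + \<delta>))"
  have inner: "(\<Sum>i\<in>S. min (2 powr (- \<delta> * real i - \<delta>' * real j)) (2 powr (\<alpha> * real i + \<alpha>' * real j) * h))
      \<le> ?c * 2 powr (- \<eta> * real j)" for j
  proof -
    define A where "A = 2 powr (\<alpha>' * real j) * h"
    define B where "B = 2 powr (- \<delta>' * real j)"
    have AB: "A > 0" "B > 0" using assms by (auto simp: A_def B_def)
    have terms: "2 powr (\<alpha> * real i + \<alpha>' * real j) * h = A * 2 powr (\<alpha> * real i)" for i
      by (simp add: A_def powr_add)
    have terms': "2 powr (- \<delta> * real i - \<delta>' * real j) = B * 2 powr (- \<delta> * real i)" for i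
      unfolding B_def powr_add[symmetric] by (simp add: algebra_simps)
    have "(\<Sum>i\<in>S. min (2 powr (- \<delta> * real i - \<delta>' * real j)) (2 powr (\<alpha> * real i + \<alpha>' * real j) * h))
        \<le> two_sided_const \<alpha> \<delta> * (A powr (\<delta> / (\<alpha> + \<delta>)) * B powr (\<alpha> / (\<alpha> + \<delta>)))"
      unfolding terms terms' min.commute[of "B * _"] using assms AB by (intro sum_min_two_powr_le) auto
    also have "A powr (\<delta> / (\<alpha> + \<delta>)) * B powr (\<alpha> / (\<alpha> + \<delta>))
        = h powr (\<delta> / (\<alpha> + \<delta>)) * (2 powr (\<alpha>' * real j * (\<delta> / (\<alpha> + \<delta>))) * 2 powr (- \<delta>' * real j * (\<alpha> / (\<alpha> + \<delta>))))"
      using assms by (simp add: A_def B_def powr_mult powr_powr)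
    also have "2 powr (\<alpha>' * real j * (\<delta> / (\<alpha> + \<delta>))) * 2 powr (- \<delta>' * real j * (\<alpha> / (\<alpha> + \<delta>))) = 2 powr (- \<eta> * real j)"
      unfolding powr_add[symmetric] \<eta>_def by (simp add: diff_divide_distrib algebra_simps)
    finally show ?thesis by (simp only: mult.assoc)
  qed
  have "(\<Sum>j\<in>S'. \<Sum>i\<in>S. min (2 powr (- \<delta> * real i - \<delta>' * real j)) (2 powr (\<alpha> * real i + \<alpha>' * real j) * h))
      \<le> ?c * (\<Sum>j\<in>S'. 2 powr (- \<eta> * real j))"
    unfolding sum_distrib_left by (intro sum_mono inner)
  also have "\<dots> \<le> ?c * (1 / (1 - 2 powr - \<eta>))"
    using assms \<eta> two_sided_const_pos[of \<alpha> \<delta>] by (intro mult_left_mono sum_two_powr_le) auto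
  finally show ?thesis by (simp add: \<eta>_def mult_ac)
qed

text \<open>
  The contribution of level \<open>l\<close> in shell \<open>n\<close> to the expected transport cost. The first factor is, up to
  a constant, the \<open>p\<close>-th power of the diameter of a cell. The minimum bounds the total discrepancy of the cells: it
  is at most the mass of the shell, of order \<open>2 powr (- q * n)\<close>, and at most the sum of the fluctuations of the
  cells, where \<open>\<kappa> = d (1 - \<beta>)\<close>, \<open>b = q \<beta>\<close> and \<open>h = t powr (- \<gamma>)\<close>.
\<close>

definition multiscale_term :: "real \<Rightarrow> real \<Rightarrow> real \<Rightarrow> real \<Rightarrow> real \<Rightarrow> nat \<Rightarrow> nat \<Rightarrow> real" where
  "multiscale_term p q b \<kappa> h n l =
     2 powr (p * (real n - real l)) *
       min (2 powr (- q * real n)) (2 powr (\<kappa> * real l - b * real n) * h)"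

lemma multiscale_term_eq:
  assumes "h > 0"
  shows "multiscale_term p q b \<kappa> h n l =
    min (2 powr ((p - q) * real n - p * real l)) (2 powr ((p - b) * real n + (\<kappa> - p) * real l) * h)"
proof -
  have "2 powr (p * (real n - real l)) * 2 powr (- q * real n) = 2 powr ((p - q) * real n - p * real l)"
    unfolding powr_add[symmetric] by (simp add: algebra_simps)
  moreover have "2 powr (p * (real n - real l)) * (2 powr (\<kappa> * real l - b * real n) * h)
      = 2 powr ((p - b) * real n + (\<kappa> - p) * real l) * h"
    unfolding mult.assoc[symmetric] powr_add[symmetric] by (simp add: algebra_simps)
  ultimately show ?thesis by (simp only: multiscale_term_def min_mult_distrib_left powr_ge_zero if_True)
qed

text \<open>
  The fluctuations alone are summable in both indices, so the series inherits the parametric order \<open>h\<close>.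
\<close>

lemma multiscale_sum_low_dimension:
  assumes "\<kappa> < p" "p < b" "h > 0" "finite S" "finite S'"
  shows "(\<Sum>n\<in>S. \<Sum>l\<in>S'. multiscale_term p q b \<kappa> h n l)
           \<le> 1 / (1 - 2 powr - (b - p)) * (1 / (1 - 2 powr - (p - \<kappa>))) * h"
proof -
  have "(\<Sum>n\<in>S. \<Sum>l\<in>S'. multiscale_term p q b \<kappa> h n l)
      \<le> (\<Sum>n\<in>S. \<Sum>l\<in>S'. 2 powr (- (b - p) * real n) * 2 powr (- (p - \<kappa>) * real l) * h)"
  proof (intro sum_mono)
    fix n l
    have "2 powr ((p - b) * real n + (\<kappa> - p) * real l) = 2 powr (- (b - p) * real n) * 2 powr (- (p - \<kappa>) * real l)"
      unfolding powr_add[symmetric] by simp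
    then show "multiscale_term p q b \<kappa> h n l \<le> 2 powr (- (b - p) * real n) * 2 powr (- (p - \<kappa>) * real l) * h"
      by (simp only: multiscale_term_eq[OF assms(3)] min.cobounded2)
  qed
  also have "\<dots> = (\<Sum>n\<in>S. 2 powr (- (b - p) * real n)) * (\<Sum>l\<in>S'. 2 powr (- (p - \<kappa>) * real l)) * h"
    by (subst sum_product) (simp only: sum_distrib_right)
  also have "\<dots> \<le> 1 / (1 - 2 powr - (b - p)) * (1 / (1 - 2 powr - (p - \<kappa>))) * h"
    using assms powr_less_one[of 2 "- (b - p)"]
    by (intro mult_right_mono mult_mono sum_two_powr_le sum_nonneg) auto
  finally show ?thesis .
qed

text \<open>
  Fluctuations increase with the shell and masses decrease. Summing over shells first balances the two at \<open>2 ^ n\<close> of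
  order \<open>(2 powr (\<kappa> * l) * h) powr (- 1 / (q - b))\<close>; what remains decays in \<open>l\<close>, also when
  \<open>\<kappa> = p\<close>, which is why the critical dimension carries no logarithm here.
\<close>

lemma multiscale_sum_heavy_tail:
  assumes "b < p" "p < q" "0 < p" "\<kappa> * (q - p) < p * (q - b)" "h > 0" "finite S" "finite S'"
  shows "(\<Sum>n\<in>S. \<Sum>l\<in>S'. multiscale_term p q b \<kappa> h n l)
           \<le> two_sided_const (p - b) (q - p) * (1 / (1 - 2 powr - ((p * (q - b) - \<kappa> * (q - p)) / (q - b))))
               * h powr ((q - p) / (q - b))"
proof -
  have "(\<Sum>n\<in>S. \<Sum>l\<in>S'. multiscale_term p q b \<kappa> h n l)
      = (\<Sum>l\<in>S'. \<Sum>n\<in>S. min (2 powr (- (q - p) * real n - p * real l)) (2 powr ((p - b) * real n + (\<kappa> - p) * real l) * h))"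
    by (subst sum.swap) (simp add: multiscale_term_eq[OF \<open>h > 0\<close>])
  also have "\<dots> \<le> two_sided_const (p - b) (q - p) *
      (1 / (1 - 2 powr - (((p - b) * p - (\<kappa> - p) * (q - p)) / (p - b + (q - p))))) * h powr ((q - p) / (p - b + (q - p)))"
    using assms by (intro double_sum_min_two_powr_le) (auto simp: algebra_simps)
  also have "(p - b) * p - (\<kappa> - p) * (q - p) = p * (q - b) - \<kappa> * (q - p)" by (simp add: algebra_simps)
  also have "p - b + (q - p) = q - b" by simp
  finally show ?thesis .
qed

text \<open>
  Fluctuations increase with the level, because there are many small cells. Summing over levels first balances them with the mass
  of the shell; what remains decays in \<open>n\<close>.
\<close>

lemma multiscale_sum_high_dimension:
  assumes "0 < p" "p < \<kappa>" "p * (q - b) < \<kappa> * (q - p)" "h > 0" "finite S" "finite S'"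
  shows "(\<Sum>n\<in>S. \<Sum>l\<in>S'. multiscale_term p q b \<kappa> h n l)
           \<le> two_sided_const (\<kappa> - p) p * (1 / (1 - 2 powr - ((\<kappa> * (q - p) - p * (q - b)) / \<kappa>)))
               * h powr (p / \<kappa>)"
proof -
  have "(\<Sum>n\<in>S. \<Sum>l\<in>S'. multiscale_term p q b \<kappa> h n l)
      = (\<Sum>n\<in>S. \<Sum>l\<in>S'. min (2 powr (- p * real l - (q - p) * real n)) (2 powr ((\<kappa> - p) * real l + (p - b) * real n) * h))"
    by (simp add: multiscale_term_eq[OF \<open>h > 0\<close>] algebra_simps)
  also have "\<dots> \<le> two_sided_const (\<kappa> - p) p *
      (1 / (1 - 2 powr - (((\<kappa> - p) * (q - p) - (p - b) * p) / (\<kappa> - p + p)))) * h powr (p / (\<kappa> - p + p))"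
    using assms by (intro double_sum_min_two_powr_le) (auto simp: algebra_simps)
  also have "(\<kappa> - p) * (q - p) - (p - b) * p = \<kappa> * (q - p) - p * (q - b)" by (simp add: algebra_simps)
  also have "\<kappa> - p + p = \<kappa>" by simp
  finally show ?thesis .
qed

text \<open>
  Up to level \<open>log 2 (1 / h) / p\<close> every term equals \<open>h\<close>, and from there on the terms decay: the number
  of levels before the crossing is the logarithm in the critical rate.
\<close>

lemma sum_min_two_powr_const_le:
  fixes p h :: real
  assumes "p > 0" "0 < h" "h \<le> 1" "finite S"
  shows "(\<Sum>l\<in>S. min (2 powr (- p * real l)) h)
           \<le> h * (1 + 1 / (1 - 2 powr - p) + ln (1 / h) / (p * ln 2))"
proof -
  define z where "z = ln (1 / h) / (p * ln 2)"
  have z0: "z \<ge> 0" using assms by (simp add: z_def)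
  have hz: "h = 2 powr (- p * z)"
  proof -
    have "- p * z * ln 2 = ln h" using assms by (simp add: z_def ln_div)
    then show ?thesis using assms by (simp add: powr_def)
  qed
  let ?S1 = "{l\<in>S. real l \<le> z}" and ?S2 = "{l\<in>S. \<not> real l \<le> z}"
  let ?f = "\<lambda>l. min (2 powr (- p * real l)) h"
  have "(\<Sum>l\<in>S. ?f l) = (\<Sum>l\<in>?S1. ?f l) + (\<Sum>l\<in>?S2. ?f l)"
    using assms by (subst sum.union_disjoint[symmetric]) (auto intro!: sum.cong)
  also have "\<dots> \<le> (\<Sum>l\<in>?S1. h) + (\<Sum>l\<in>?S2. h * 2 powr (- p * (real l - z)))"
  proof (intro add_mono sum_mono)
    fix l
    have "2 powr (- p * real l) = h * 2 powr (- p * (real l - z))"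
      by (subst hz) (simp add: powr_add[symmetric] algebra_simps)
    then show "?f l \<le> h * 2 powr (- p * (real l - z))" by simp
  qed simp
  also have "\<dots> \<le> h * (z + 1) + h * (1 / (1 - 2 powr - p))"
  proof (intro add_mono)
    have "?S1 \<subseteq> {..nat \<lfloor>z\<rfloor>}" by (auto simp: le_nat_floor)
    then have "card ?S1 \<le> Suc (nat \<lfloor>z\<rfloor>)" using card_mono[of "{..nat \<lfloor>z\<rfloor>}" ?S1] by simp
    then have "real (card ?S1) \<le> z + 1" using z0 by linarith
    then show "(\<Sum>l\<in>?S1. h) \<le> h * (z + 1)" using assms by (simp add: mult.commute)
    show "(\<Sum>l\<in>?S2. h * 2 powr (- p * (real l - z))) \<le> h * (1 / (1 - 2 powr - p))"
      unfolding sum_distrib_left[symmetric] using assms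
      by (intro mult_left_mono sum_two_powr_above_le) auto
  qed
  finally show ?thesis by (simp add: z_def algebra_simps)
qed

text \<open>
  With \<open>\<kappa> = p\<close> the diameters compensate the number of cells exactly, so their product is constant in
  \<open>l\<close>. The factor \<open>2 powr (- (b - p) * n)\<close> makes the sum over shells converge.
\<close>

lemma multiscale_sum_critical_dimension:
  assumes "0 < p" "p < b" "b < q" "0 < h" "finite S" "finite S'"
  shows "(\<Sum>n\<in>S. \<Sum>l\<in>S'. multiscale_term p q b p h n l)
           \<le> 1 / (1 - 2 powr - (b - p)) *
               (min h 1 * (1 + 1 / (1 - 2 powr - p) + ln (1 / min h 1) / (p * ln 2)))"
proof -
  have *: "multiscale_term p q b p h n l \<le> 2 powr (- (b - p) * real n) * min (2 powr (- p * real l)) (min h 1)"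
    for n l
  proof -
    have "min (2 powr (- p * real l)) (min h 1) = min (2 powr (- p * real l)) h"
      using powr_mono[of "- p * real l" 0 2] assms by (auto simp: min_def)
    moreover have "2 powr ((p - q) * real n - p * real l) \<le> 2 powr (- (b - p) * real n) * 2 powr (- p * real l)"
      unfolding powr_add[symmetric] using assms mult_right_mono[of b q "real n"]
      by (intro powr_mono) (auto simp: algebra_simps)
    ultimately show ?thesis
      unfolding multiscale_term_eq[OF assms(4)] by (auto simp: min_mult_distrib_left min_le_iff_disj)
  qed
  have "(\<Sum>n\<in>S. \<Sum>l\<in>S'. multiscale_term p q b p h n l)
     \<le> (\<Sum>n\<in>S. \<Sum>l\<in>S'. 2 powr (- (b - p) * real n) * min (2 powr (- p * real l)) (min h 1))"
    by (intro sum_mono *)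
  also have "\<dots> = (\<Sum>n\<in>S. 2 powr (- (b - p) * real n)) * (\<Sum>l\<in>S'. min (2 powr (- p * real l)) (min h 1))"
    by (simp add: sum_product)
  also have "\<dots> \<le> 1 / (1 - 2 powr - (b - p)) *
               (min h 1 * (1 + 1 / (1 - 2 powr - p) + ln (1 / min h 1) / (p * ln 2)))"
    using assms powr_less_one[of 2 "- (b - p)"]
    by (intro mult_mono sum_two_powr_le sum_min_two_powr_const_le sum_nonneg) auto
  finally show ?thesis .
qed

section \<open>Couplings adapted to a laminar family\<close>

text \<open>
  A greedy algorithm: among all pairs \<open>(i, j)\<close> with supply left at \<open>i\<close> and demand left at
  \<open>j\<close>, ship as much as possible along one contained in the largest number of sets of the family. If \<open>C\<close>
  separates the chosen pair, then by laminarity no pair inside \<open>C\<close> is available any more, so all that is still to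
  cross the boundary of \<open>C\<close> is the unavoidable excess of \<open>C\<close>. Each step exhausts a supply or a demand,
  which bounds the number of steps.
\<close>

lemma laminar_transport_matrix:
  fixes a b :: "'i \<Rightarrow> real"
  assumes I: "finite I" and C: "finite \<C>" "\<And>C. C \<in> \<C> \<Longrightarrow> C \<subseteq> I"
    and laminar: "\<And>C D. C \<in> \<C> \<Longrightarrow> D \<in> \<C> \<Longrightarrow> C \<subseteq> D \<or> D \<subseteq> C \<or> C \<inter> D = {}"
    and nonneg: "\<And>i. i \<in> I \<Longrightarrow> 0 \<le> a i" "\<And>i. i \<in> I \<Longrightarrow> 0 \<le> b i"
    and mass: "sum a I = sum b I"
  shows "\<exists>w. (\<forall>i j. 0 \<le> w i j) \<and> (\<forall>i\<in>I. (\<Sum>j\<in>I. w i j) = a i) \<and> (\<forall>j\<in>I. (\<Sum>i\<in>I. w i j) = b j) \<and>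
             (\<forall>C\<in>\<C>. (\<Sum>i\<in>C. \<Sum>j\<in>I - C. w i j) \<le> max 0 (sum a C - sum b C))"
  using nonneg mass
proof (induction "card {i\<in>I. a i \<noteq> 0} + card {i\<in>I. b i \<noteq> 0}" arbitrary: a b rule: less_induct)
  case less
  define Q where "Q = {(i, j). i \<in> I \<and> j \<in> I \<and> a i > 0 \<and> b j > 0}"
  show ?case
  proof (cases "Q = {}")
    case True
    have "(\<forall>i\<in>I. a i = 0) \<or> (\<forall>i\<in>I. b i = 0)"
      using True less.prems unfolding Q_def by (fastforce simp: order_le_less)
    then have "sum a I = 0" "sum b I = 0"
      using less.prems(3) by (metis sum.neutral)+
    then have "\<forall>i\<in>I. a i = 0" "\<forall>i\<in>I. b i = 0"
      using less.prems I by (simp_all add: sum_nonneg_eq_0_iff)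
    then show ?thesis by (intro exI[of _ "\<lambda>_ _. 0"]) auto
  next
    case False
    define N where "N i j = card {C\<in>\<C>. i \<in> C \<and> j \<in> C}" for i j
    have "finite Q" unfolding Q_def by (rule finite_subset[of _ "I \<times> I"]) (use I in auto)
    then have "Max (case_prod N ` Q) \<in> case_prod N ` Q" using False by (intro Max_in) auto
    then obtain i j where ij: "(i, j) \<in> Q" and max: "N i j = Max (case_prod N ` Q)" by auto
    have N_le: "N x y \<le> N i j" if "x \<in> I" "y \<in> I" "a x > 0" "b y > 0" for x y
      unfolding max using that \<open>finite Q\<close> by (intro Max_ge) (auto simp: Q_def intro!: image_eqI[of _ _ "(x, y)"])
    from ij have i: "i \<in> I" "a i > 0" and j: "j \<in> I" "b j > 0" by (auto simp: Q_def)
    define m where "m = min (a i) (b j)"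
    have m: "m > 0" "m \<le> a i" "m \<le> b j" using i j by (auto simp: m_def)
    define a' where "a' = (\<lambda>x. a x - (if x = i then m else 0))"
    define b' where "b' = (\<lambda>x. b x - (if x = j then m else 0))"
    have a'0: "0 \<le> a' x" and b'0: "0 \<le> b' x" if "x \<in> I" for x
      using less.prems(1,2)[OF that] m by (auto simp: a'_def b'_def)
    have sum_a': "sum a' C = sum a C - (if i \<in> C then m else 0)"
      and sum_b': "sum b' C = sum b C - (if j \<in> C then m else 0)" if "C \<subseteq> I" for C
      using finite_subset[OF that I] by (simp_all add: a'_def b'_def sum_subtractf)
    have fin: "finite {x\<in>I. a x \<noteq> 0}" "finite {x\<in>I. b x \<noteq> 0}" using I by auto
    have sub: "{x\<in>I. a' x \<noteq> 0} \<subseteq> {x\<in>I. a x \<noteq> 0}" "{x\<in>I. b' x \<noteq> 0} \<subseteq> {x\<in>I. b x \<noteq> 0}"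
      using i j by (auto simp: a'_def b'_def split: if_splits)
    have "a' i = 0 \<or> b' j = 0" by (auto simp: a'_def b'_def m_def)
    then have "{x\<in>I. a' x \<noteq> 0} \<subset> {x\<in>I. a x \<noteq> 0} \<or> {x\<in>I. b' x \<noteq> 0} \<subset> {x\<in>I. b x \<noteq> 0}"
      using sub i j by force
    then have dec: "card {x\<in>I. a' x \<noteq> 0} + card {x\<in>I. b' x \<noteq> 0}
        < card {x\<in>I. a x \<noteq> 0} + card {x\<in>I. b x \<noteq> 0}"
      using psubset_card_mono[OF fin(1)] psubset_card_mono[OF fin(2)]
        card_mono[OF fin(1) sub(1)] card_mono[OF fin(2) sub(2)]
      by (meson add_le_less_mono add_less_le_mono)
    have "sum a' I = sum b' I" using less.prems(3) i j by (simp add: sum_a' sum_b')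
    from less.hyps[OF dec a'0 b'0 this] obtain w
      where w0: "\<And>i j. 0 \<le> w i j" and w1: "\<And>i. i \<in> I \<Longrightarrow> (\<Sum>j\<in>I. w i j) = a' i"
        and w2: "\<And>j. j \<in> I \<Longrightarrow> (\<Sum>i\<in>I. w i j) = b' j"
        and w3: "\<And>C. C \<in> \<C> \<Longrightarrow> (\<Sum>i\<in>C. \<Sum>j\<in>I - C. w i j) \<le> max 0 (sum a' C - sum b' C)"
      by blast
    define v where "v = (\<lambda>x y. w x y + (if x = i then if y = j then m else 0 else 0))"
    have v_sum: "(\<Sum>x\<in>A. \<Sum>y\<in>B. v x y) = (\<Sum>x\<in>A. \<Sum>y\<in>B. w x y) + (if i \<in> A \<and> j \<in> B then m else 0)"
      if "A \<subseteq> I" "B \<subseteq> I" for A B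
    proof -
      have f: "finite A" "finite B" using that I by (auto intro: finite_subset)
      have "(\<Sum>y\<in>B. v x y) = (\<Sum>y\<in>B. w x y) + (if x = i then if j \<in> B then m else 0 else 0)" for x
        using f(2) by (simp add: v_def sum.distrib)
      then show ?thesis using f(1) by (simp add: sum.distrib)
    qed
    have v1: "(\<Sum>y\<in>I. v x y) = a x" if "x \<in> I" for x
      using w1[OF that] I j by (auto simp: v_def sum.distrib a'_def)
    have v2: "(\<Sum>x\<in>I. v x y) = b y" if "y \<in> I" for y
      using w2[OF that] I i by (cases "y = j") (auto simp: v_def sum.distrib b'_def)
    have v3: "(\<Sum>x\<in>C. \<Sum>y\<in>I - C. v x y) \<le> max 0 (sum a C - sum b C)" if "C \<in> \<C>" for C
    proof -
      have CI: "C \<subseteq> I" using C that by auto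
      have eq: "(\<Sum>x\<in>C. \<Sum>y\<in>I - C. v x y) = (\<Sum>x\<in>C. \<Sum>y\<in>I - C. w x y) + (if i \<in> C \<and> j \<notin> C then m else 0)"
        using v_sum[OF CI, of "I - C"] j by auto
      note w3C = w3[OF that, unfolded sum_a'[OF CI] sum_b'[OF CI]]
      consider "i \<in> C \<longleftrightarrow> j \<in> C" | "i \<in> C" "j \<notin> C" | "i \<notin> C" "j \<in> C" by auto
      then show ?thesis
      proof cases
        case 1
        then show ?thesis using w3C unfolding eq by (auto split: if_splits)
      next
        case 2
        \<comment> \<open>An available \<open>y\<close> in \<open>C\<close> would share with \<open>i\<close> all sets shared by \<open>i\<close> and \<open>j\<close>, and \<open>C\<close> in addition.\<close>
        have "b y = 0" if y: "y \<in> C" for y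
        proof (rule ccontr)
          assume "b y \<noteq> 0"
          then have by0: "b y > 0" and yI: "y \<in> I" using y CI less.prems(2)[of y] by auto
          have "{D\<in>\<C>. i \<in> D \<and> j \<in> D} \<subset> {D\<in>\<C>. i \<in> D \<and> y \<in> D}"
            using laminar[OF \<open>C \<in> \<C>\<close>] 2 y \<open>C \<in> \<C>\<close> by blast
          then have "N i j < N i y" unfolding N_def using C(1) by (intro psubset_card_mono) auto
          then show False using N_le[OF i(1) yI i(2) by0] by simp
        qed
        then have "sum b C = 0" by simp
        moreover have "sum a' C \<ge> 0" using a'0 CI by (intro sum_nonneg) auto
        ultimately show ?thesis using w3C 2 sum_a'[OF CI] unfolding eq by auto
      next
        case 3
        have "a y = 0" if y: "y \<in> C" for y
        proof (rule ccontr)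
          assume "a y \<noteq> 0"
          then have by0: "a y > 0" and yI: "y \<in> I" using y CI less.prems(1)[of y] by auto
          have "{D\<in>\<C>. i \<in> D \<and> j \<in> D} \<subset> {D\<in>\<C>. y \<in> D \<and> j \<in> D}"
            using laminar[OF \<open>C \<in> \<C>\<close>] 3 y \<open>C \<in> \<C>\<close> by blast
          then have "N i j < N y j" unfolding N_def using C(1) by (intro psubset_card_mono) auto
          then show False using N_le[OF yI j(1) by0 j(2)] by simp
        qed
        then have "sum a C = 0" by simp
        moreover have "sum b' C \<ge> 0" using b'0 CI by (intro sum_nonneg) auto
        ultimately show ?thesis using w3C 3 sum_b'[OF CI] unfolding eq by auto
      qed
    qed
    have "0 \<le> v x y" for x y using w0[of x y] m(1) by (simp add: v_def)
    then show ?thesis using v1 v2 v3 by blast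
  qed
qed

text \<open>
  A density that is constant on products of cells is used to turn a transport matrix into a measure; on rectangles that measure is
  a finite sum.
\<close>

lemma emeasure_rectangle_step_density:
  fixes g :: "'a::topological_space \<Rightarrow> 'i" and W :: "'i \<Rightarrow> 'i \<Rightarrow> real"
  assumes fs: "finite I" "range g \<subseteq> I" and cells: "\<And>i. g -` {i} \<in> sets borel"
    and "prob_space \<mu>" "prob_space \<nu>" and sets[simp]: "sets \<mu> = sets borel" "sets \<nu> = sets borel"
    and W: "\<And>i j. 0 \<le> W i j"
    and AB: "A \<in> sets (borel :: 'a measure)" "B \<in> sets borel"
  shows "(\<lambda>z. ennreal (W (g (fst z)) (g (snd z)))) \<in> borel_measurable (\<mu> \<Otimes>\<^sub>M \<nu>)" (is ?m)
    and "emeasure (density (\<mu> \<Otimes>\<^sub>M \<nu>) (\<lambda>z. ennreal (W (g (fst z)) (g (snd z))))) (A \<times> B)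
      = ennreal (\<Sum>i\<in>I. \<Sum>j\<in>I. W i j * (measure \<mu> (A \<inter> g -` {i}) * measure \<nu> (B \<inter> g -` {j})))" (is ?e)
proof -
  interpret m: prob_space \<mu> by fact
  interpret n: prob_space \<nu> by fact
  have step: "ennreal (W (g x) (g y)) * indicator (A \<times> B) (x, y)
      = (\<Sum>i\<in>I. \<Sum>j\<in>I. ennreal (W i j) * indicator ((A \<inter> g -` {i}) \<times> (B \<inter> g -` {j})) (x, y))" for x y A B
  proof -
    have "(\<Sum>i\<in>I. \<Sum>j\<in>I. ennreal (W i j) * indicator ((A \<inter> g -` {i}) \<times> (B \<inter> g -` {j})) (x, y))
        = (\<Sum>i\<in>I. \<Sum>j\<in>I. if i = g x then if j = g y then ennreal (W i j) * indicator (A \<times> B) (x, y) else 0 else 0)"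
      by (intro sum.cong refl) (auto simp: indicator_def)
    also have "\<dots> = (\<Sum>i\<in>I. if i = g x then ennreal (W i (g y)) * indicator (A \<times> B) (x, y) else 0)"
    proof (intro sum.cong refl)
      fix i
      have "(\<Sum>j\<in>I. if j = g y then ennreal (W i j) * indicator (A \<times> B) (x, y) else 0)
        = ennreal (W i (g y)) * indicator (A \<times> B) (x, y)"
        using fs by (subst sum.delta) auto
      then show "(\<Sum>j\<in>I. if i = g x then if j = g y then ennreal (W i j) * indicator (A \<times> B) (x, y) else 0 else 0)
         = (if i = g x then ennreal (W i (g y)) * indicator (A \<times> B) (x, y) else 0)"
        by (cases "i = g x") simp_all
    qed
    also have "\<dots> = ennreal (W (g x) (g y)) * indicator (A \<times> B) (x, y)"
      using fs by (subst sum.delta) auto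
    finally show ?thesis ..
  qed
  have rect: "(A \<inter> g -` {i}) \<times> (B \<inter> g -` {j}) \<in> sets (\<mu> \<Otimes>\<^sub>M \<nu>)"
    if "A \<in> sets borel" "B \<in> sets borel" for i j A B
    using cells that by (intro pair_measureI) auto
  have meas: "(\<lambda>z. ennreal (W i j) * indicator ((A \<inter> g -` {i}) \<times> (B \<inter> g -` {j})) z)
      \<in> borel_measurable (\<mu> \<Otimes>\<^sub>M \<nu>)" if "A \<in> sets borel" "B \<in> sets borel" for i j A B
    by (intro borel_measurable_times_ennreal borel_measurable_const borel_measurable_indicator rect that)
  show m: ?m
  proof -
    have "(\<lambda>z. ennreal (W (g (fst z)) (g (snd z))))
      = (\<lambda>z. \<Sum>i\<in>I. \<Sum>j\<in>I. ennreal (W i j) * indicator ((UNIV \<inter> g -` {i}) \<times> (UNIV \<inter> g -` {j})) z)"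
      using step[of _ _ UNIV UNIV] by auto
    also have "\<dots> \<in> borel_measurable (\<mu> \<Otimes>\<^sub>M \<nu>)"
      by (intro borel_measurable_sum meas) auto
    finally show ?thesis .
  qed
  have "emeasure (density (\<mu> \<Otimes>\<^sub>M \<nu>) (\<lambda>z. ennreal (W (g (fst z)) (g (snd z))))) (A \<times> B)
     = (\<integral>\<^sup>+z. ennreal (W (g (fst z)) (g (snd z))) * indicator (A \<times> B) z \<partial>(\<mu> \<Otimes>\<^sub>M \<nu>))"
    using AB by (intro emeasure_density[OF m]) (auto intro!: pair_measureI)
  also have "\<dots> = (\<integral>\<^sup>+z. (\<Sum>i\<in>I. \<Sum>j\<in>I. ennreal (W i j) * indicator ((A \<inter> g -` {i}) \<times> (B \<inter> g -` {j})) z) \<partial>(\<mu> \<Otimes>\<^sub>M \<nu>))"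
    using step by (intro nn_integral_cong) auto
  also have "\<dots> = (\<Sum>i\<in>I. \<integral>\<^sup>+z. (\<Sum>j\<in>I. ennreal (W i j) * indicator ((A \<inter> g -` {i}) \<times> (B \<inter> g -` {j})) z) \<partial>(\<mu> \<Otimes>\<^sub>M \<nu>))"
    by (intro nn_integral_sum borel_measurable_sum meas AB)
  also have "\<dots> = (\<Sum>i\<in>I. \<Sum>j\<in>I. \<integral>\<^sup>+z. ennreal (W i j) * indicator ((A \<inter> g -` {i}) \<times> (B \<inter> g -` {j})) z \<partial>(\<mu> \<Otimes>\<^sub>M \<nu>))"
    by (intro sum.cong refl nn_integral_sum meas AB)
  also have "\<dots> = (\<Sum>i\<in>I. \<Sum>j\<in>I. ennreal (W i j) * emeasure (\<mu> \<Otimes>\<^sub>M \<nu>) ((A \<inter> g -` {i}) \<times> (B \<inter> g -` {j})))"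
    by (simp only: nn_integral_cmult_indicator[OF rect[OF AB]])
  also have "\<dots> = (\<Sum>i\<in>I. \<Sum>j\<in>I. ennreal (W i j * (measure \<mu> (A \<inter> g -` {i}) * measure \<nu> (B \<inter> g -` {j}))))"
    using cells AB W
    by (intro sum.cong refl)
       (simp add: n.emeasure_pair_measure_Times m.emeasure_eq_measure n.emeasure_eq_measure ennreal_mult)
  also have "\<dots> = ennreal (\<Sum>i\<in>I. \<Sum>j\<in>I. W i j * (measure \<mu> (A \<inter> g -` {i}) * measure \<nu> (B \<inter> g -` {j})))"
    using W by (simp add: sum_ennreal sum_nonneg)
  finally show ?e .
qed


text \<open>
  Conversion of a matrix into densities: dividing entry \<open>(i, j)\<close> by the masses of cells \<open>i\<close> and
  \<open>j\<close> preserves the marginals, including the cells of mass zero, where a quotient is zero by convention and so is the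
  matrix entry.
\<close>

lemma sum_normalized_row:
  fixes w :: "'i \<Rightarrow> 'i \<Rightarrow> real"
  assumes "(\<Sum>j\<in>I. w i j) = a" "0 \<le> u" "u \<le> a" "\<And>j. j \<in> I \<Longrightarrow> b j = 0 \<Longrightarrow> w i j = 0"
  shows "(\<Sum>j\<in>I. w i j / (a * b j) * (u * b j)) = u"
proof (cases "a = 0")
  case False
  have "(\<Sum>j\<in>I. w i j / (a * b j) * (u * b j)) = (\<Sum>j\<in>I. w i j * (u / a))"
    using assms(4) by (intro sum.cong refl) auto
  also have "\<dots> = u" unfolding sum_distrib_right[symmetric] assms(1) using False by simp
  finally show ?thesis .
qed (use assms in simp)

text \<open>
  The atoms of the family, indexed by the collection \<open>g x\<close> of members that contain \<open>x\<close>, turn it into a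
  laminar family on a finite set, to which the greedy transport applies. Moving mass between two atoms as a product measure gives
  a coupling, because which members of the family contain a point depends only on its atom. Every coupling must carry at least the
  excess of \<open>C\<close> across its boundary; the point is that one coupling achieves this for all members at once.
\<close>

theorem laminar_coupling:
  fixes \<mu> \<nu> :: "'a::euclidean_space measure"
  assumes \<mu>: "\<mu> \<in> space (prob_algebra borel)" and \<nu>: "\<nu> \<in> space (prob_algebra borel)"
    and \<C>: "finite \<C>" "\<C> \<subseteq> sets borel"
    and laminar: "\<And>C D. C \<in> \<C> \<Longrightarrow> D \<in> \<C> \<Longrightarrow> C \<subseteq> D \<or> D \<subseteq> C \<or> C \<inter> D = {}"
  shows "\<exists>\<pi>\<in>couplings \<mu> \<nu>. \<forall>C\<in>\<C>. measure \<pi> (C \<times> - C) \<le> \<bar>measure \<mu> C - measure \<nu> C\<bar> \<and>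
                              measure \<pi> ((- C) \<times> C) \<le> \<bar>measure \<mu> C - measure \<nu> C\<bar>"
proof -
  have sets[simp]: "sets \<mu> = sets borel" "sets \<nu> = sets borel" and "prob_space \<mu>" "prob_space \<nu>"
    using \<mu> \<nu> by (auto simp: space_prob_algebra)
  interpret m: prob_space \<mu> by fact
  interpret n: prob_space \<nu> by fact
  have sp[simp]: "space \<mu> = UNIV" "space \<nu> = UNIV"
    using sets_eq_imp_space_eq[OF sets(1)] sets_eq_imp_space_eq[OF sets(2)] by auto
  define g where "g x = {C\<in>\<C>. x \<in> C}" for x
  define I where "I = range g"
  have finI: "finite I" unfolding I_def g_def
    by (rule finite_subset[of _ "Pow \<C>"]) (use \<C> in auto)
  define cell where "cell i = g -` {i}" for i
  have cell: "cell i \<in> sets borel" for i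
  proof (cases "i \<subseteq> \<C>")
    case True
    then have "cell i = (\<Inter>C\<in>\<C>. if C \<in> i then C else - C)"
      unfolding cell_def g_def by (auto split: if_splits)
    also have "\<dots> \<in> sets borel"
    proof (cases "\<C> = {}")
      case False
      show ?thesis
      proof (rule sets.finite_INT)
        fix C assume "C \<in> \<C>"
        then have "C \<in> sets borel" using \<C> by auto
        then show "(if C \<in> i then C else - C) \<in> sets borel" by (auto intro: borel_comp)
      qed (use \<C> False in auto)
    qed simp
    finally show ?thesis .
  next
    case False
    then have "cell i = {}" unfolding cell_def g_def by auto
    then show ?thesis by simp
  qed
  have cellsum: "(\<Sum>i\<in>J. measure M (A \<inter> cell i)) = measure M (A \<inter> g -` J)"
    if "J \<subseteq> I" "sets M = sets borel" "A \<in> sets borel" "prob_space M" for J A and M :: "'a measure"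
  proof -
    interpret prob_space M by fact
    have "(\<Union>i\<in>J. A \<inter> cell i) = A \<inter> g -` J" by (auto simp: cell_def)
    moreover have "measure M (\<Union>i\<in>J. A \<inter> cell i) = (\<Sum>i\<in>J. measure M (A \<inter> cell i))"
      using that cell finite_subset[OF that(1) finI]
      by (intro finite_measure_finite_Union) (auto simp: disjoint_family_on_def cell_def)
    ultimately show ?thesis by simp
  qed
  have gI: "g -` I = UNIV" by (auto simp: I_def)
  define a where "a i = measure \<mu> (cell i)" for i
  define b where "b i = measure \<nu> (cell i)" for i
  define K where "K C = {i\<in>I. C \<in> i}" for C
  have K: "g -` K C = C" if "C \<in> \<C>" for C
    using that by (auto simp: K_def I_def g_def)
  have sumK: "sum a (K C) = measure \<mu> C" "sum b (K C) = measure \<nu> C" if "C \<in> \<C>" for C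
    using cellsum[of "K C" \<mu> UNIV] cellsum[of "K C" \<nu> UNIV] K[OF that] \<open>prob_space \<mu>\<close> \<open>prob_space \<nu>\<close>
    by (auto simp: a_def b_def K_def)
  have "\<exists>w. (\<forall>i j. 0 \<le> w i j) \<and> (\<forall>i\<in>I. (\<Sum>j\<in>I. w i j) = a i) \<and> (\<forall>j\<in>I. (\<Sum>i\<in>I. w i j) = b j) \<and>
             (\<forall>C\<in>K ` \<C>. (\<Sum>i\<in>C. \<Sum>j\<in>I - C. w i j) \<le> max 0 (sum a C - sum b C))"
  proof (rule laminar_transport_matrix)
    show "sum a I = sum b I"
      using cellsum[of I \<mu> UNIV] cellsum[of I \<nu> UNIV] \<open>prob_space \<mu>\<close> \<open>prob_space \<nu>\<close>
        m.prob_space n.prob_space by (simp add: a_def b_def gI)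
    show "X \<subseteq> Y \<or> Y \<subseteq> X \<or> X \<inter> Y = {}" if XY: "X \<in> K ` \<C>" "Y \<in> K ` \<C>" for X Y
    proof -
      obtain C D where CD: "C \<in> \<C>" "D \<in> \<C>" "X = K C" "Y = K D" using XY by auto
      have X: "X = g ` C" and Y: "Y = g ` D"
        using CD by (auto simp: K_def I_def g_def image_iff)
      consider "C \<subseteq> D" | "D \<subseteq> C" | "C \<inter> D = {}" using laminar[OF CD(1,2)] by blast
      then show ?thesis
      proof cases
        case 3
        have "X \<inter> Y = {}"
        proof (rule ccontr)
          assume "X \<inter> Y \<noteq> {}"
          then obtain x where "C \<in> g x" "D \<in> g x" using CD by (auto simp: K_def I_def)
          then show False using 3 by (auto simp: g_def)
        qed
        then show ?thesis by simp
      qed (use X Y in auto)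
    qed
  qed (use finI \<C> in \<open>auto simp: a_def b_def K_def\<close>)
  then obtain w where "\<forall>i j. 0 \<le> w i j" and "\<forall>i\<in>I. (\<Sum>j\<in>I. w i j) = a i"
    and "\<forall>j\<in>I. (\<Sum>i\<in>I. w i j) = b j"
    and K_out: "\<forall>C\<in>K ` \<C>. (\<Sum>i\<in>C. \<Sum>j\<in>I - C. w i j) \<le> max 0 (sum a C - sum b C)"
    by blast
  then have w0: "\<And>i j. 0 \<le> w i j" and w1: "\<And>i. i \<in> I \<Longrightarrow> (\<Sum>j\<in>I. w i j) = a i"
    and w2: "\<And>j. j \<in> I \<Longrightarrow> (\<Sum>i\<in>I. w i j) = b j" by blast+
  have w3: "(\<Sum>i\<in>K C. \<Sum>j\<in>I - K C. w i j) \<le> max 0 (measure \<mu> C - measure \<nu> C)" if "C \<in> \<C>" for C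
    using bspec[OF K_out imageI[OF that]] sumK[OF that] by simp
  have a0: "w i j = 0" if "i \<in> I" "j \<in> I" "a i = 0" for i j
    using w1[OF that(1)] that w0 finI by (simp add: sum_nonneg_eq_0_iff)
  have b0: "w i j = 0" if "i \<in> I" "j \<in> I" "b j = 0" for i j
    using w2[OF that(2)] that w0 finI by (simp add: sum_nonneg_eq_0_iff)
  define W where "W i j = w i j / (a i * b j)" for i j
  have W0: "0 \<le> W i j" for i j using w0 by (simp add: W_def a_def b_def)
  have Wab: "W i j * (a i * b j) = w i j" if "i \<in> I" "j \<in> I" for i j
    using a0[OF that] b0[OF that] by (auto simp: W_def)
  define \<pi> where "\<pi> = density (\<mu> \<Otimes>\<^sub>M \<nu>) (\<lambda>z. ennreal (W (g (fst z)) (g (snd z))))"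
  have rect: "emeasure \<pi> (A \<times> B)
      = ennreal (\<Sum>i\<in>I. \<Sum>j\<in>I. W i j * (measure \<mu> (A \<inter> cell i) * measure \<nu> (B \<inter> cell j)))"
    if "A \<in> sets borel" "B \<in> sets borel" for A B
    unfolding \<pi>_def cell_def
    by (rule emeasure_rectangle_step_density)
       (use that finI cell W0 \<open>prob_space \<mu>\<close> \<open>prob_space \<nu>\<close> in \<open>auto simp: I_def cell_def\<close>)
  have sets_\<pi>[measurable_cong]: "sets \<pi> = sets (borel \<Otimes>\<^sub>M borel)"
    unfolding \<pi>_def by (simp cong: sets_pair_measure_cong)
  have marg1: "emeasure \<pi> (A \<times> UNIV) = emeasure \<mu> A" if A: "A \<in> sets borel" for A
  proof -
    have "(\<Sum>i\<in>I. \<Sum>j\<in>I. W i j * (measure \<mu> (A \<inter> cell i) * measure \<nu> (UNIV \<inter> cell j)))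
        = (\<Sum>i\<in>I. measure \<mu> (A \<inter> cell i))"
    proof (intro sum.cong refl)
      fix i assume i: "i \<in> I"
      have "measure \<mu> (A \<inter> cell i) \<le> a i" unfolding a_def using cell by (intro m.finite_measure_mono) auto
      then show "(\<Sum>j\<in>I. W i j * (measure \<mu> (A \<inter> cell i) * measure \<nu> (UNIV \<inter> cell j))) = measure \<mu> (A \<inter> cell i)"
        using sum_normalized_row[where w = w, OF w1[OF i], of _ b] b0[OF i] by (simp add: W_def b_def)
    qed
    also have "\<dots> = measure \<mu> A" using cellsum[of I \<mu> A] A \<open>prob_space \<mu>\<close> by (simp add: gI)
    finally show ?thesis using rect[OF A, of UNIV] by (simp add: m.emeasure_eq_measure)
  qed
  have marg2: "emeasure \<pi> (UNIV \<times> B) = emeasure \<nu> B" if B: "B \<in> sets borel" for B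
  proof -
    have "(\<Sum>i\<in>I. W i j * (measure \<mu> (UNIV \<inter> cell i) * measure \<nu> (B \<inter> cell j))) = measure \<nu> (B \<inter> cell j)"
      if j: "j \<in> I" for j
    proof -
      have "measure \<nu> (B \<inter> cell j) \<le> b j" unfolding b_def using cell by (intro n.finite_measure_mono) auto
      then show ?thesis
        using sum_normalized_row[where w = "\<lambda>j i. w i j", OF w2[OF j], of _ a] a0[OF _ j]
        by (simp add: W_def a_def mult.commute)
    qed
    then have "(\<Sum>i\<in>I. \<Sum>j\<in>I. W i j * (measure \<mu> (UNIV \<inter> cell i) * measure \<nu> (B \<inter> cell j)))
        = (\<Sum>j\<in>I. measure \<nu> (B \<inter> cell j))"
      by (subst sum.swap) simp
    also have "\<dots> = measure \<nu> B" using cellsum[of I \<nu> B] B \<open>prob_space \<nu>\<close> by (simp add: gI)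
    finally show ?thesis using rect[OF _ B, of UNIV] by (simp add: n.emeasure_eq_measure)
  qed
  have sp_\<pi>: "space \<pi> = UNIV" using sets_eq_imp_space_eq[OF sets_\<pi>] by (simp add: space_pair_measure)
  have "emeasure \<pi> (space \<pi>) = 1"
    using marg1[of UNIV] m.emeasure_space_1 by (simp add: sp_\<pi>)
  then interpret p: prob_space \<pi> by (rule prob_spaceI)
  have "distr \<pi> borel fst = \<mu>"
  proof (rule measure_eqI)
    fix A assume "A \<in> sets (distr \<pi> borel fst)"
    then have A: "A \<in> sets borel" by simp
    have "fst -` A \<inter> space \<pi> = A \<times> UNIV" by (auto simp: sp_\<pi>)
    then show "emeasure (distr \<pi> borel fst) A = emeasure \<mu> A"
      using marg1[OF A] A by (subst emeasure_distr) auto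
  qed simp
  moreover have "distr \<pi> borel snd = \<nu>"
  proof (rule measure_eqI)
    fix A assume "A \<in> sets (distr \<pi> borel snd)"
    then have A: "A \<in> sets borel" by simp
    have "snd -` A \<inter> space \<pi> = UNIV \<times> A" by (auto simp: sp_\<pi>)
    then show "emeasure (distr \<pi> borel snd) A = emeasure \<nu> A"
      using marg2[OF A] A by (subst emeasure_distr) auto
  qed simp
  ultimately have coupling: "\<pi> \<in> couplings \<mu> \<nu>"
    using sets_\<pi> p.prob_space_axioms by (simp add: couplings_def space_prob_algebra)
  have out: "measure \<pi> (C \<times> - C) \<le> max 0 (measure \<mu> C - measure \<nu> C)" if "C \<in> \<C>" for C
  proof -
    have Cb: "C \<in> sets borel" using \<C> that by auto
    have C1: "measure \<mu> (C \<inter> cell i) = (if i \<in> K C then a i else 0)"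
      and C2: "measure \<nu> (- C \<inter> cell i) = (if i \<in> I - K C then b i else 0)" if "i \<in> I" for i
    proof -
      have "C \<inter> cell i = (if i \<in> K C then cell i else {})" "- C \<inter> cell i = (if i \<in> I - K C then cell i else {})"
        using \<open>C \<in> \<C>\<close> \<open>i \<in> I\<close> by (auto simp: cell_def K_def g_def)
      then show "measure \<mu> (C \<inter> cell i) = (if i \<in> K C then a i else 0)"
        "measure \<nu> (- C \<inter> cell i) = (if i \<in> I - K C then b i else 0)" by (simp_all add: a_def b_def)
    qed
    have "measure \<pi> (C \<times> - C) = (\<Sum>i\<in>I. \<Sum>j\<in>I. W i j * (measure \<mu> (C \<inter> cell i) * measure \<nu> (- C \<inter> cell j)))"
      using rect[of C "- C"] Cb W0 by (simp add: measure_def sum_nonneg)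
    also have "\<dots> = (\<Sum>i\<in>I. \<Sum>j\<in>I. if i \<in> K C then if j \<in> I - K C then w i j else 0 else 0)"
      by (intro sum.cong refl) (auto simp: C1 C2 Wab)
    also have "\<dots> = (\<Sum>i\<in>K C. \<Sum>j\<in>I - K C. w i j)"
    proof -
      have "(\<Sum>j\<in>I. if i \<in> K C then if j \<in> I - K C then w i j else 0 else 0)
          = (if i \<in> K C then \<Sum>j\<in>I - K C. w i j else 0)" for i
        using finI by (auto simp: sum.If_cases Diff_eq Int_def intro!: sum.cong)
      moreover have "I \<inter> K C = K C" by (auto simp: K_def)
      ultimately show ?thesis using finI by (simp add: sum.inter_restrict[symmetric])
    qed
    also have "\<dots> \<le> max 0 (measure \<mu> C - measure \<nu> C)" by (rule w3[OF that])
    finally show ?thesis .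
  qed
  have "measure \<pi> ((- C) \<times> C) \<le> \<bar>measure \<mu> C - measure \<nu> C\<bar>" if "C \<in> \<C>" for C
  proof -
    have Cb: "C \<in> sets borel" using \<C> that by auto
    have r: "A \<in> sets borel \<Longrightarrow> B \<in> sets borel \<Longrightarrow> A \<times> B \<in> sets \<pi>" for A B
      unfolding sets_\<pi> by (rule pair_measureI)
    have "measure \<pi> (UNIV \<times> C) = measure \<pi> (C \<times> C) + measure \<pi> ((- C) \<times> C)"
      using Cb r by (subst p.finite_measure_Union[symmetric]) (auto intro: arg_cong2[where f = measure])
    moreover have "measure \<pi> (C \<times> UNIV) = measure \<pi> (C \<times> C) + measure \<pi> (C \<times> - C)"
      using Cb r by (subst p.finite_measure_Union[symmetric]) (auto intro: arg_cong2[where f = measure])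
    moreover have "measure \<pi> (UNIV \<times> C) = measure \<nu> C" "measure \<pi> (C \<times> UNIV) = measure \<mu> C"
      using marg1[OF Cb] marg2[OF Cb] by (simp_all add: measure_def)
    ultimately show ?thesis using out[OF that] by linarith
  qed
  moreover have "measure \<pi> (C \<times> - C) \<le> \<bar>measure \<mu> C - measure \<nu> C\<bar>" if "C \<in> \<C>" for C
    using out[OF that] by linarith
  ultimately show ?thesis using coupling by blast
qed

section \<open>Dyadic upper bound of Wasserstein distances\<close>

fun dyadic_shell :: "nat \<Rightarrow> 'a::euclidean_space set" where
  "dyadic_shell 0 = {x. norm x \<le> 1}"
| "dyadic_shell (Suc n) = {x. 2 ^ n < norm x \<and> norm x \<le> 2 ^ Suc n}"

text \<open>
  The coordinates of \<open>x\<close> in the lattice of mesh \<open>2 ^ n / 2 ^ l\<close>, proportional to the size of the shell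
  it is used in. The restriction to \<open>Basis\<close> makes the indices that occur a finite set of functions.
\<close>

definition dyadic_grid :: "nat \<Rightarrow> nat \<Rightarrow> 'a::euclidean_space \<Rightarrow> 'a \<Rightarrow> int" where
  "dyadic_grid n l x = (\<lambda>b\<in>Basis. \<lfloor>2 ^ l * ((x \<bullet> b) / 2 ^ n)\<rfloor>)"

definition dyadic_cell :: "nat \<Rightarrow> nat \<Rightarrow> ('a \<Rightarrow> int) \<Rightarrow> 'a::euclidean_space set" where
  "dyadic_cell n l z = {x \<in> dyadic_shell n. dyadic_grid n l x = z}"

definition dyadic_indices :: "nat \<Rightarrow> ('a::euclidean_space \<Rightarrow> int) set" where
  "dyadic_indices l = (\<Pi>\<^sub>E b\<in>Basis. {- (2 ^ l)..2 ^ l})"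

lemma norm_dyadic_shell: "x \<in> dyadic_shell n \<Longrightarrow> norm x \<le> 2 ^ n"
  by (cases n) auto

lemma dyadic_shell_disjoint: "n \<noteq> m \<Longrightarrow> dyadic_shell n \<inter> dyadic_shell m = {}"
proof (induction n m rule: linorder_wlog)
  case (le n m)
  then obtain k where m: "m = Suc k" and "n \<le> k" by (cases m) auto
  then have "(2::real) ^ n \<le> 2 ^ k" by (intro power_increasing) auto
  then have "norm x \<le> 2 ^ k" if "x \<in> dyadic_shell n" for x :: 'a
    using norm_dyadic_shell[OF that] by linarith
  then show ?case by (fastforce simp: m)
qed auto

lemma in_dyadic_shell_exists:
  assumes "norm x \<le> 2 ^ N"
  obtains n where "n \<le> N" "x \<in> dyadic_shell n"
proof -
  define n where "n = (LEAST n. norm x \<le> 2 ^ n)"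
  have n: "norm x \<le> 2 ^ n" unfolding n_def by (rule LeastI[of _ N]) (fact assms)
  have "n \<le> N" unfolding n_def by (rule Least_le) (fact assms)
  moreover have "x \<in> dyadic_shell n"
  proof (cases n)
    case (Suc m)
    then have "\<not> norm x \<le> 2 ^ m" unfolding n_def by (intro not_less_Least) auto
    then show ?thesis using n Suc by auto
  qed (use n in auto)
  ultimately show ?thesis by (rule that)
qed

lemma dyadic_shell_borel[measurable]: "dyadic_shell n \<in> sets borel"
  by (cases n) auto

lemma dyadic_cell_borel[measurable]: "dyadic_cell n l (z :: 'a::euclidean_space \<Rightarrow> int) \<in> sets borel"
proof (cases "z \<in> extensional Basis")
  case True
  have "dyadic_grid n l x = z \<longleftrightarrow> (\<forall>b\<in>Basis. \<lfloor>2 ^ l * ((x \<bullet> b) / 2 ^ n)\<rfloor> = z b)" for x :: 'a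
    using True by (auto simp: dyadic_grid_def intro!: extensionalityI[of _ Basis])
  then have "dyadic_cell n l z
      = dyadic_shell n \<inter> (\<Inter>b\<in>Basis. {x. of_int (z b) \<le> 2 ^ l * ((x \<bullet> b) / 2 ^ n) \<and>
            2 ^ l * ((x \<bullet> b) / 2 ^ n) < of_int (z b) + 1})"
    unfolding dyadic_cell_def by (auto simp: floor_eq_iff)
  also have "\<dots> \<in> sets borel"
  proof (intro sets.Int sets.finite_INT)
    fix b :: 'a
    show "{x. of_int (z b) \<le> 2 ^ l * ((x \<bullet> b) / 2 ^ n) \<and> 2 ^ l * ((x \<bullet> b) / 2 ^ n) < of_int (z b) + 1} \<in> sets borel"
      by measurable
  qed auto
  finally show ?thesis .
next
  case False
  then have "dyadic_cell n l z = {}" unfolding dyadic_cell_def dyadic_grid_def by auto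
  then show ?thesis by simp
qed

lemma finite_dyadic_indices: "finite (dyadic_indices l)"
  unfolding dyadic_indices_def by (intro finite_PiE) auto

lemma card_dyadic_indices:
  "real (card (dyadic_indices l :: ('a::euclidean_space \<Rightarrow> int) set)) \<le> 3 ^ DIM('a) * 2 powr (DIM('a) * real l)"
proof -
  have "card (dyadic_indices l :: ('a \<Rightarrow> int) set) = (2 * 2 ^ l + 1) ^ DIM('a)"
  proof -
    have "nat (2 ^ l + 1 + 2 ^ l) = 2 * 2 ^ l + (1::nat)"
      by (simp add: nat_add_distrib nat_mult_distrib nat_power_eq)
    then show ?thesis unfolding dyadic_indices_def by (simp add: card_PiE)
  qed
  also have "real \<dots> \<le> real ((3 * 2 ^ l) ^ DIM('a))"
    by (intro of_nat_mono power_mono) auto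
  also have "\<dots> = 3 ^ DIM('a) * 2 powr (DIM('a) * real l)"
    by (simp add: power_mult_distrib powr_realpow[symmetric] powr_powr mult.commute)
  finally show ?thesis .
qed

lemma dyadic_grid_in_indices:
  assumes "x \<in> dyadic_shell n"
  shows "dyadic_grid n l x \<in> dyadic_indices l"
proof -
  have "\<lfloor>2 ^ l * ((x \<bullet> b) / 2 ^ n)\<rfloor> \<in> {- (2 ^ l)..2 ^ l}" if b: "b \<in> Basis" for b
  proof -
    define u where "u = 2 ^ l * ((x \<bullet> b) / 2 ^ n)"
    have "\<bar>x \<bullet> b\<bar> \<le> 2 ^ n" using Basis_le_norm[OF b, of x] norm_dyadic_shell[OF assms] by linarith
    then have "\<bar>(x \<bullet> b) / 2 ^ n\<bar> \<le> 1" by simp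
    then have "\<bar>2 ^ l * ((x \<bullet> b) / 2 ^ n)\<bar> \<le> 2 ^ l * 1"
      unfolding abs_mult by (intro mult_mono) auto
    then have "\<bar>u\<bar> \<le> 2 ^ l" by (simp only: u_def mult_1_right)
    then have "u \<le> of_int (2 ^ l)" "of_int (- (2 ^ l)) \<le> u" by auto
    then have "\<lfloor>u\<rfloor> \<in> {- (2 ^ l)..2 ^ l}" unfolding atLeastAtMost_iff le_floor_iff by linarith
    then show ?thesis by (simp only: u_def)
  qed
  then show ?thesis by (auto simp: dyadic_grid_def dyadic_indices_def)
qed

text \<open>
  Coarser coordinates are quotients of finer ones: \<open>\<lfloor>x / k\<rfloor> = \<lfloor>x\<rfloor> div k\<close> for integral
  \<open>k\<close>.
\<close>

lemma dyadic_grid_refine: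
  assumes "l \<le> k" "dyadic_grid n k x = dyadic_grid n k y"
  shows "dyadic_grid n l x = dyadic_grid n l y"
proof -
  \<comment> \<open>Level \<open>l\<close> is obtained from level \<open>k\<close> by dropping \<open>k - l\<close> binary digits.\<close>
  have half: "\<lfloor>2 ^ l * u\<rfloor> = \<lfloor>2 ^ k * u\<rfloor> div 2 ^ (k - l)" for u :: real
  proof -
    have "2 ^ l * u = (2 ^ k * u) / of_int (2 ^ (k - l))"
      using power_add[of "2::real" l "k - l"] assms(1) by simp
    then show ?thesis by (simp only: floor_divide_real_eq_div zero_le_power zero_le_numeral)
  qed
  have "\<lfloor>2 ^ k * ((x \<bullet> b) / 2 ^ n)\<rfloor> = \<lfloor>2 ^ k * ((y \<bullet> b) / 2 ^ n)\<rfloor>" if "b \<in> Basis" for b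
    using fun_cong[OF assms(2), of b] that by (simp add: dyadic_grid_def)
  then show ?thesis unfolding dyadic_grid_def by (intro restrict_ext) (simp only: half)
qed

lemma dyadic_grid_diameter:
  fixes x y :: "'a::euclidean_space"
  assumes "dyadic_grid n l x = dyadic_grid n l y"
  shows "norm (x - y) \<le> DIM('a) * (2 ^ n / 2 ^ l)"
proof -
  have "\<bar>(x - y) \<bullet> b\<bar> \<le> 2 ^ n / 2 ^ l" if "b \<in> Basis" for b
  proof -
    have "\<lfloor>2 ^ l * ((x \<bullet> b) / 2 ^ n)\<rfloor> = \<lfloor>2 ^ l * ((y \<bullet> b) / 2 ^ n)\<rfloor>"
      using fun_cong[OF assms, of b] that by (simp add: dyadic_grid_def)
    then have "\<bar>2 ^ l * ((x \<bullet> b) / 2 ^ n) - 2 ^ l * ((y \<bullet> b) / 2 ^ n)\<bar> \<le> 1" by linarith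
    then have "\<bar>2 ^ l * (((x - y) \<bullet> b) / 2 ^ n)\<bar> \<le> 1"
      by (simp add: inner_diff_left diff_divide_distrib right_diff_distrib)
    then show ?thesis by (simp add: abs_mult field_simps)
  qed
  then have "(\<Sum>b\<in>Basis. \<bar>(x - y) \<bullet> b\<bar>) \<le> (\<Sum>b\<in>(Basis::'a set). 2 ^ n / 2 ^ l)"
    by (intro sum_mono)
  then show ?thesis using norm_le_l1[of "x - y"] by simp
qed

lemma dyadic_cells_laminar:
  "dyadic_cell n l z \<subseteq> dyadic_cell m k z' \<or> dyadic_cell m k z' \<subseteq> dyadic_cell n l z \<or>
   dyadic_cell n l z \<inter> dyadic_cell m k z' = {}"
proof (cases "n = m")
  case True
  have "dyadic_cell n k z' \<subseteq> dyadic_cell n l z \<or> dyadic_cell n l z \<inter> dyadic_cell n k z' = {}"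
    if "l \<le> k" for l k z z'
  proof (cases "\<exists>x\<in>dyadic_shell n. dyadic_grid n l x = z \<and> dyadic_grid n k x = z'")
    case True
    then have "dyadic_cell n k z' \<subseteq> dyadic_cell n l z"
      using dyadic_grid_refine[OF that] unfolding dyadic_cell_def by fastforce
    then show ?thesis ..
  qed (auto simp: dyadic_cell_def)
  then show ?thesis unfolding True by (metis Int_commute le_cases)
next
  case False
  then show ?thesis using dyadic_shell_disjoint[of n m] unfolding dyadic_cell_def by blast
qed

text \<open>
  The level of the cell is the first one at which \<open>x\<close> and \<open>y\<close> differ, so that one level higher they
  still agree and their distance is at most the diameter there. In different shells they are separated at level \<open>0\<close>
  of the outer one. The second alternative is that they agree down to the finest level.
\<close>

lemma dyadic_separation:
  fixes x y :: "'a::euclidean_space"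
  assumes "norm x \<le> 2 ^ N" "norm y \<le> 2 ^ N"
  shows "(\<exists>n\<le>N. \<exists>l\<le>L. \<exists>z\<in>dyadic_indices l. (x \<in> dyadic_cell n l z \<longleftrightarrow> y \<notin> dyadic_cell n l z) \<and>
             norm (x - y) \<le> 2 * DIM('a) * (2 ^ n / 2 ^ l)) \<or>
         (\<exists>n\<le>N. x \<in> dyadic_shell n \<and> norm (x - y) \<le> 2 * DIM('a) * (2 ^ n / 2 ^ L))"
proof -
  have d: "real DIM('a) \<ge> 1" using DIM_positive[where 'a = 'a] by linarith
  obtain n where n: "n \<le> N" "x \<in> dyadic_shell n" by (rule in_dyadic_shell_exists[OF assms(1)])
  obtain m where m: "m \<le> N" "y \<in> dyadic_shell m" by (rule in_dyadic_shell_exists[OF assms(2)])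
  have far: "norm (x - y) \<le> 2 * DIM('a) * (2 ^ k / 2 ^ 0)" if "n \<le> k" "m \<le> k" for k
  proof -
    have "(2::real) ^ n \<le> 2 ^ k" "(2::real) ^ m \<le> 2 ^ k" using that by (auto intro: power_increasing)
    then have "norm (x - y) \<le> 2 * 2 ^ k"
      using norm_triangle_ineq4[of x y] norm_dyadic_shell[OF n(2)] norm_dyadic_shell[OF m(2)] by linarith
    also have "\<dots> \<le> DIM('a) * (2 * 2 ^ k)" using d by simp
    finally show ?thesis by simp
  qed
  show ?thesis
  proof (cases "n = m")
    case False
    define k where "k = max n m"
    have "\<exists>z\<in>dyadic_indices 0. (x \<in> dyadic_cell k 0 z \<longleftrightarrow> y \<notin> dyadic_cell k 0 z)"
    proof (cases "n < m")
      case True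
      then have "x \<notin> dyadic_shell k" "y \<in> dyadic_shell k"
        using dyadic_shell_disjoint[OF False] n m by (auto simp: k_def max_def)
      then show ?thesis using dyadic_grid_in_indices[of y k 0]
        by (intro bexI[of _ "dyadic_grid k 0 y"]) (auto simp: dyadic_cell_def)
    next
      case ge: False
      then have "x \<in> dyadic_shell k" "y \<notin> dyadic_shell k"
        using dyadic_shell_disjoint[OF False] n m by (auto simp: k_def max_def)
      then show ?thesis using dyadic_grid_in_indices[of x k 0]
        by (intro bexI[of _ "dyadic_grid k 0 x"]) (auto simp: dyadic_cell_def)
    qed
    moreover have "k \<le> N" using n m by (simp add: k_def)
    moreover have "norm (x - y) \<le> 2 * DIM('a) * (2 ^ k / 2 ^ 0)" by (rule far) (auto simp: k_def)
    ultimately show ?thesis by blast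
  next
    case True
    show ?thesis
    proof (cases "dyadic_grid n L x = dyadic_grid n L y")
      case same: True
      have "norm (x - y) \<le> 2 * DIM('a) * (2 ^ n / 2 ^ L)"
        by (intro order_trans[OF dyadic_grid_diameter[OF same]] mult_right_mono) auto
      then show ?thesis using n by blast
    next
      case False
      define l where "l = (LEAST l. dyadic_grid n l x \<noteq> dyadic_grid n l y)"
      have l: "dyadic_grid n l x \<noteq> dyadic_grid n l y" unfolding l_def by (rule LeastI[of _ L]) (fact False)
      have lL: "l \<le> L" unfolding l_def by (rule Least_le) (fact False)
      have "norm (x - y) \<le> 2 * DIM('a) * (2 ^ n / 2 ^ l)"
      proof (cases l)
        case 0
        then show ?thesis using far[of n] True by simp
      next
        case (Suc k)
        then have "dyadic_grid n k x = dyadic_grid n k y"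
          using not_less_Least[of k "\<lambda>l. dyadic_grid n l x \<noteq> dyadic_grid n l y"] unfolding l_def by auto
        from dyadic_grid_diameter[OF this] show ?thesis by (simp add: Suc)
      qed
      moreover have "x \<in> dyadic_cell n l (dyadic_grid n l x)" "y \<notin> dyadic_cell n l (dyadic_grid n l x)"
        using n l by (auto simp: dyadic_cell_def)
      moreover have "dyadic_grid n l x \<in> dyadic_indices l" by (rule dyadic_grid_in_indices) fact
      ultimately show ?thesis using n lL by blast
    qed
  qed
qed


lemma ennreal_powr_mono: "0 \<le> a \<Longrightarrow> x \<le> y \<Longrightarrow> ennreal_powr x a \<le> ennreal_powr y a"
  unfolding ennreal_powr_def
  by (auto simp: top.extremum_unique less_top[symmetric] intro!: ennreal_leI powr_mono2 enn2real_mono)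

lemma ennreal_powr_inverse: "p > 0 \<Longrightarrow> ennreal_powr (ennreal_powr x (1 / p)) p = x"
  by (auto simp: ennreal_powr_def powr_powr less_top[symmetric])

lemma wasserstein_powr_le_coupling:
  assumes "\<pi> \<in> couplings \<mu> \<nu>" "p > 0"
  shows "ennreal_powr (wasserstein p \<mu> \<nu>) p \<le> (\<integral>\<^sup>+z. ennreal (norm (fst z - snd z) powr p) \<partial>\<pi>)"
proof -
  have "wasserstein p \<mu> \<nu> \<le> ennreal_powr (\<integral>\<^sup>+z. ennreal (norm (fst z - snd z) powr p) \<partial>\<pi>) (1 / p)"
    unfolding wasserstein_def by (rule INF_lower) fact
  then have "ennreal_powr (wasserstein p \<mu> \<nu>) p
      \<le> ennreal_powr (ennreal_powr (\<integral>\<^sup>+z. ennreal (norm (fst z - snd z) powr p) \<partial>\<pi>) (1 / p)) p"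
    using assms by (intro ennreal_powr_mono) auto
  then show ?thesis using assms by (simp add: ennreal_powr_inverse)
qed

definition dyadic_discrepancy :: "real \<Rightarrow> nat \<Rightarrow> 'a::euclidean_space measure \<Rightarrow> 'a measure \<Rightarrow> ennreal" where
  "dyadic_discrepancy p N \<mu> \<nu> =
     (\<Sum>n\<le>N. \<Sum>l\<le>N. ennreal (2 powr (p * (real n - real l))) *
        (\<Sum>z\<in>dyadic_indices l. ennreal \<bar>measure \<mu> (dyadic_cell n l z) - measure \<nu> (dyadic_cell n l z)\<bar>))"

text \<open>
  What is left after cutting at level \<open>N\<close>: pairs that are not separated by any cell pay the diameter at the finest
  level, and pairs with a point outside the ball of radius \<open>2 ^ N\<close> pay that point's norm.
\<close>

definition dyadic_remainder :: "real \<Rightarrow> nat \<Rightarrow> 'a::euclidean_space measure \<Rightarrow> ennreal" where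
  "dyadic_remainder p N \<mu> =
     (\<Sum>n\<le>N. ennreal (2 powr (p * (real n - real N))) * emeasure \<mu> (dyadic_shell n)) +
     (\<integral>\<^sup>+x. ennreal (norm x powr p) * indicator {x. 2 ^ N < norm x} x \<partial>\<mu>)"

lemma cost_le_dyadic:
  fixes x y :: "'a::euclidean_space" and N :: nat
  assumes p: "p > 0"
  defines "K \<equiv> ennreal ((2 * DIM('a)) powr p)"
  defines "S \<equiv> (\<Sum>n\<le>N. \<Sum>l\<le>N. ennreal (2 powr (p * (real n - real l))) *
            (\<Sum>z\<in>dyadic_indices l. indicator (dyadic_cell n l z \<times> - dyadic_cell n l z) (x, y) +
                                     indicator ((- dyadic_cell n l z) \<times> dyadic_cell n l z) (x, y)))"
  defines "T \<equiv> (\<Sum>n\<le>N. ennreal (2 powr (p * (real n - real N))) * indicator (dyadic_shell n) x)"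
  defines "U \<equiv> \<lambda>x. ennreal (norm x powr p) * indicator {x :: 'a. 2 ^ N < norm x} x"
  shows "ennreal (norm (x - y) powr p) \<le> K * (S + T + U x + U y)"
proof -
  have d: "real DIM('a) \<ge> 1" using DIM_positive[where 'a = 'a] by linarith
  have scaled: "ennreal (norm (x - y) powr p) \<le> K * ennreal (r powr p)"
    if "norm (x - y) \<le> 2 * DIM('a) * r" "r \<ge> 0" for r :: real
  proof -
    have "norm (x - y) powr p \<le> (2 * DIM('a) * r) powr p" using p that by (intro powr_mono2) auto
    also have "\<dots> = (2 * DIM('a)) powr p * r powr p" using d that by (simp add: powr_mult)
    finally show ?thesis unfolding K_def by (simp add: ennreal_mult[symmetric] ennreal_leI)
  qed
  have two: "(2 ^ n / 2 ^ l) powr p = 2 powr (p * (real n - real l))" for n l :: nat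
  proof -
    have "(2::real) ^ n / 2 ^ l = 2 powr (real n - real l)" by (simp add: powr_diff powr_realpow)
    then show ?thesis by (simp add: powr_powr mult.commute)
  qed
  show ?thesis
  proof (cases "norm x \<le> 2 ^ N \<and> norm y \<le> 2 ^ N")
    case False
    have tail: "norm (x - y) \<le> 2 * DIM('a) * max (norm x) (norm y)"
    proof -
      have "norm (x - y) \<le> 2 * max (norm x) (norm y)"
        using norm_triangle_ineq4[of x y] by linarith
      also have "\<dots> \<le> DIM('a) * (2 * max (norm x) (norm y))"
        using mult_right_mono[OF d, of "2 * max (norm x) (norm y)"] by (simp add: le_max_iff_disj)
      finally show ?thesis by simp
    qed
    have "ennreal (norm (x - y) powr p) \<le> K * ennreal (max (norm x) (norm y) powr p)"
      by (rule scaled[OF tail]) (simp add: le_max_iff_disj)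
    also have "ennreal (max (norm x) (norm y) powr p) \<le> U x + U y"
    proof (cases "norm x \<le> norm y")
      case True
      then have "max (norm x) (norm y) = norm y" "2 ^ N < norm y" using False by auto
      then have "ennreal (max (norm x) (norm y) powr p) = U y" by (simp add: U_def)
      then show ?thesis by simp
    next
      case le: False
      then have "max (norm x) (norm y) = norm x" "2 ^ N < norm x" using False by auto
      then have "ennreal (max (norm x) (norm y) powr p) = U x" by (simp add: U_def)
      then show ?thesis by simp
    qed
    also have "U x + U y \<le> S + T + U x + U y" by (simp add: add_increasing)
    finally show ?thesis by (simp add: mult_left_mono)
  next
    case True
    then consider
      (cell) n l z where "n \<le> N" "l \<le> N" "z \<in> dyadic_indices l"
        "x \<in> dyadic_cell n l z \<longleftrightarrow> y \<notin> dyadic_cell n l z" "norm (x - y) \<le> 2 * DIM('a) * (2 ^ n / 2 ^ l)"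
    | (shell) n where "n \<le> N" "x \<in> dyadic_shell n" "norm (x - y) \<le> 2 * DIM('a) * (2 ^ n / 2 ^ N)"
      using dyadic_separation[of x N y N] by blast
    then show ?thesis
    proof cases
      case cell
      let ?I = "\<lambda>n l z. indicator (dyadic_cell n l z \<times> - dyadic_cell n l z) (x, y) +
                     (indicator ((- dyadic_cell n l z) \<times> dyadic_cell n l z) (x, y) :: ennreal)"
      have "ennreal (2 powr (p * (real n - real l))) \<le> ennreal (2 powr (p * (real n - real l))) * ?I n l z"
        using cell(4) by (auto simp: indicator_def)
      also have "\<dots> \<le> ennreal (2 powr (p * (real n - real l))) * (\<Sum>z\<in>dyadic_indices l. ?I n l z)"
        using cell(3) finite_dyadic_indices by (intro mult_left_mono member_le_sum) auto
      also have "\<dots> \<le> (\<Sum>l\<le>N. ennreal (2 powr (p * (real n - real l))) * (\<Sum>z\<in>dyadic_indices l. ?I n l z))"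
        by (rule member_le_sum[of l "{..N}" "\<lambda>l. ennreal (2 powr (p * (real n - real l))) * (\<Sum>z\<in>dyadic_indices l. ?I n l z)"])
           (use cell in auto)
      also have "\<dots> \<le> S" unfolding S_def
        by (rule member_le_sum[of n "{..N}" "\<lambda>n. \<Sum>l\<le>N. ennreal (2 powr (p * (real n - real l))) * (\<Sum>z\<in>dyadic_indices l. ?I n l z)"])
           (use cell in auto)
      also have "S \<le> S + T + U x + U y" by (simp add: add.assoc)
      finally have "ennreal (2 powr (p * (real n - real l))) \<le> S + T + U x + U y" .
      then show ?thesis
        using order_trans[OF scaled[OF cell(5), unfolded two] mult_left_mono] by simp
    next
      case shell
      have "ennreal (2 powr (p * (real n - real N))) \<le> ennreal (2 powr (p * (real n - real N))) * indicator (dyadic_shell n) x"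
        using shell by simp
      also have "\<dots> \<le> T" unfolding T_def
        by (rule member_le_sum[of n "{..N}" "\<lambda>n. ennreal (2 powr (p * (real n - real N))) * indicator (dyadic_shell n) x"])
           (use shell in auto)
      also have "T \<le> T + (S + U x + U y)" by simp
      also have "\<dots> = S + T + U x + U y" by (simp only: ac_simps)
      finally have "ennreal (2 powr (p * (real n - real N))) \<le> S + T + U x + U y" .
      then show ?thesis
        using order_trans[OF scaled[OF shell(3), unfolded two] mult_left_mono] by simp
    qed
  qed
qed

text \<open>
  Integrate the pointwise estimate of the cost against the coupling that is optimal for all dyadic cells at once: the mass
  separated by a cell is then at most its discrepancy.
\<close>

theorem wasserstein_le_dyadic:
  fixes \<mu> \<nu> :: "'a::euclidean_space measure"
  assumes \<mu>: "\<mu> \<in> space (prob_algebra borel)" and \<nu>: "\<nu> \<in> space (prob_algebra borel)" and p: "p > 0"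
  shows "ennreal_powr (wasserstein p \<mu> \<nu>) p \<le>
    ennreal (2 * (2 * DIM('a)) powr p) *
      (dyadic_discrepancy p N \<mu> \<nu> + dyadic_remainder p N \<mu> + dyadic_remainder p N \<nu>)"
proof -
  define \<C> where "\<C> = (\<Union>n\<le>N. \<Union>l\<le>N. dyadic_cell n l ` (dyadic_indices l :: ('a \<Rightarrow> int) set))"
  have "\<exists>\<pi>\<in>couplings \<mu> \<nu>. \<forall>C\<in>\<C>. measure \<pi> (C \<times> - C) \<le> \<bar>measure \<mu> C - measure \<nu> C\<bar> \<and>
                              measure \<pi> ((- C) \<times> C) \<le> \<bar>measure \<mu> C - measure \<nu> C\<bar>"
  proof (rule laminar_coupling[OF \<mu> \<nu>])
    show "finite \<C>" unfolding \<C>_def using finite_dyadic_indices by auto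
    show "C \<subseteq> D \<or> D \<subseteq> C \<or> C \<inter> D = {}" if "C \<in> \<C>" "D \<in> \<C>" for C D
      using that dyadic_cells_laminar unfolding \<C>_def by blast
  qed (auto simp: \<C>_def)
  then obtain \<pi> where \<pi>: "\<pi> \<in> couplings \<mu> \<nu>"
    and \<pi>C: "\<And>C. C \<in> \<C> \<Longrightarrow> measure \<pi> (C \<times> - C) \<le> \<bar>measure \<mu> C - measure \<nu> C\<bar>"
            "\<And>C. C \<in> \<C> \<Longrightarrow> measure \<pi> ((- C) \<times> C) \<le> \<bar>measure \<mu> C - measure \<nu> C\<bar>" by auto
  have sets_\<pi>[measurable_cong]: "sets \<pi> = sets (borel \<Otimes>\<^sub>M borel)" and "prob_space \<pi>"
    and marg: "distr \<pi> borel fst = \<mu>" "distr \<pi> borel snd = \<nu>"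
    using \<pi> by (auto simp: couplings_def space_prob_algebra)
  interpret prob_space \<pi> by fact
  define S where "S z = (\<Sum>n\<le>N. \<Sum>l\<le>N. ennreal (2 powr (p * (real n - real l))) *
            (\<Sum>c\<in>dyadic_indices l. indicator (dyadic_cell n l c \<times> - dyadic_cell n l c) z +
                                     indicator ((- dyadic_cell n l c) \<times> dyadic_cell n l c) z))" for z :: "'a \<times> 'a"
  define T where "T x = (\<Sum>n\<le>N. ennreal (2 powr (p * (real n - real N))) * indicator (dyadic_shell n) x)" for x :: 'a
  define U where "U x = ennreal (norm x powr p) * indicator {x :: 'a. 2 ^ N < norm x} x" for x :: 'a
  let ?K = "ennreal ((2 * DIM('a)) powr p)"
  have rect: "C \<times> - C \<in> sets \<pi>" "(- C) \<times> C \<in> sets \<pi>" if "C \<in> sets borel" for C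
    unfolding sets_\<pi> using that borel_comp[OF that] by (auto intro!: pair_measureI)
  have ind[measurable]: "indicator (dyadic_cell n l c \<times> - dyadic_cell n l c) \<in> borel_measurable \<pi>"
    "indicator ((- dyadic_cell n l c) \<times> dyadic_cell n l c) \<in> borel_measurable \<pi>" for n l c
    by (intro borel_measurable_indicator rect dyadic_cell_borel)+
  have S_m: "S \<in> borel_measurable \<pi>" unfolding S_def by measurable
  have T_b: "T \<in> borel_measurable borel" unfolding T_def by measurable
  have U_b: "U \<in> borel_measurable borel" unfolding U_def by measurable
  have fs: "fst \<in> \<pi> \<rightarrow>\<^sub>M borel" "snd \<in> \<pi> \<rightarrow>\<^sub>M borel" by measurable
  note [measurable] = S_m measurable_compose[OF fs(1) T_b] measurable_compose[OF fs(1) U_b] measurable_compose[OF fs(2) U_b]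
  have fst_int: "(\<integral>\<^sup>+z. f (fst z) \<partial>\<pi>) = (\<integral>\<^sup>+x. f x \<partial>\<mu>)" and snd_int: "(\<integral>\<^sup>+z. f (snd z) \<partial>\<pi>) = (\<integral>\<^sup>+x. f x \<partial>\<nu>)"
    if "f \<in> borel_measurable borel" for f :: "'a \<Rightarrow> ennreal"
    unfolding marg[symmetric] using that fs by (simp_all add: nn_integral_distr)
  have S_int: "(\<integral>\<^sup>+z. S z \<partial>\<pi>) \<le> 2 * dyadic_discrepancy p N \<mu> \<nu>"
  proof -
    have "(\<integral>\<^sup>+z. S z \<partial>\<pi>) = (\<Sum>n\<le>N. \<Sum>l\<le>N. ennreal (2 powr (p * (real n - real l))) *
            (\<Sum>c\<in>dyadic_indices l. emeasure \<pi> (dyadic_cell n l c \<times> - dyadic_cell n l c) +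
                                     emeasure \<pi> ((- dyadic_cell n l c) \<times> dyadic_cell n l c)))"
      unfolding S_def by (simp add: nn_integral_sum nn_integral_cmult nn_integral_add rect)
    also have "\<dots> \<le> (\<Sum>n\<le>N. \<Sum>l\<le>N. ennreal (2 powr (p * (real n - real l))) *
        (\<Sum>z\<in>dyadic_indices l. 2 * ennreal \<bar>measure \<mu> (dyadic_cell n l z) - measure \<nu> (dyadic_cell n l z)\<bar>))"
    proof (intro sum_mono mult_left_mono)
      fix n l and z :: "'a \<Rightarrow> int" assume "n \<in> {..N}" "l \<in> {..N}" "z \<in> dyadic_indices l"
      then have "dyadic_cell n l z \<in> \<C>" by (auto simp: \<C>_def)
      from \<pi>C[OF this]
      have "emeasure \<pi> (dyadic_cell n l z \<times> - dyadic_cell n l z) + emeasure \<pi> ((- dyadic_cell n l z) \<times> dyadic_cell n l z)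
         \<le> ennreal \<bar>measure \<mu> (dyadic_cell n l z) - measure \<nu> (dyadic_cell n l z)\<bar> +
           ennreal \<bar>measure \<mu> (dyadic_cell n l z) - measure \<nu> (dyadic_cell n l z)\<bar>"
        unfolding emeasure_eq_measure by (intro add_mono ennreal_leI)
      then show "emeasure \<pi> (dyadic_cell n l z \<times> - dyadic_cell n l z) + emeasure \<pi> ((- dyadic_cell n l z) \<times> dyadic_cell n l z)
         \<le> 2 * ennreal \<bar>measure \<mu> (dyadic_cell n l z) - measure \<nu> (dyadic_cell n l z)\<bar>"
        by (simp only: mult_2)
    qed simp
    also have "\<dots> = 2 * dyadic_discrepancy p N \<mu> \<nu>"
      unfolding dyadic_discrepancy_def by (simp only: sum_distrib_left mult_ac)
    finally show ?thesis .
  qed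
  have "ennreal_powr (wasserstein p \<mu> \<nu>) p \<le> (\<integral>\<^sup>+z. ennreal (norm (fst z - snd z) powr p) \<partial>\<pi>)"
    by (rule wasserstein_powr_le_coupling[OF \<pi> p])
  also have "\<dots> \<le> (\<integral>\<^sup>+z. ?K * (S z + T (fst z) + U (fst z) + U (snd z)) \<partial>\<pi>)"
    unfolding S_def T_def U_def using cost_le_dyadic[OF p] by (intro nn_integral_mono) auto
  also have "\<dots> = ?K * ((\<integral>\<^sup>+z. S z \<partial>\<pi>) + (\<integral>\<^sup>+x. T x \<partial>\<mu>) + (\<integral>\<^sup>+x. U x \<partial>\<mu>) + (\<integral>\<^sup>+x. U x \<partial>\<nu>))"
    by (simp add: nn_integral_cmult nn_integral_add fst_int T_b U_b snd_int)
  also have "\<dots> \<le> ?K * (2 * dyadic_discrepancy p N \<mu> \<nu> + dyadic_remainder p N \<mu> + dyadic_remainder p N \<nu>)"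
  proof (rule mult_left_mono)
    have sets_\<mu>: "sets \<mu> = sets borel" using \<mu> by (simp add: space_prob_algebra)
    have "(\<integral>\<^sup>+x. T x \<partial>\<mu>) = (\<Sum>n\<le>N. ennreal (2 powr (p * (real n - real N))) * emeasure \<mu> (dyadic_shell n))"
      unfolding T_def using sets_\<mu> dyadic_shell_borel
      by (subst nn_integral_sum) (simp_all add: nn_integral_cmult_indicator)
    then have "(\<integral>\<^sup>+x. T x \<partial>\<mu>) + (\<integral>\<^sup>+x. U x \<partial>\<mu>) = dyadic_remainder p N \<mu>"
      by (simp add: dyadic_remainder_def U_def)
    moreover have "(\<integral>\<^sup>+x. U x \<partial>\<nu>) \<le> dyadic_remainder p N \<nu>"
      by (simp add: dyadic_remainder_def U_def)
    ultimately show "(\<integral>\<^sup>+z. S z \<partial>\<pi>) + (\<integral>\<^sup>+x. T x \<partial>\<mu>) + (\<integral>\<^sup>+x. U x \<partial>\<mu>) + (\<integral>\<^sup>+x. U x \<partial>\<nu>)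
        \<le> 2 * dyadic_discrepancy p N \<mu> \<nu> + dyadic_remainder p N \<mu> + dyadic_remainder p N \<nu>"
      using S_int by (simp add: add.assoc add_mono)
  qed simp
  also have "\<dots> \<le> ?K * (2 * (dyadic_discrepancy p N \<mu> \<nu> + dyadic_remainder p N \<mu> + dyadic_remainder p N \<nu>))"
  proof (rule mult_left_mono)
    have "2 * (dyadic_discrepancy p N \<mu> \<nu> + dyadic_remainder p N \<mu> + dyadic_remainder p N \<nu>)
      = (2 * dyadic_discrepancy p N \<mu> \<nu> + dyadic_remainder p N \<mu> + dyadic_remainder p N \<nu>)
        + (dyadic_remainder p N \<mu> + dyadic_remainder p N \<nu>)"
      by (simp only: mult_2 ac_simps)
    then show "2 * dyadic_discrepancy p N \<mu> \<nu> + dyadic_remainder p N \<mu> + dyadic_remainder p N \<nu>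
      \<le> 2 * (dyadic_discrepancy p N \<mu> \<nu> + dyadic_remainder p N \<mu> + dyadic_remainder p N \<nu>)" by (metis le_iff_add)
  qed simp
  also have "\<dots> = ennreal (2 * (2 * DIM('a)) powr p) *
      (dyadic_discrepancy p N \<mu> \<nu> + dyadic_remainder p N \<mu> + dyadic_remainder p N \<nu>)"
    by (simp only: ennreal_mult powr_ge_zero zero_le_numeral ennreal_numeral mult_ac)
  finally show ?thesis .
qed

section \<open>Expected Wasserstein distance of a random measure\<close>

text \<open>
  Jensen's inequality for the concave function \<open>x \<mapsto> x powr \<beta>\<close>, up to a factor two, by comparing each
  term with the mean value \<open>u = s / k\<close>: below \<open>u\<close> a term is at most \<open>u powr \<beta>\<close>, above
  \<open>u\<close> it is at most \<open>u powr (\<beta> - 1) * x\<close>.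
\<close>

lemma sum_powr_le_card:
  fixes x :: "'i \<Rightarrow> real"
  assumes "finite I" "\<And>i. i \<in> I \<Longrightarrow> 0 \<le> x i" "0 < \<beta>" "\<beta> < 1" "sum x I \<le> s" "real (card I) \<le> k" "0 < k"
  shows "(\<Sum>i\<in>I. x i powr \<beta>) \<le> 2 * (k powr (1 - \<beta>) * s powr \<beta>)"
proof (cases "s > 0")
  case False
  then have "sum x I \<le> 0" using assms by linarith
  moreover have "sum x I \<ge> 0" using assms by (intro sum_nonneg) auto
  ultimately have "\<forall>i\<in>I. x i = 0" using sum_nonneg_eq_0_iff[of I x] assms by simp
  then show ?thesis using assms by simp
next
  case True
  define u where "u = s / k"
  have u: "u > 0" using True assms by (simp add: u_def)
  have *: "x i powr \<beta> \<le> u powr (\<beta> - 1) * x i + u powr \<beta>" if "i \<in> I" for i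
  proof (cases "x i \<le> u")
    case True
    then have "x i powr \<beta> \<le> u powr \<beta>" using assms(2)[OF that] assms(3) by (intro powr_mono2) auto
    then show ?thesis using assms(2)[OF that] by (smt (verit) mult_nonneg_nonneg powr_ge_zero)
  next
    case False
    have "x i powr \<beta> = x i powr (\<beta> - 1) * x i"
      using False u powr_mult_base[of "x i" "\<beta> - 1"] by (simp add: mult.commute)
    also have "\<dots> \<le> u powr (\<beta> - 1) * x i"
      using False u assms by (intro mult_right_mono powr_mono2') auto
    finally show ?thesis by (smt (verit) powr_ge_zero)
  qed
  have "(\<Sum>i\<in>I. x i powr \<beta>) \<le> (\<Sum>i\<in>I. u powr (\<beta> - 1) * x i + u powr \<beta>)"
    by (intro sum_mono *)
  also have "\<dots> = u powr (\<beta> - 1) * sum x I + real (card I) * u powr \<beta>"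
    by (simp add: sum.distrib sum_distrib_left)
  also have "\<dots> \<le> u powr (\<beta> - 1) * s + k * u powr \<beta>"
    using assms by (intro add_mono mult_left_mono mult_right_mono) auto
  also have "u powr (\<beta> - 1) * s = k powr (1 - \<beta>) * s powr \<beta>"
  proof -
    have "s powr (\<beta> - 1) * s = s powr \<beta>"
      using True powr_mult_base[of s "\<beta> - 1"] by (simp add: mult.commute)
    moreover have powr_u: "u powr (\<beta> - 1) = s powr (\<beta> - 1) / k powr (\<beta> - 1)"
      using True assms by (simp add: u_def powr_divide)
    moreover have "k powr (1 - \<beta>) = inverse (k powr (\<beta> - 1))"
      by (simp add: powr_minus[symmetric])
    ultimately show ?thesis using True assms by (simp add: powr_u field_simps)
  qed
  also have "k * u powr \<beta> = k powr (1 - \<beta>) * s powr \<beta>"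
    using True assms by (simp add: u_def powr_divide powr_diff)
  finally show ?thesis by (simp add: mult_ac)
qed

lemma nn_integral_le_dominated:
  assumes "sets \<mu> = sets \<pi>" "\<And>A. A \<in> sets \<pi> \<Longrightarrow> emeasure \<mu> A \<le> c * emeasure \<pi> A"
    and f: "f \<in> borel_measurable \<pi>"
  shows "(\<integral>\<^sup>+x. f x \<partial>\<mu>) \<le> c * (\<integral>\<^sup>+x. f x \<partial>\<pi>)"
proof -
  have "\<mu> \<le> scale_measure c \<pi>"
    using assms by (subst le_measure) auto
  then have "(\<integral>\<^sup>+x. f x \<partial>\<mu>) \<le> (\<integral>\<^sup>+x. f x \<partial>scale_measure c \<pi>)"
    using assms by (intro nn_integral_mono_measure) auto
  then show ?thesis using f by (simp add: nn_integral_scale_measure)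
qed

lemma dyadic_remainder_dominated:
  fixes \<mu> \<pi> :: "'a::euclidean_space measure"
  assumes "sets \<mu> = sets borel" "sets \<pi> = sets borel"
    and dom: "\<And>A. A \<in> sets borel \<Longrightarrow> emeasure \<mu> A \<le> c * emeasure \<pi> A"
  shows "dyadic_remainder p N \<mu> \<le> c * dyadic_remainder p N \<pi>"
proof -
  have "(\<Sum>n\<le>N. ennreal (2 powr (p * (real n - real N))) * emeasure \<mu> (dyadic_shell n))
     \<le> (\<Sum>n\<le>N. ennreal (2 powr (p * (real n - real N))) * (c * emeasure \<pi> (dyadic_shell n)))"
    by (intro sum_mono mult_left_mono dom) auto
  also have "\<dots> = c * (\<Sum>n\<le>N. ennreal (2 powr (p * (real n - real N))) * emeasure \<pi> (dyadic_shell n))"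
    by (simp only: sum_distrib_left mult_ac)
  finally show ?thesis unfolding dyadic_remainder_def distrib_left
    using assms by (intro add_mono nn_integral_le_dominated) (auto cong: measurable_cong_sets)
qed

text \<open>
  Markov's inequality for the moment of order \<open>q\<close>; the inner radius \<open>2 ^ (n - 1)\<close> is responsible for the
  factor \<open>2 powr q\<close>.
\<close>

lemma measure_dyadic_shell_le:
  fixes \<pi> :: "'a::euclidean_space measure"
  assumes \<pi>: "\<pi> \<in> space (prob_algebra borel)" and q: "q > 0"
    and m: "moment \<pi> q \<le> ennreal m" "m \<ge> 1"
  shows "measure \<pi> (dyadic_shell n) \<le> 2 powr q * m * 2 powr (- q * real n)"
proof (cases n)
  case 0
  interpret prob_space \<pi> using \<pi> by (simp add: space_prob_algebra)
  have "measure \<pi> (dyadic_shell n) \<le> 1 * 1" by simp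
  also have "\<dots> \<le> 2 powr q * m" using q m by (intro mult_mono ge_one_powr_ge_zero) auto
  finally show ?thesis using 0 by simp
next
  case (Suc k)
  interpret prob_space \<pi> using \<pi> by (simp add: space_prob_algebra)
  have sets: "sets \<pi> = sets borel" using \<pi> by (simp add: space_prob_algebra)
  have "ennreal (2 powr (q * real k)) * emeasure \<pi> (dyadic_shell n)
      = (\<integral>\<^sup>+x. ennreal (2 powr (q * real k)) * indicator (dyadic_shell n) x \<partial>\<pi>)"
    using sets by (simp add: nn_integral_cmult_indicator)
  also have "\<dots> \<le> moment \<pi> q"
    unfolding moment_def
  proof (intro nn_integral_mono)
    fix x :: 'a
    show "ennreal (2 powr (q * real k)) * indicator (dyadic_shell n) x \<le> ennreal (norm x powr q)"
    proof (cases "x \<in> dyadic_shell n")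
      case True
      then have "2 powr real k \<le> norm x" by (simp add: Suc powr_realpow)
      then have "(2 powr real k) powr q \<le> norm x powr q" using q by (intro powr_mono2) auto
      then show ?thesis using True by (simp add: powr_powr mult.commute ennreal_leI)
    qed simp
  qed
  also have "\<dots> \<le> ennreal m" by fact
  finally have "2 powr (q * real k) * measure \<pi> (dyadic_shell n) \<le> m"
    using m by (simp add: emeasure_eq_measure ennreal_mult[symmetric])
  then have "2 powr (- (q * real k)) * (2 powr (q * real k) * measure \<pi> (dyadic_shell n)) \<le> 2 powr (- (q * real k)) * m"
    by (intro mult_left_mono) auto
  also have "2 powr (- (q * real k)) * (2 powr (q * real k) * measure \<pi> (dyadic_shell n)) = measure \<pi> (dyadic_shell n)"
    by (simp add: mult.assoc[symmetric] powr_add[symmetric])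
  also have "2 powr (- (q * real k)) * m = 2 powr q * m * 2 powr (- q * real n)"
    by (simp add: Suc algebra_simps powr_diff powr_minus powr_add field_simps)
  finally show ?thesis .
qed

text \<open>
  Both parts tend to zero: the finest diameters at rate \<open>2 powr (- p * N)\<close>, and the moment of order \<open>p\<close>
  outside the ball of radius \<open>2 ^ N\<close> at rate \<open>2 powr (- (q - p) * N)\<close>.
\<close>

lemma dyadic_remainder_le:
  fixes \<pi> :: "'a::euclidean_space measure"
  assumes \<pi>: "\<pi> \<in> space (prob_algebra borel)" and q: "0 < p" "p < q"
    and m: "moment \<pi> q \<le> ennreal m" "m \<ge> 1"
  shows "dyadic_remainder p N \<pi> \<le>
    ennreal (m * (2 powr q * (1 / (1 - 2 powr - (q - p))) * 2 powr (- p * real N) + 2 powr (- (q - p) * real N)))"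
proof -
  interpret prob_space \<pi> using \<pi> by (simp add: space_prob_algebra)
  have sets[measurable_cong]: "sets \<pi> = sets borel" using \<pi> by (simp add: space_prob_algebra)
  have "(\<Sum>n\<le>N. 2 powr (p * (real n - real N)) * measure \<pi> (dyadic_shell n))
     \<le> (\<Sum>n\<le>N. 2 powr (p * (real n - real N)) * (2 powr q * m * 2 powr (- q * real n)))"
    using \<pi> q m by (intro sum_mono mult_left_mono measure_dyadic_shell_le) auto
  also have "\<dots> = 2 powr q * m * 2 powr (- p * real N) * (\<Sum>n\<le>N. 2 powr (- (q - p) * real n))"
  proof -
    have "2 powr (p * (real n - real N)) * 2 powr (- q * real n) = 2 powr (- p * real N) * 2 powr (- (q - p) * real n)" for n
      unfolding powr_add[symmetric] by (simp add: algebra_simps)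
    then have "2 powr (p * (real n - real N)) * (2 powr q * m * 2 powr (- q * real n))
      = 2 powr q * m * 2 powr (- p * real N) * 2 powr (- (q - p) * real n)" for n
      by (simp only: mult_ac)
    then show ?thesis by (simp only: sum_distrib_left)
  qed
  also have "\<dots> \<le> 2 powr q * m * 2 powr (- p * real N) * (1 / (1 - 2 powr - (q - p)))"
    using q m by (intro mult_left_mono sum_two_powr_le) auto
  finally have 1: "(\<Sum>n\<le>N. ennreal (2 powr (p * (real n - real N))) * emeasure \<pi> (dyadic_shell n))
      \<le> ennreal (2 powr q * m * 2 powr (- p * real N) * (1 / (1 - 2 powr - (q - p))))"
    by (simp add: emeasure_eq_measure ennreal_mult[symmetric] ennreal_leI)
  have "(\<integral>\<^sup>+x. ennreal (norm x powr p) * indicator {x. 2 ^ N < norm x} x \<partial>\<pi>)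
      \<le> (\<integral>\<^sup>+x. ennreal (2 powr (- (q - p) * real N)) * ennreal (norm x powr q) \<partial>\<pi>)"
  proof (intro nn_integral_mono)
    fix x :: 'a
    show "ennreal (norm x powr p) * indicator {x. 2 ^ N < norm x} x
        \<le> ennreal (2 powr (- (q - p) * real N)) * ennreal (norm x powr q)"
    proof (cases "2 ^ N < norm x")
      case True
      then have x: "norm x > 0" by (meson less_trans zero_less_numeral zero_less_power)
      have "2 powr ((q - p) * real N) = (2 ^ N) powr (q - p)"
        by (simp add: powr_realpow[symmetric] powr_powr mult.commute)
      also have "\<dots> \<le> norm x powr (q - p)" using True q by (intro powr_mono2) auto
      finally have "2 powr (- (q - p) * real N) * (2 powr ((q - p) * real N) * norm x powr p)
          \<le> 2 powr (- (q - p) * real N) * (norm x powr (q - p) * norm x powr p)"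
        by (intro mult_left_mono mult_right_mono) auto
      also have "norm x powr (q - p) * norm x powr p = norm x powr q"
        by (simp add: powr_add[symmetric])
      also have "2 powr (- (q - p) * real N) * (2 powr ((q - p) * real N) * norm x powr p) = norm x powr p"
      proof -
        have "- (q - p) * real N + (q - p) * real N = 0" by (simp only: mult_minus_left left_minus)
        then show ?thesis unfolding mult.assoc[symmetric] powr_add[symmetric] by simp
      qed
      finally show ?thesis using True by (simp add: ennreal_mult[symmetric] ennreal_leI)
    qed simp
  qed
  also have "\<dots> = ennreal (2 powr (- (q - p) * real N)) * moment \<pi> q"
    unfolding moment_def by (rule nn_integral_cmult) measurable
  also have "\<dots> \<le> ennreal (2 powr (- (q - p) * real N)) * ennreal m"
    using m by (intro mult_left_mono) auto
  also have "\<dots> = ennreal (2 powr (- (q - p) * real N) * m)" using m by (simp add: ennreal_mult)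
  finally have "dyadic_remainder p N \<pi> \<le>
      ennreal (2 powr q * m * 2 powr (- p * real N) * (1 / (1 - 2 powr - (q - p)))) +
      ennreal (2 powr (- (q - p) * real N) * m)"
    unfolding dyadic_remainder_def using 1 by (intro add_mono)
  also have "\<dots> = ennreal (m * (2 powr q * (1 / (1 - 2 powr - (q - p))) * 2 powr (- p * real N) + 2 powr (- (q - p) * real N)))"
    using m q powr_less_one[of 2 "- (q - p)"]
    by (subst ennreal_plus[symmetric]) (auto simp: algebra_simps)
  finally show ?thesis .
qed


lemma multiscale_term_nonneg: "h \<ge> 0 \<Longrightarrow> multiscale_term p q b \<kappa> h n l \<ge> 0"
  by (simp add: multiscale_term_def)

text \<open>
  The two entries of the minimum come from the two ways to sum over the cells of a level: their masses add up to at most that of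
  the shell, and their \<open>\<beta>\<close>-th powers are summed by concavity, where a number of cells of order \<open>2 powr (d
  * l)\<close> produces \<open>2 powr (d * (1 - \<beta>) * l)\<close>.
\<close>

lemma sum_dyadic_cells_min_le:
  fixes \<pi> :: "'a::euclidean_space measure" and \<beta> q h m :: real
  assumes \<pi>: "\<pi> \<in> space (prob_algebra borel)" and q: "q > 0" and \<beta>: "0 < \<beta>" "\<beta> < 1" and h: "h > 0"
    and m: "moment \<pi> q \<le> ennreal m" "m \<ge> 1"
  shows "(\<Sum>z\<in>dyadic_indices l. min (measure \<pi> (dyadic_cell n l z)) (measure \<pi> (dyadic_cell n l z) powr \<beta> * h))
    \<le> 2 * 3 ^ DIM('a) * 2 powr q * m *
        min (2 powr (- q * real n)) (2 powr (DIM('a) * (1 - \<beta>) * real l - q * \<beta> * real n) * h)"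
proof -
  interpret prob_space \<pi> using \<pi> by (simp add: space_prob_algebra)
  have sets: "sets \<pi> = sets borel" using \<pi> by (simp add: space_prob_algebra)
  let ?I = "dyadic_indices l :: ('a \<Rightarrow> int) set"
  define x where "x z = measure \<pi> (dyadic_cell n l z)" for z :: "'a \<Rightarrow> int"
  define s where "s = 2 powr q * m * 2 powr (- q * real n)"
  have s: "s > 0" using m by (simp add: s_def)
  have x0: "0 \<le> x z" for z by (simp add: x_def)
  have "sum x ?I = measure \<pi> (\<Union>z\<in>?I. dyadic_cell n l z)"
    unfolding x_def
  proof (intro finite_measure_finite_Union[symmetric] finite_dyadic_indices)
    show "dyadic_cell n l ` ?I \<subseteq> sets \<pi>" unfolding sets by (intro image_subsetI dyadic_cell_borel)
    show "disjoint_family_on (dyadic_cell n l) ?I"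
      unfolding disjoint_family_on_def dyadic_cell_def by blast
  qed
  also have "\<dots> \<le> measure \<pi> (dyadic_shell n)"
  proof (intro finite_measure_mono)
    show "(\<Union>z\<in>?I. dyadic_cell n l z) \<subseteq> dyadic_shell n" unfolding dyadic_cell_def by blast
    show "dyadic_shell n \<in> sets \<pi>" unfolding sets by (rule dyadic_shell_borel)
  qed
  also have "\<dots> \<le> s" unfolding s_def by (rule measure_dyadic_shell_le[OF \<pi> q m])
  finally have sum_x: "sum x ?I \<le> s" .
  define k where "k = (3::real) ^ DIM('a) * 2 powr (DIM('a) * real l)"
  have "(\<Sum>z\<in>?I. x z powr \<beta>) \<le> 2 * (k powr (1 - \<beta>) * s powr \<beta>)"
    using finite_dyadic_indices x0 \<beta> sum_x card_dyadic_indices[where 'a = 'a, of l]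
    by (intro sum_powr_le_card) (auto simp: k_def)
  also have "\<dots> \<le> 2 * ((3 ^ DIM('a) * 2 powr (DIM('a) * (1 - \<beta>) * real l)) * ((2 powr q * m) * 2 powr (- q * \<beta> * real n)))"
  proof (intro mult_left_mono mult_mono)
    have "((3::real) ^ DIM('a)) powr (1 - \<beta>) \<le> (3 ^ DIM('a)) powr 1"
      using \<beta> by (intro powr_mono) auto
    then show "k powr (1 - \<beta>) \<le> 3 ^ DIM('a) * 2 powr (DIM('a) * (1 - \<beta>) * real l)"
      unfolding k_def by (simp add: powr_mult powr_powr mult_ac)
    have "(2 powr q * m) powr \<beta> \<le> (2 powr q * m) powr 1"
      using \<beta> q m mult_mono[of 1 "2 powr q" 1 m] ge_one_powr_ge_zero[of 2 q] by (intro powr_mono) auto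
    then have "(2 powr q * m) powr \<beta> \<le> 2 powr q * m" using m by simp
    then have "(2 powr q * m) powr \<beta> * (2 powr (- q * real n)) powr \<beta> \<le> (2 powr q * m) * 2 powr (- q * \<beta> * real n)"
      using m by (intro mult_mono) (auto simp: powr_powr mult_ac)
    then show "s powr \<beta> \<le> (2 powr q * m) * 2 powr (- q * \<beta> * real n)"
      unfolding s_def using m by (simp only: powr_mult)
  qed (use m in auto)
  also have "\<dots> = 2 * 3 ^ DIM('a) * 2 powr q * m * 2 powr (DIM('a) * (1 - \<beta>) * real l - q * \<beta> * real n)"
  proof -
    have "2 powr (DIM('a) * (1 - \<beta>) * real l - q * \<beta> * real n)
        = 2 powr (DIM('a) * (1 - \<beta>) * real l) * 2 powr (- q * \<beta> * real n)"
      unfolding powr_add[symmetric] by simp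
    then show ?thesis by (simp only: mult_ac)
  qed
  finally have 1: "(\<Sum>z\<in>?I. x z powr \<beta>) \<le> 2 * 3 ^ DIM('a) * 2 powr q * m * 2 powr (DIM('a) * (1 - \<beta>) * real l - q * \<beta> * real n)" .
  have "(\<Sum>z\<in>?I. min (x z) (x z powr \<beta> * h)) \<le> sum x ?I" by (intro sum_mono) simp
  also have "\<dots> \<le> 1 * s" using sum_x by simp
  also have "\<dots> \<le> (2 * 3 ^ DIM('a)) * s"
    using s one_le_power[of "3::real" "DIM('a)"] by (intro mult_right_mono) linarith+
  finally have 2: "(\<Sum>z\<in>?I. min (x z) (x z powr \<beta> * h)) \<le> 2 * 3 ^ DIM('a) * 2 powr q * m * 2 powr (- q * real n)"
    by (simp add: s_def)
  have "(\<Sum>z\<in>?I. min (x z) (x z powr \<beta> * h)) \<le> (\<Sum>z\<in>?I. x z powr \<beta> * h)" by (intro sum_mono) simp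
  also have "\<dots> = (\<Sum>z\<in>?I. x z powr \<beta>) * h" by (simp add: sum_distrib_right)
  also have "\<dots> \<le> 2 * 3 ^ DIM('a) * 2 powr q * m * 2 powr (DIM('a) * (1 - \<beta>) * real l - q * \<beta> * real n) * h"
    using 1 h by (intro mult_right_mono) auto
  finally show ?thesis using 2 m unfolding x_def
    by (simp add: min_mult_distrib_left mult.assoc)
qed

text \<open>
  Take expectations in the dyadic bound for a random probability measure \<open>R\<close>. The deviation hypothesis controls each
  cell, and domination of the mean of \<open>R\<close> by \<open>\<pi>\<close> controls the remainder, which disappears as
  \<open>N\<close> tends to infinity; a bound for the double series uniform in \<open>N\<close> therefore suffices.
\<close>

theorem expected_wasserstein_le_multiscale:
  fixes R :: "'w \<Rightarrow> 'a::euclidean_space measure" and \<nu> \<pi> :: "'a measure"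
    and p q \<beta> h m C\<^sub>0 B :: real
  assumes "prob_space M" and R[measurable]: "R \<in> M \<rightarrow>\<^sub>M prob_algebra borel"
    and \<nu>: "\<nu> \<in> space (prob_algebra borel)" and \<pi>: "\<pi> \<in> space (prob_algebra borel)"
    and p: "0 < p" "p < q" and \<beta>: "0 < \<beta>" "\<beta> < 1" and h: "h > 0" and C\<^sub>0: "C\<^sub>0 > 0"
    and m: "moment \<pi> q \<le> ennreal m" "m \<ge> 1"
    and deviation: "\<And>A. A \<in> sets borel \<Longrightarrow>
        (\<integral>\<^sup>+\<omega>. ennreal \<bar>measure (R \<omega>) A - measure \<nu> A\<bar> \<partial>M) \<le> ennreal (C\<^sub>0 * min (measure \<pi> A) (measure \<pi> A powr \<beta> * h))"
    and mean: "\<And>A. A \<in> sets borel \<Longrightarrow> emeasure (M \<bind> R) A \<le> 2 * emeasure \<pi> A"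
    and \<nu>_le: "\<And>A. A \<in> sets borel \<Longrightarrow> emeasure \<nu> A \<le> 2 * emeasure \<pi> A"
    and B: "\<And>N. (\<Sum>n\<le>N. \<Sum>l\<le>N. multiscale_term p q (q * \<beta>) (DIM('a) * (1 - \<beta>)) h n l) \<le> B"
  shows "(\<integral>\<^sup>+\<omega>. ennreal_powr (wasserstein p (R \<omega>) \<nu>) p \<partial>M)
    \<le> ennreal (2 * (2 * DIM('a)) powr p * (C\<^sub>0 * (2 * 3 ^ DIM('a) * 2 powr q)) * m * B)"
proof -
  interpret prob_space M by fact
  have Rs[measurable]: "R \<in> M \<rightarrow>\<^sub>M subprob_algebra borel" using R by (rule measurable_prob_algebraD)
  have Rsp: "R \<omega> \<in> space (prob_algebra borel)" if "\<omega> \<in> space M" for \<omega>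
    using measurable_space[OF R that] .
  let ?K = "2 * (2 * DIM('a)) powr p :: real"
  let ?c = "C\<^sub>0 * (2 * 3 ^ DIM('a) * 2 powr q) :: real"
  have bind_int: "(\<integral>\<^sup>+\<omega>. (\<integral>\<^sup>+x. f x \<partial>R \<omega>) \<partial>M) = (\<integral>\<^sup>+x. f x \<partial>(M \<bind> R))"
    if "f \<in> borel_measurable borel" for f :: "'a \<Rightarrow> ennreal"
    using that Rs by (simp add: nn_integral_bind)
  have bind_em: "(\<integral>\<^sup>+\<omega>. emeasure (R \<omega>) A \<partial>M) = emeasure (M \<bind> R) A" if "A \<in> sets borel" for A
    by (rule emeasure_bind[OF not_empty Rs that, symmetric])
  have int_m[measurable]: "(\<lambda>\<omega>. \<integral>\<^sup>+x. f x \<partial>R \<omega>) \<in> borel_measurable M"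
    if "f \<in> borel_measurable borel" for f :: "'a \<Rightarrow> ennreal"
    by (rule measurable_compose[OF Rs nn_integral_measurable_subprob_algebra[OF that]])
  have em_m[measurable]: "(\<lambda>\<omega>. emeasure (R \<omega>) A) \<in> borel_measurable M" if "A \<in> sets borel" for A
    by (rule measurable_compose[OF Rs measurable_emeasure_subprob_algebra[OF that]])
  have meas_m[measurable]: "(\<lambda>\<omega>. measure (R \<omega>) A) \<in> borel_measurable M" if "A \<in> sets borel" for A
    by (rule measurable_compose[OF Rs measurable_measure_subprob_algebra[OF that]])
  have disc_m[measurable]: "(\<lambda>\<omega>. dyadic_discrepancy p N (R \<omega>) \<nu>) \<in> borel_measurable M" for N
    unfolding dyadic_discrepancy_def by measurable
  have tail_m: "(\<lambda>x. ennreal (norm x powr p) * indicator {x :: 'a. 2 ^ N < norm x} x) \<in> borel_measurable borel" for N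
    by measurable
  have rem_m[measurable]: "(\<lambda>\<omega>. dyadic_remainder p N (R \<omega>)) \<in> borel_measurable M" for N
    unfolding dyadic_remainder_def using tail_m by measurable
  have disc: "(\<integral>\<^sup>+\<omega>. dyadic_discrepancy p N (R \<omega>) \<nu> \<partial>M) \<le> ennreal (?c * m * B)" for N
  proof -
    have "(\<integral>\<^sup>+\<omega>. dyadic_discrepancy p N (R \<omega>) \<nu> \<partial>M)
       = (\<Sum>n\<le>N. \<Sum>l\<le>N. ennreal (2 powr (p * (real n - real l))) * (\<Sum>z\<in>dyadic_indices l.
            (\<integral>\<^sup>+\<omega>. ennreal \<bar>measure (R \<omega>) (dyadic_cell n l z) - measure \<nu> (dyadic_cell n l z)\<bar> \<partial>M)))"
      unfolding dyadic_discrepancy_def by (simp add: nn_integral_sum nn_integral_cmult del: sum_ennreal)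
    also have "\<dots> \<le> (\<Sum>n\<le>N. \<Sum>l\<le>N. ennreal (?c * m * multiscale_term p q (q * \<beta>) (DIM('a) * (1 - \<beta>)) h n l))"
    proof (intro sum_mono)
      fix n l
      let ?x = "\<lambda>z. min (measure \<pi> (dyadic_cell n l z)) (measure \<pi> (dyadic_cell n l z) powr \<beta> * h)"
      let ?t = "min (2 powr (- q * real n)) (2 powr (DIM('a) * (1 - \<beta>) * real l - q * \<beta> * real n) * h)"
      have "(\<Sum>z\<in>dyadic_indices l. (\<integral>\<^sup>+\<omega>. ennreal \<bar>measure (R \<omega>) (dyadic_cell n l z) - measure \<nu> (dyadic_cell n l z)\<bar> \<partial>M))
         \<le> (\<Sum>z\<in>dyadic_indices l. ennreal (C\<^sub>0 * ?x z))"
        by (intro sum_mono deviation) simp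
      also have "\<dots> = ennreal (C\<^sub>0 * (\<Sum>z\<in>dyadic_indices l. ?x z))"
        using C\<^sub>0 h by (subst sum_ennreal) (auto simp: sum_distrib_left intro!: mult_nonneg_nonneg)
      also have "\<dots> \<le> ennreal (C\<^sub>0 * (2 * 3 ^ DIM('a) * 2 powr q * m * ?t))"
        using C\<^sub>0 h m p \<beta> by (intro ennreal_leI mult_left_mono sum_dyadic_cells_min_le[OF \<pi>]) auto
      finally have "ennreal (2 powr (p * (real n - real l))) * (\<Sum>z\<in>dyadic_indices l.
            (\<integral>\<^sup>+\<omega>. ennreal \<bar>measure (R \<omega>) (dyadic_cell n l z) - measure \<nu> (dyadic_cell n l z)\<bar> \<partial>M))
          \<le> ennreal (2 powr (p * (real n - real l))) * ennreal (C\<^sub>0 * (2 * 3 ^ DIM('a) * 2 powr q * m * ?t))"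
        by (intro mult_left_mono) auto
      also have "\<dots> = ennreal (2 powr (p * (real n - real l)) * (C\<^sub>0 * (2 * 3 ^ DIM('a) * 2 powr q * m * ?t)))"
        using C\<^sub>0 h m by (intro ennreal_mult[symmetric]) (auto intro!: mult_nonneg_nonneg)
      also have "2 powr (p * (real n - real l)) * (C\<^sub>0 * (2 * 3 ^ DIM('a) * 2 powr q * m * ?t))
          = ?c * m * multiscale_term p q (q * \<beta>) (DIM('a) * (1 - \<beta>)) h n l"
        unfolding multiscale_term_def by (simp only: mult_ac)
      finally show "ennreal (2 powr (p * (real n - real l))) * (\<Sum>z\<in>dyadic_indices l.
            (\<integral>\<^sup>+\<omega>. ennreal \<bar>measure (R \<omega>) (dyadic_cell n l z) - measure \<nu> (dyadic_cell n l z)\<bar> \<partial>M))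
          \<le> ennreal (?c * m * multiscale_term p q (q * \<beta>) (DIM('a) * (1 - \<beta>)) h n l)" .
    qed
    also have "\<dots> = ennreal (?c * m * (\<Sum>n\<le>N. \<Sum>l\<le>N. multiscale_term p q (q * \<beta>) (DIM('a) * (1 - \<beta>)) h n l))"
      using C\<^sub>0 h m by (simp add: sum_ennreal sum_nonneg multiscale_term_nonneg sum_distrib_left)
    also have "\<dots> \<le> ennreal (?c * m * B)"
      using C\<^sub>0 m B by (intro ennreal_leI mult_left_mono) auto
    finally show ?thesis .
  qed
  define \<rho> where "\<rho> N = m * (2 powr q * (1 / (1 - 2 powr - (q - p))) * 2 powr (- p * real N) + 2 powr (- (q - p) * real N))"
    for N :: nat
  have \<rho>0: "0 \<le> \<rho> N" for N
    using m p powr_less_one[of 2 "- (q - p)"] unfolding \<rho>_def by (intro mult_nonneg_nonneg add_nonneg_nonneg) auto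
  have sets: "sets \<pi> = sets borel" "sets \<nu> = sets borel" using \<pi> \<nu> by (auto simp: space_prob_algebra)
  have rem_\<pi>: "dyadic_remainder p N \<pi> \<le> ennreal (\<rho> N)" for N
    unfolding \<rho>_def by (rule dyadic_remainder_le[OF \<pi> p m])
  have rem_\<nu>: "dyadic_remainder p N \<nu> \<le> ennreal (2 * \<rho> N)" for N
  proof -
    have "dyadic_remainder p N \<nu> \<le> 2 * dyadic_remainder p N \<pi>"
      by (rule dyadic_remainder_dominated[OF sets(2,1) \<nu>_le])
    also have "\<dots> \<le> 2 * ennreal (\<rho> N)" using rem_\<pi> by (intro mult_left_mono) auto
    finally show ?thesis using \<rho>0 by (simp add: ennreal_mult)
  qed
  have rem_R: "(\<integral>\<^sup>+\<omega>. dyadic_remainder p N (R \<omega>) \<partial>M) \<le> ennreal (2 * \<rho> N)" for N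
  proof -
    have "(\<integral>\<^sup>+\<omega>. dyadic_remainder p N (R \<omega>) \<partial>M) = dyadic_remainder p N (M \<bind> R)"
    proof -
      have "(\<integral>\<^sup>+\<omega>. (\<Sum>n\<le>N. ennreal (2 powr (p * (real n - real N))) * emeasure (R \<omega>) (dyadic_shell n)) \<partial>M)
          = (\<Sum>n\<le>N. ennreal (2 powr (p * (real n - real N))) * emeasure (M \<bind> R) (dyadic_shell n))"
        by (simp add: nn_integral_sum nn_integral_cmult bind_em)
      then show ?thesis
        unfolding dyadic_remainder_def using int_m[OF tail_m] bind_int[OF tail_m]
        by (subst nn_integral_add) simp_all
    qed
    also have "\<dots> \<le> 2 * dyadic_remainder p N \<pi>"
      using sets_bind[of M R borel] measurable_space[OF Rs] not_empty
      by (intro dyadic_remainder_dominated mean sets(1)) (auto simp: space_subprob_algebra)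
    also have "\<dots> \<le> 2 * ennreal (\<rho> N)" using rem_\<pi> by (intro mult_left_mono) auto
    finally show ?thesis using \<rho>0 by (simp add: ennreal_mult)
  qed
  have B0: "0 \<le> B" using B[of 0] h multiscale_term_nonneg[of h p q "q * \<beta>" "DIM('a) * (1 - \<beta>)" 0 0] by simp
  have main: "(\<integral>\<^sup>+\<omega>. ennreal_powr (wasserstein p (R \<omega>) \<nu>) p \<partial>M) \<le> ennreal (?K * (?c * m * B + 4 * \<rho> N))" for N
  proof -
    have "(\<integral>\<^sup>+\<omega>. ennreal_powr (wasserstein p (R \<omega>) \<nu>) p \<partial>M)
      \<le> (\<integral>\<^sup>+\<omega>. ennreal ?K * (dyadic_discrepancy p N (R \<omega>) \<nu> + dyadic_remainder p N (R \<omega>) + dyadic_remainder p N \<nu>) \<partial>M)"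
      using Rsp \<nu> p by (intro nn_integral_mono wasserstein_le_dyadic) auto
    also have "\<dots> = ennreal ?K * ((\<integral>\<^sup>+\<omega>. dyadic_discrepancy p N (R \<omega>) \<nu> \<partial>M) + (\<integral>\<^sup>+\<omega>. dyadic_remainder p N (R \<omega>) \<partial>M) + dyadic_remainder p N \<nu>)"
      by (simp add: nn_integral_cmult nn_integral_add emeasure_space_1)
    also have "\<dots> \<le> ennreal ?K * (ennreal (?c * m * B) + ennreal (2 * \<rho> N) + ennreal (2 * \<rho> N))"
      by (intro mult_left_mono add_mono disc rem_R rem_\<nu>) simp
    also have "\<dots> = ennreal ?K * ennreal (?c * m * B + 4 * \<rho> N)"
      using C\<^sub>0 m B0 \<rho>0 by (simp add: ennreal_plus[symmetric] add.commute del: ennreal_plus)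
    also have "\<dots> = ennreal (?K * (?c * m * B + 4 * \<rho> N))"
      using C\<^sub>0 m B0 \<rho>0 by (intro ennreal_mult[symmetric]) (auto intro!: add_nonneg_nonneg mult_nonneg_nonneg)
    finally show ?thesis .
  qed
  \<comment> \<open>The expected distance does not involve \<open>N\<close>, so only the limit of the remainder matters.\<close>
  have pw: "(\<lambda>N. 2 powr (- s * real N)) \<longlonglongrightarrow> 0" if "s > 0" for s :: real
  proof -
    have "2 powr (- s * real N) = (2 powr - s) ^ N" for N
      by (simp add: powr_realpow[symmetric] powr_powr)
    then show ?thesis using powr_less_one[of 2 "- s"] that by (simp add: LIMSEQ_realpow_zero)
  qed
  have "\<rho> \<longlonglongrightarrow> m * (2 powr q * (1 / (1 - 2 powr - (q - p))) * 0 + 0)"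
    unfolding \<rho>_def using p by (intro tendsto_intros pw) auto
  then have "(\<lambda>N. ennreal (?K * (?c * m * B + 4 * \<rho> N))) \<longlonglongrightarrow> ennreal (?K * (?c * m * B + 4 * 0))"
    by (intro tendsto_ennrealI tendsto_intros) simp
  then have "(\<integral>\<^sup>+\<omega>. ennreal_powr (wasserstein p (R \<omega>) \<nu>) p \<partial>M) \<le> ennreal (?K * (?c * m * B + 4 * 0))"
    by (rule LIMSEQ_le_const) (use main in auto)
  then show ?thesis by (simp add: mult.assoc)
qed

section \<open>Rates of the double series\<close>

text \<open>
  Several rates are claimed with one constant \<open>K\<close>; the largest of the individual constants serves.
\<close>

lemma common_constant:
  fixes f :: "real \<Rightarrow> ennreal" and g :: "'i \<Rightarrow> real \<Rightarrow> ennreal"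
  assumes "finite \<R>" "\<And>r. r \<in> \<R> \<Longrightarrow> \<exists>K>0. \<forall>t\<ge>t\<^sub>0. f t \<le> ennreal K * m * g r t"
  shows "\<exists>K>0. \<forall>r\<in>\<R>. \<forall>t\<ge>t\<^sub>0. f t \<le> ennreal K * m * g r t"
  using assms
proof (induction rule: finite_induct)
  case empty
  show ?case by (intro exI[of _ 1]) auto
next
  case (insert x F)
  obtain K where K: "K > 0" "\<And>t. t \<ge> t\<^sub>0 \<Longrightarrow> f t \<le> ennreal K * m * g x t" using insert.prems by blast
  obtain L where L: "L > 0" "\<And>r t. r \<in> F \<Longrightarrow> t \<ge> t\<^sub>0 \<Longrightarrow> f t \<le> ennreal L * m * g r t"
    using insert.IH insert.prems by blast
  show ?case
  proof (intro exI[of _ "max K L"] conjI ballI allI impI)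
    fix r t assume r: "r \<in> insert x F" and t: "t\<^sub>0 \<le> t"
    have "ennreal K * m * g r t \<le> ennreal (max K L) * m * g r t"
      "ennreal L * m * g r t \<le> ennreal (max K L) * m * g r t"
      by (intro mult_right_mono ennreal_leI; simp)+
    then show "f t \<le> ennreal (max K L) * m * g r t"
      using r K(2)[OF t] L(2)[OF _ t] by (auto intro: order_trans)
  qed (use K in auto)
qed

locale rate_parameters =
  fixes d q p t\<^sub>0 :: real
  assumes d: "d > 0" and q: "q > 1" and p: "0 < p" "p < q" and t\<^sub>0: "t\<^sub>0 > 0"
begin

definition multiscale_rate :: "(real \<Rightarrow> real) \<Rightarrow> bool" where
  "multiscale_rate r \<longleftrightarrow> (\<exists>K>0. \<forall>t\<ge>t\<^sub>0. \<forall>N. (\<Sum>n\<le>N. \<Sum>l\<le>N.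
     multiscale_term p q ((q - 1) / 2) (d / 2 * (1 + 1 / q)) (t powr (- (1 / 2))) n l) \<le> K * r t)"

text \<open>
  As \<open>r\<close> is nonnegative, any constant can be enlarged to a positive one.
\<close>

lemma multiscale_rateI:
  assumes "\<And>t. t \<ge> t\<^sub>0 \<Longrightarrow> r t \<ge> 0"
    and "\<And>t N. t \<ge> t\<^sub>0 \<Longrightarrow> (\<Sum>n\<le>N. \<Sum>l\<le>N.
     multiscale_term p q ((q - 1) / 2) (d / 2 * (1 + 1 / q)) (t powr (- (1 / 2))) n l) \<le> c * r t"
  shows "multiscale_rate r"
  unfolding multiscale_rate_def
proof (intro exI[of _ "\<bar>c\<bar> + 1"] conjI allI impI)
  fix t :: real and N :: nat assume t: "t\<^sub>0 \<le> t"
  have "c * r t \<le> (\<bar>c\<bar> + 1) * r t" using assms(1)[OF t] by (intro mult_right_mono) auto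
  then show "(\<Sum>n\<le>N. \<Sum>l\<le>N.
     multiscale_term p q ((q - 1) / 2) (d / 2 * (1 + 1 / q)) (t powr (- (1 / 2))) n l) \<le> (\<bar>c\<bar> + 1) * r t"
    using assms(2)[OF t, of N] by linarith
qed simp

lemma critical_exponent: "d / 2 * (1 + 1 / q) = d * (q + 1) / (2 * q)"
  using q by (simp add: field_simps)

text \<open>
  The conditions on the exponents in the summation lemmas compare \<open>p * q\<close> with \<open>d * (q - p)\<close>, up to the
  common factor \<open>(q + 1) / (2 * q)\<close>.
\<close>

lemma tail_condition:
  "d / 2 * (1 + 1 / q) * (q - p) < p * (q - (q - 1) / 2) \<longleftrightarrow> d * q / (d + q) < p"
  "p * (q - (q - 1) / 2) < d / 2 * (1 + 1 / q) * (q - p) \<longleftrightarrow> p < d * q / (d + q)"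
proof -
  have eq: "d / 2 * (1 + 1 / q) * (q - p) = (q + 1) / (2 * q) * (d * (q - p))"
    "p * (q - (q - 1) / 2) = (q + 1) / (2 * q) * (p * q)"
    using q by (simp_all add: field_simps)
  have c: "(q + 1) / (2 * q) > 0" using q by simp
  have 1: "d * q / (d + q) < p \<longleftrightarrow> d * (q - p) < p * q"
    using d q by (simp add: divide_less_eq algebra_simps)
  have 2: "p < d * q / (d + q) \<longleftrightarrow> p * q < d * (q - p)"
    using d q by (simp add: less_divide_eq algebra_simps)
  show "d / 2 * (1 + 1 / q) * (q - p) < p * (q - (q - 1) / 2) \<longleftrightarrow> d * q / (d + q) < p"
    unfolding eq 1 using c by (rule mult_less_cancel_left_pos)
  show "p * (q - (q - 1) / 2) < d / 2 * (1 + 1 / q) * (q - p) \<longleftrightarrow> p < d * q / (d + q)"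
    unfolding eq 2 using c by (rule mult_less_cancel_left_pos)
qed

lemma rate_high_dimension:
  assumes "p < d / 2 * (1 + 1 / q)" "p < d * q / (d + q)"
  shows "multiscale_rate (\<lambda>t. t powr (- (p * q / ((q + 1) * d))))"
proof (rule multiscale_rateI)
  fix t :: real and N :: nat assume "t\<^sub>0 \<le> t"
  then have "t > 0" using t\<^sub>0 by simp
  note multiscale_sum_high_dimension[OF p(1) assms(1) tail_condition(2)[THEN iffD2, OF assms(2)],
      of "t powr (- (1 / 2))" "{..N}" "{..N}"]
  moreover have "(t powr (- (1 / 2))) powr (p / (d / 2 * (1 + 1 / q))) = t powr (- (p * q / ((q + 1) * d)))"
    unfolding critical_exponent powr_powr using d q by (intro arg_cong[where f = "(powr) t"]) (simp add: field_simps)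
  ultimately show "(\<Sum>n\<le>N. \<Sum>l\<le>N. multiscale_term p q ((q - 1) / 2) (d / 2 * (1 + 1 / q)) (t powr (- (1 / 2))) n l)
    \<le> two_sided_const (d / 2 * (1 + 1 / q) - p) p *
       (1 / (1 - 2 powr - ((d / 2 * (1 + 1 / q) * (q - p) - p * (q - (q - 1) / 2)) / (d / 2 * (1 + 1 / q))))) *
       t powr (- (p * q / ((q + 1) * d)))"
    using \<open>t > 0\<close> by simp
qed simp

lemma rate_heavy_tail:
  assumes "(q - 1) / 2 < p" "d * q / (d + q) < p"
  shows "multiscale_rate (\<lambda>t. t powr (- ((q - p) / (q + 1))))"
proof (rule multiscale_rateI)
  fix t :: real and N :: nat assume "t\<^sub>0 \<le> t"
  then have "t > 0" using t\<^sub>0 by simp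
  note multiscale_sum_heavy_tail[OF assms(1) p(2,1) tail_condition(1)[THEN iffD2, OF assms(2)],
      of "t powr (- (1 / 2))" "{..N}" "{..N}"]
  moreover have "(t powr (- (1 / 2))) powr ((q - p) / (q - (q - 1) / 2)) = t powr (- ((q - p) / (q + 1)))"
    unfolding powr_powr using q by (intro arg_cong[where f = "(powr) t"]) (simp add: field_simps)
  ultimately show "(\<Sum>n\<le>N. \<Sum>l\<le>N. multiscale_term p q ((q - 1) / 2) (d / 2 * (1 + 1 / q)) (t powr (- (1 / 2))) n l)
    \<le> two_sided_const (p - (q - 1) / 2) (q - p) *
       (1 / (1 - 2 powr - ((p * (q - (q - 1) / 2) - d / 2 * (1 + 1 / q) * (q - p)) / (q - (q - 1) / 2)))) *
       t powr (- ((q - p) / (q + 1)))"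
    using \<open>t > 0\<close> by simp
qed simp

lemma rate_low_dimension:
  assumes "d / 2 * (1 + 1 / q) < p" "p < (q - 1) / 2"
  shows "multiscale_rate (\<lambda>t. t powr (- (1 / 2)))"
proof (rule multiscale_rateI)
  fix t :: real and N :: nat assume "t\<^sub>0 \<le> t"
  then have "t powr (- (1 / 2)) > 0" using t\<^sub>0 by simp
  from multiscale_sum_low_dimension[OF assms this, of "{..N}" "{..N}"]
  show "(\<Sum>n\<le>N. \<Sum>l\<le>N. multiscale_term p q ((q - 1) / 2) (d / 2 * (1 + 1 / q)) (t powr (- (1 / 2))) n l)
    \<le> 1 / (1 - 2 powr - ((q - 1) / 2 - p)) * (1 / (1 - 2 powr - (p - d / 2 * (1 + 1 / q)))) * t powr (- (1 / 2))"
    by simp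
qed simp

text \<open>
  For large times \<open>ln (1 + t)\<close> dominates the number \<open>ln (1 / h)\<close> of levels, and it never falls below
  \<open>ln (1 + t\<^sub>0)\<close>, which enters the constant.
\<close>

lemma rate_critical_dimension:
  assumes "p = d / 2 * (1 + 1 / q)" "p < (q - 1) / 2"
  shows "multiscale_rate (\<lambda>t. t powr (- (1 / 2)) * ln (1 + t))"
proof (rule multiscale_rateI)
  fix t :: real assume "t\<^sub>0 \<le> t"
  then show "0 \<le> t powr (- (1 / 2)) * ln (1 + t)" using t\<^sub>0 by simp
next
  fix t :: real and N :: nat assume t: "t\<^sub>0 \<le> t"
  define h where "h = t powr (- (1 / 2))"
  define c\<^sub>1 where "c\<^sub>1 = 1 / (1 - 2 powr - ((q - 1) / 2 - p))"
  define c\<^sub>2 where "c\<^sub>2 = 1 + 1 / (1 - 2 powr - p)"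
  have t0: "t > 0" using t t\<^sub>0 by simp
  have h: "h > 0" using t0 by (simp add: h_def)
  have c: "c\<^sub>1 > 0" "c\<^sub>2 > 0"
    using assms(2) p powr_less_one[of 2 "- ((q - 1) / 2 - p)"] powr_less_one[of 2 "- p"]
    by (auto simp: c\<^sub>1_def c\<^sub>2_def intro!: add_pos_pos)
  have L0: "ln (1 + t\<^sub>0) > 0" and L: "ln (1 + t\<^sub>0) \<le> ln (1 + t)" using t t\<^sub>0 by auto
  have "c\<^sub>2 = c\<^sub>2 / ln (1 + t\<^sub>0) * ln (1 + t\<^sub>0)" using L0 by simp
  also have "\<dots> \<le> c\<^sub>2 / ln (1 + t\<^sub>0) * ln (1 + t)" using L L0 c by (intro mult_left_mono) auto
  finally have 1: "c\<^sub>2 \<le> c\<^sub>2 / ln (1 + t\<^sub>0) * ln (1 + t)" .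
  have "ln (1 / min h 1) \<le> ln (1 + t)"
  proof (cases "h \<le> 1")
    case True
    have "ln (1 / h) = ln t / 2" using h t0 by (simp add: h_def ln_div ln_powr)
    also have "\<dots> \<le> ln (1 + t)"
    proof (cases "t \<ge> 1")
      case True
      then have "0 \<le> ln t" "ln t \<le> ln (1 + t)" by auto
      then show ?thesis by linarith
    next
      case False
      then have "ln t \<le> 0" using t0 by simp
      then show ?thesis using L L0 by linarith
    qed
    finally show ?thesis using True by (simp add: min_def)
  qed (use L L0 in auto)
  then have "ln (1 / min h 1) / (p * ln 2) \<le> ln (1 + t) / (p * ln 2)"
    using p by (intro divide_right_mono) auto
  then have 2: "c\<^sub>2 + ln (1 / min h 1) / (p * ln 2) \<le> (c\<^sub>2 / ln (1 + t\<^sub>0) + 1 / (p * ln 2)) * ln (1 + t)"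
    using 1 by (simp add: distrib_right)
  have p0: "0 < p" by (rule p)
  have "(\<Sum>n\<le>N. \<Sum>l\<le>N. multiscale_term p q ((q - 1) / 2) p h n l)
      \<le> c\<^sub>1 * (min h 1 * (c\<^sub>2 + ln (1 / min h 1) / (p * ln 2)))"
    unfolding c\<^sub>1_def c\<^sub>2_def using assms(2) p q h by (intro multiscale_sum_critical_dimension) auto
  also have "\<dots> \<le> c\<^sub>1 * (h * ((c\<^sub>2 / ln (1 + t\<^sub>0) + 1 / (p * ln 2)) * ln (1 + t)))"
    using c h L0 p by (intro mult_left_mono mult_mono 2) (auto intro!: add_nonneg_nonneg divide_nonneg_pos simp: min_def)
  also have "\<dots> = c\<^sub>1 * (c\<^sub>2 / ln (1 + t\<^sub>0) + 1 / (p * ln 2)) * (h * ln (1 + t))" by (simp only: mult_ac)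
  finally show "(\<Sum>n\<le>N. \<Sum>l\<le>N. multiscale_term p q ((q - 1) / 2) (d / 2 * (1 + 1 / q)) (t powr (- (1 / 2))) n l)
     \<le> c\<^sub>1 * (c\<^sub>2 / ln (1 + t\<^sub>0) + 1 / (p * ln 2)) * (t powr (- (1 / 2)) * ln (1 + t))"
    unfolding assms(1)[symmetric] h_def[symmetric] .
qed

text \<open>
  If \<open>d * q / (d + q)\<close> is smaller than the critical exponent \<open>d / 2 * (1 + 1 / q)\<close>, then \<open>2 * q *
  q < (q + 1) * (d + q)\<close>, which says precisely that it is larger than \<open>(q - 1) / 2\<close>.
\<close>

lemma tail_condition_high_dimension:
  assumes "p < d / 2 * (1 + 1 / q)" "d * q / (d + q) < p"
  shows "(q - 1) / 2 < p"
proof -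
  have "d * q / (d + q) < d * (q + 1) / (2 * q)" using assms unfolding critical_exponent by simp
  then have "2 * q * (d * q) < d * (q + 1) * (d + q)"
    using d q by (simp add: divide_less_eq less_divide_eq mult_ac)
  then have "d * (2 * q * q) < d * ((q + 1) * (d + q))" by (simp only: mult_ac)
  then have "2 * q * q < (q + 1) * (d + q)" using d by simp
  then have "(q - 1) * (d + q) < 2 * (d * q)" by (simp add: algebra_simps)
  then have "(q - 1) / 2 < d * q / (d + q)" using d q by (simp add: less_divide_eq)
  then show ?thesis using assms(2) by linarith
qed

text \<open>
  The polynomial is the one whose positive root is \<open>d\<^sub>+\<close>.
\<close>

lemma critical_exponent_less: "d / 2 * (1 + 1 / q) < (q - 1) / 2 \<longleftrightarrow> 0 < q * q - (d + 1) * q - d"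
  "(q - 1) / 2 < d / 2 * (1 + 1 / q) \<longleftrightarrow> q * q - (d + 1) * q - d < 0"
proof -
  have pos: "0 < 2 * q" and eq: "(q - 1) / 2 * (2 * q) = (q - 1) * q" using q by simp_all
  show "d / 2 * (1 + 1 / q) < (q - 1) / 2 \<longleftrightarrow> 0 < q * q - (d + 1) * q - d"
    unfolding critical_exponent pos_divide_less_eq[OF pos] eq by (auto simp: algebra_simps)
  show "(q - 1) / 2 < d / 2 * (1 + 1 / q) \<longleftrightarrow> q * q - (d + 1) * q - d < 0"
    unfolding critical_exponent pos_less_divide_eq[OF pos] eq by (auto simp: algebra_simps)
qed

lemma below_d_plus:
  assumes "q < (d + 1 + sqrt ((d + 1)\<^sup>2 + 4 * d)) / 2"
  shows "(q - 1) / 2 < d / 2 * (1 + 1 / q)"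
  unfolding critical_exponent_less
proof (cases "2 * q \<le> d + 1")
  case True
  then have "q * q \<le> (d + 1) * q" using q d by (intro mult_right_mono) auto
  then show "q * q - (d + 1) * q - d < 0" using d by linarith
next
  case False
  then have "0 \<le> 2 * q - (d + 1)" "2 * q - (d + 1) < sqrt ((d + 1)\<^sup>2 + 4 * d)" using assms by auto
  then have "(2 * q - (d + 1))\<^sup>2 < (sqrt ((d + 1)\<^sup>2 + 4 * d))\<^sup>2"
    by (intro power_strict_mono) auto
  also have "\<dots> = (d + 1)\<^sup>2 + 4 * d" using d by simp
  finally show "q * q - (d + 1) * q - d < 0" by (simp add: power2_eq_square algebra_simps)
qed

lemma above_d_plus:
  assumes "(d + 1 + sqrt ((d + 1)\<^sup>2 + 4 * d)) / 2 < q"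
  shows "d / 2 * (1 + 1 / q) < (q - 1) / 2"
  unfolding critical_exponent_less
proof -
  have "sqrt ((d + 1)\<^sup>2 + 4 * d) < 2 * q - (d + 1)" using assms by simp
  then have "(sqrt ((d + 1)\<^sup>2 + 4 * d))\<^sup>2 < (2 * q - (d + 1))\<^sup>2"
    using d by (intro power_strict_mono) auto
  moreover have "(sqrt ((d + 1)\<^sup>2 + 4 * d))\<^sup>2 = (d + 1)\<^sup>2 + 4 * d" using d by simp
  ultimately show "0 < q * q - (d + 1) * q - d" by (simp add: power2_eq_square algebra_simps)
qed

lemma tail_condition_above_critical:
  assumes "d / 2 * (1 + 1 / q) \<le> p" "(q - 1) / 2 < p"
  shows "d * q / (d + q) < p"
  unfolding tail_condition(1)[symmetric]
proof -
  have "d / 2 * (1 + 1 / q) * (q - p) \<le> p * (q - p)" using assms p by (intro mult_right_mono) auto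
  also have "\<dots> < p * (q - (q - 1) / 2)" using assms p by (intro mult_strict_left_mono) auto
  finally show "d / 2 * (1 + 1 / q) * (q - p) < p * (q - (q - 1) / 2)" .
qed

text \<open>
  Whichever case applies, the rate in question belongs to the finite set \<open>\<R>\<close> of those functions, among the four
  that occur, which bound the double series; the constant is chosen for \<open>\<R>\<close> as a whole.
\<close>

lemma wasserstein_rate_cases:
  fixes F :: "real \<Rightarrow> ennreal"
  assumes F: "\<And>r. multiscale_rate r \<Longrightarrow> (\<And>t. t \<ge> t\<^sub>0 \<Longrightarrow> r t \<ge> 0) \<Longrightarrow>
      \<exists>K>0. \<forall>t\<ge>t\<^sub>0. F t \<le> ennreal K * m * ennreal (r t)"
  shows "\<exists>K>0. \<forall>t\<ge>t\<^sub>0.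
    (let bound = (\<lambda>r. F t \<le> ennreal K * m * ennreal r) in
     (p < d/2 * (1 + 1/q) \<longrightarrow>
       (p < d * q / (d + q) \<longrightarrow> bound (t powr (- (p * q / ((q + 1) * d))))) \<and>
       (d * q / (d + q) < p \<and> p < q \<longrightarrow> bound (t powr (- ((q - p) / (q + 1)))))) \<and>
     (p = d/2 * (1 + 1/q) \<longrightarrow>
       ((d + sqrt (d\<^sup>2 + 8 * d)) / 4 < q \<and> q < (d + 1 + sqrt ((d + 1)\<^sup>2 + 4 * d)) / 2 \<longrightarrow>
         bound (t powr (- ((q - p) / (q + 1))))) \<and>
       (q > (d + 1 + sqrt ((d + 1)\<^sup>2 + 4 * d)) / 2 \<longrightarrow> bound (t powr (- (1/2)) * ln (1 + t)))) \<and>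
     (p > d/2 * (1 + 1/q) \<longrightarrow>
       (p < (q - 1) / 2 \<longrightarrow> bound (t powr (- (1/2)))) \<and>
       ((q - 1) / 2 < p \<and> p < q \<longrightarrow> bound (t powr (- ((q - p) / (q + 1)))))))"
proof -
  define \<R> where "\<R> = {r \<in> {\<lambda>t. t powr (- (p * q / ((q + 1) * d))), \<lambda>t. t powr (- ((q - p) / (q + 1))),
      \<lambda>t. t powr (- (1/2)) * ln (1 + t), \<lambda>t. t powr (- (1/2))}. multiscale_rate r}"
  have "\<exists>K>0. \<forall>t\<ge>t\<^sub>0. F t \<le> ennreal K * m * ennreal (r t)" if "r \<in> \<R>" for r
    by (rule F) (use that t\<^sub>0 in \<open>auto simp: \<R>_def\<close>)
  then obtain K where K: "K > 0"
    and bound: "\<And>r t. r \<in> \<R> \<Longrightarrow> t \<ge> t\<^sub>0 \<Longrightarrow> F t \<le> ennreal K * m * ennreal (r t)"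
    using common_constant[of \<R> t\<^sub>0 F m "\<lambda>r t. ennreal (r t)"] unfolding \<R>_def by auto
  have high: "F t \<le> ennreal K * m * ennreal (t powr (- (p * q / ((q + 1) * d))))"
    if "p < d/2 * (1 + 1/q)" "p < d * q / (d + q)" "t \<ge> t\<^sub>0" for t
    using bound[OF _ that(3)] rate_high_dimension[OF that(1,2)] unfolding \<R>_def by blast
  have heavy: "F t \<le> ennreal K * m * ennreal (t powr (- ((q - p) / (q + 1))))"
    if "(q - 1) / 2 < p" "d * q / (d + q) < p" "t \<ge> t\<^sub>0" for t
    using bound[OF _ that(3)] rate_heavy_tail[OF that(1,2)] unfolding \<R>_def by blast
  have critical: "F t \<le> ennreal K * m * ennreal (t powr (- (1/2)) * ln (1 + t))"
    if "p = d/2 * (1 + 1/q)" "(d + 1 + sqrt ((d + 1)\<^sup>2 + 4 * d)) / 2 < q" "t \<ge> t\<^sub>0" for t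
  proof -
    have "p < (q - 1) / 2" using above_d_plus[OF that(2)] unfolding that(1)[symmetric] .
    from rate_critical_dimension[OF that(1) this] show ?thesis
      using bound[OF _ that(3)] unfolding \<R>_def by blast
  qed
  have low: "F t \<le> ennreal K * m * ennreal (t powr (- (1/2)))"
    if "d/2 * (1 + 1/q) < p" "p < (q - 1) / 2" "t \<ge> t\<^sub>0" for t
    using bound[OF _ that(3)] rate_low_dimension[OF that(1,2)] unfolding \<R>_def by blast
  have critical_heavy: "F t \<le> ennreal K * m * ennreal (t powr (- ((q - p) / (q + 1))))"
    if "p = d/2 * (1 + 1/q)" "q < (d + 1 + sqrt ((d + 1)\<^sup>2 + 4 * d)) / 2" "t \<ge> t\<^sub>0" for t
  proof -
    have "(q - 1) / 2 < p" using below_d_plus[OF that(2)] unfolding that(1)[symmetric] .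
    with tail_condition_above_critical[OF eq_refl[OF that(1)[symmetric]]] show ?thesis
      using heavy that(3) by blast
  qed
  have high_heavy: "F t \<le> ennreal K * m * ennreal (t powr (- ((q - p) / (q + 1))))"
    if "p < d/2 * (1 + 1/q)" "d * q / (d + q) < p" "t \<ge> t\<^sub>0" for t
    by (rule heavy[OF tail_condition_high_dimension[OF that(1,2)] that(2,3)])
  have low_heavy: "F t \<le> ennreal K * m * ennreal (t powr (- ((q - p) / (q + 1))))"
    if "d/2 * (1 + 1/q) < p" "(q - 1) / 2 < p" "t \<ge> t\<^sub>0" for t
    by (rule heavy[OF that(2) tail_condition_above_critical[OF less_imp_le[OF that(1)] that(2)] that(3)])
  show ?thesis
    unfolding Let_def
    by (intro exI[of _ K] conjI allI impI K; (elim conjE)?;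
        (rule high high_heavy critical critical_heavy low low_heavy; assumption))
qed

end

section \<open>Ergodicity of the semigroup\<close>

text \<open>
  The supremum in the definition is one of real numbers, so it bounds its members only because the integrals are bounded, here by
  \<open>2\<close>.
\<close>

lemma tv_norm_bound:
  fixes \<mu> \<nu> :: "'a::euclidean_space measure" and f :: "'a \<Rightarrow> real"
  assumes "\<mu> \<in> space (prob_algebra borel)" "\<nu> \<in> space (prob_algebra borel)"
    and f: "f \<in> borel_measurable borel" "\<And>x. \<bar>f x\<bar> \<le> 1"
  shows "\<bar>(\<integral>x. f x \<partial>\<mu>) - (\<integral>x. f x \<partial>\<nu>)\<bar> \<le> tv_norm \<mu> \<nu>"
  unfolding tv_norm_def
proof (rule cSUP_upper)
  have le1: "\<bar>\<integral>x. g x \<partial>\<rho>\<bar> \<le> 1" if "\<rho> \<in> space (prob_algebra borel)"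
    "g \<in> borel_measurable borel" "\<And>x. \<bar>g x\<bar> \<le> 1" for \<rho> :: "'a measure" and g :: "'a \<Rightarrow> real"
  proof -
    have "sets \<rho> = sets borel" and "prob_space \<rho>" using that by (auto simp: space_prob_algebra)
    interpret prob_space \<rho> by fact
    have [measurable]: "g \<in> borel_measurable \<rho>" using that \<open>sets \<rho> = sets borel\<close> by (simp cong: measurable_cong_sets)
    have "integrable \<rho> g" using that by (intro integrable_const_bound[of _ 1]) auto
    then have "\<bar>\<integral>x. g x \<partial>\<rho>\<bar> \<le> (\<integral>x. \<bar>g x\<bar> \<partial>\<rho>)" by (intro integral_abs_bound)
    also have "\<dots> \<le> (\<integral>x. 1 \<partial>\<rho>)"
      using \<open>integrable \<rho> g\<close> that by (intro integral_mono) auto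
    finally show ?thesis by (simp add: prob_space)
  qed
  show "bdd_above ((\<lambda>f. \<bar>(\<integral>x. f x \<partial>\<mu>) - (\<integral>x. f x \<partial>\<nu>)\<bar>) ` {f \<in> borel_measurable borel. \<forall>x. \<bar>(f :: 'a \<Rightarrow> real) x\<bar> \<le> 1})"
  proof (intro bdd_aboveI2[where M = 2])
    fix g assume "g \<in> {f \<in> borel_measurable borel. \<forall>x. \<bar>(f :: 'a \<Rightarrow> real) x\<bar> \<le> 1}"
    then show "\<bar>(\<integral>x. g x \<partial>\<mu>) - (\<integral>x. g x \<partial>\<nu>)\<bar> \<le> 2"
      using le1[OF assms(1), of g] le1[OF assms(2), of g] by auto
  qed
  show "f \<in> {f \<in> borel_measurable borel. \<forall>x. \<bar>f x\<bar> \<le> 1}" using f by auto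
qed

lemma tv_norm_measure_bound:
  fixes \<mu> \<nu> :: "'a::euclidean_space measure"
  assumes "\<mu> \<in> space (prob_algebra borel)" "\<nu> \<in> space (prob_algebra borel)" "A \<in> sets borel"
  shows "\<bar>measure \<mu> A - measure \<nu> A\<bar> \<le> tv_norm \<mu> \<nu>"
proof -
  have "(\<integral>x. indicator A x \<partial>\<rho>) = measure \<rho> A" if "\<rho> \<in> space (prob_algebra borel)" for \<rho> :: "'a measure"
  proof -
    have "sets \<rho> = sets borel" and "prob_space \<rho>" using that by (auto simp: space_prob_algebra)
    then show ?thesis using assms(3) sets_eq_imp_space_eq[of \<rho> borel] by simp
  qed
  then show ?thesis
    using tv_norm_bound[OF assms(1,2), of "indicator A"] assms by (auto simp: indicator_def)
qed

text \<open>
  Otherwise \<open>e t + e (t + s)\<close> would be at least \<open>\<epsilon>\<close> on the whole ray and could not be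
  integrable.
\<close>

lemma integrable_on_ray_small:
  fixes e :: "real \<Rightarrow> real"
  assumes e: "set_integrable lborel {0..} e" "\<And>t. t \<ge> 0 \<Longrightarrow> e t \<ge> 0" and s: "s \<ge> 0" and \<epsilon>: "\<epsilon> > 0"
  shows "\<exists>t\<ge>0. e t < \<epsilon> \<and> e (t + s) < \<epsilon>"
proof (rule ccontr)
  assume not: "\<not> ?thesis"
  define g where "g t = indicator {0..} t * e t" for t :: real
  have g: "integrable lborel g" using e(1) by (simp add: set_integrable_def g_def[abs_def])
  have "integrable lborel (\<lambda>t. g (s + 1 * t))" by (rule lborel_integrable_real_affine[OF g]) simp
  then have "integrable lborel (\<lambda>t. g t + g (s + t))" using g by simp
  then have fin: "(\<integral>\<^sup>+t. ennreal (norm (g t + g (s + t))) \<partial>lborel) < \<infinity>"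
    unfolding integrable_iff_bounded by simp
  have "(\<integral>\<^sup>+t. ennreal \<epsilon> * indicator {0::real..} t \<partial>lborel) \<le> (\<integral>\<^sup>+t. ennreal (norm (g t + g (s + t))) \<partial>lborel)"
  proof (intro nn_integral_mono)
    fix t :: real
    show "ennreal \<epsilon> * indicator {0..} t \<le> ennreal (norm (g t + g (s + t)))"
    proof (cases "t \<ge> 0")
      case True
      then have "\<epsilon> \<le> e t \<or> \<epsilon> \<le> e (t + s)" using not by force
      then have "\<epsilon> \<le> e t + e (s + t)" using e(2)[of t] e(2)[of "t + s"] True s by (auto simp: add.commute)
      then show ?thesis using True s by (auto simp: g_def intro!: ennreal_leI)
    qed simp
  qed
  moreover have "(\<integral>\<^sup>+t. ennreal \<epsilon> * indicator {0::real..} t \<partial>lborel) = \<infinity>"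
  proof -
    have "emeasure lborel {0::real..} = \<infinity>"
    proof -
      have "ennreal (real n) \<le> emeasure lborel {0::real..}" for n
        using emeasure_mono[of "{0..real n}" "{0..}" lborel] by simp
      then show ?thesis
        by (metis ennreal_less_top ennreal_of_nat_eq_real_of_nat ennreal_Ex_less_of_nat infinity_ennreal_def leD top.not_eq_extremum)
    qed
    then show ?thesis using \<epsilon> by (simp add: nn_integral_cmult_indicator ennreal_mult_eq_top_iff)
  qed
  ultimately show False using fin by simp
qed

context
  fixes P :: "real \<Rightarrow> 'a::euclidean_space \<Rightarrow> 'a measure" and \<nu> :: "'a measure"
    and \<psi> :: "'a \<Rightarrow> real" and e :: "real \<Rightarrow> real"
  assumes P: "markov_semigroup P" and \<nu>: "\<nu> \<in> space (prob_algebra borel)"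
    and \<psi>: "\<And>x. \<psi> x \<ge> 0" and e: "set_integrable lborel {0..} e" "\<And>t. t \<ge> 0 \<Longrightarrow> e t \<ge> 0"
    and tv: "\<And>t x. t \<ge> 0 \<Longrightarrow> tv_norm (P t x) \<nu> \<le> \<psi> x * e t"
begin

lemma kernel_measurable: "t \<ge> 0 \<Longrightarrow> P t \<in> borel \<rightarrow>\<^sub>M prob_algebra borel"
  using P by (simp add: markov_semigroup_def)

lemma kernel_space: "t \<ge> 0 \<Longrightarrow> P t x \<in> space (prob_algebra borel)"
  using measurable_space[OF kernel_measurable, of t x] by simp

lemma kernel_integral_deviation:
  fixes f :: "'a \<Rightarrow> real"
  assumes "t \<ge> 0" "f \<in> borel_measurable borel" "\<And>x. \<bar>f x\<bar> \<le> 1"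
  shows "\<bar>(\<integral>y. f y \<partial>P t x) - (\<integral>y. f y \<partial>\<nu>)\<bar> \<le> \<psi> x * e t"
  using tv_norm_bound[OF kernel_space[OF assms(1), of x] \<nu> assms(2,3)] tv[OF assms(1), of x] by linarith

lemma kernel_measure_deviation:
  assumes "t \<ge> 0" "A \<in> sets borel"
  shows "\<bar>measure (P t x) A - measure \<nu> A\<bar> \<le> \<psi> x * e t"
  using tv_norm_measure_bound[OF kernel_space[OF assms(1), of x] \<nu> assms(2)] tv[OF assms(1), of x] by linarith

lemma vanishing_times:
  obtains \<tau> :: "nat \<Rightarrow> real" where "\<And>n. \<tau> n \<ge> 0" "(\<lambda>n. e (\<tau> n)) \<longlonglongrightarrow> 0"
proof -
  have "\<exists>t\<ge>0. e t < inverse (Suc n)" for n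
    using integrable_on_ray_small[OF e, of 0 "inverse (Suc n)"] by auto
  then obtain \<tau> where \<tau>: "\<And>n. \<tau> n \<ge> 0" "\<And>n. e (\<tau> n) < inverse (Suc n)" by metis
  have "(\<lambda>n. e (\<tau> n)) \<longlonglongrightarrow> 0"
    by (rule tendsto_sandwich[OF _ _ tendsto_const LIMSEQ_inverse_real_of_nat])
       (use \<tau> e(2) in \<open>auto intro!: always_eventually less_imp_le\<close>)
  then show ?thesis using \<tau>(1) that by blast
qed

lemma kernel_integral_tendsto:
  fixes f :: "'a \<Rightarrow> real"
  assumes \<tau>: "\<And>n. \<tau> n \<ge> 0" "(\<lambda>n. e (\<tau> n)) \<longlonglongrightarrow> 0"
    and f: "f \<in> borel_measurable borel" "\<And>x. \<bar>f x\<bar> \<le> 1"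
  shows "(\<lambda>n. \<integral>y. f y \<partial>P (\<tau> n) x) \<longlonglongrightarrow> (\<integral>y. f y \<partial>\<nu>)"
proof -
  have "(\<lambda>n. \<psi> x * e (\<tau> n)) \<longlonglongrightarrow> \<psi> x * 0" by (intro tendsto_intros \<tau>)
  then have "(\<lambda>n. \<psi> x * e (\<tau> n)) \<longlonglongrightarrow> 0" by simp
  then have "(\<lambda>n. (\<integral>y. f y \<partial>P (\<tau> n) x) - (\<integral>y. f y \<partial>\<nu>)) \<longlonglongrightarrow> 0"
    by (rule Lim_null_comparison[rotated])
       (use kernel_integral_deviation[OF \<tau>(1) f] in \<open>auto intro!: always_eventually\<close>)
  then show ?thesis by (simp add: LIM_zero_iff)
qed

text \<open>
  Compare \<open>P\<^sub>t\<^sub>+\<^sub>s(x, A)\<close> with \<open>\<nu>(A)\<close> directly, and with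
  \<open>\<nu>P\<^sub>s(A)\<close> through \<open>P\<^sub>t\<^sub>+\<^sub>s = P\<^sub>tP\<^sub>s\<close>, at a time
  \<open>t\<close> for which both \<open>e t\<close> and \<open>e (t + s)\<close> are small.
\<close>

lemma kernel_invariant: "invariant_distribution P \<nu>"
  unfolding invariant_distribution_def
proof (intro conjI \<nu> allI impI)
  fix s :: real assume s: "0 \<le> s"
  have sets_\<nu>: "sets \<nu> = sets borel" and "prob_space \<nu>" using \<nu> by (auto simp: space_prob_algebra)
  interpret prob_space \<nu> by fact
  have Ps: "P s \<in> \<nu> \<rightarrow>\<^sub>M subprob_algebra borel"
    using kernel_measurable[OF s] sets_\<nu> by (auto intro: measurable_prob_algebraD cong: measurable_cong_sets)
  have bind_in: "\<nu> \<bind> P s \<in> space (prob_algebra borel)"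
    using measurable_space[OF measurable_bind_prob_space[OF
        measurable_const[OF \<nu>, of "borel :: 'a measure"] kernel_measurable[OF s]], of 0] by simp
  then have sets_bind: "sets (\<nu> \<bind> P s) = sets borel" and "prob_space (\<nu> \<bind> P s)"
    by (auto simp: space_prob_algebra)
  show "\<nu> \<bind> P s = \<nu>"
  proof (rule measure_eqI)
    show "sets (\<nu> \<bind> P s) = sets \<nu>" using sets_bind sets_\<nu> by simp
    fix A assume "A \<in> sets (\<nu> \<bind> P s)"
    then have A: "A \<in> sets borel" using sets_bind by simp
    define g where "g y = measure (P s y) A" for y
    have g: "g \<in> borel_measurable borel" unfolding g_def
      using measurable_compose[OF kernel_measurable[OF s] measurable_measure_prob_algebra[OF A]] .
    have g1: "\<bar>g y\<bar> \<le> 1" for y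
      using kernel_space[OF s, of y] prob_space.prob_le_1[of "P s y" A] by (auto simp: g_def space_prob_algebra)
    have bindA: "measure (\<nu> \<bind> P s) A = (\<integral>y. g y \<partial>\<nu>)"
      unfolding g_def by (rule measure_bind[OF Ps A])
    have small: "\<bar>measure (\<nu> \<bind> P s) A - measure \<nu> A\<bar> \<le> 2 * \<psi> x * \<epsilon>" if "\<epsilon> > 0" for x \<epsilon>
    proof -
      obtain t where t: "t \<ge> 0" "e t < \<epsilon>" "e (t + s) < \<epsilon>"
        using integrable_on_ray_small[OF e s \<open>\<epsilon> > 0\<close>] by auto
      interpret Pt: prob_space "P t x" using kernel_space[OF t(1), of x] by (simp add: space_prob_algebra)
      have "sets (P t x) = sets borel" using kernel_space[OF t(1), of x] by (simp add: space_prob_algebra)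
      then have "P s \<in> P t x \<rightarrow>\<^sub>M subprob_algebra borel"
        using kernel_measurable[OF s] by (auto intro: measurable_prob_algebraD cong: measurable_cong_sets)
      then have "measure (P t x \<bind> P s) A = (\<integral>y. g y \<partial>P t x)"
        unfolding g_def by (rule Pt.measure_bind[OF _ A])
      moreover have "P (t + s) x = P t x \<bind> P s" using P t(1) s by (simp add: markov_semigroup_def)
      ultimately have ck: "measure (P (t + s) x) A = (\<integral>y. g y \<partial>P t x)" by simp
      have "\<bar>measure (P (t + s) x) A - measure \<nu> A\<bar> \<le> \<psi> x * e (t + s)"
        using t(1) s A by (intro kernel_measure_deviation) auto
      moreover have "\<bar>(\<integral>y. g y \<partial>P t x) - (\<integral>y. g y \<partial>\<nu>)\<bar> \<le> \<psi> x * e t"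
        by (rule kernel_integral_deviation[OF t(1) g g1])
      moreover have "\<psi> x * e t \<le> \<psi> x * \<epsilon>" "\<psi> x * e (t + s) \<le> \<psi> x * \<epsilon>"
        using t \<psi>[of x] by (auto intro!: mult_left_mono)
      ultimately show ?thesis unfolding bindA ck by linarith
    qed
    have "\<bar>measure (\<nu> \<bind> P s) A - measure \<nu> A\<bar> \<le> 0"
    proof (rule field_le_epsilon)
      fix \<epsilon> :: real assume "\<epsilon> > 0"
      \<comment> \<open>Any starting point will do; the summand \<open>1\<close> keeps the denominator positive.\<close>
      have "\<bar>measure (\<nu> \<bind> P s) A - measure \<nu> A\<bar> \<le> 2 * \<psi> 0 * (\<epsilon> / (2 * \<psi> 0 + 1))"
        using \<open>\<epsilon> > 0\<close> \<psi>[of 0] by (intro small) auto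
      also have "\<dots> \<le> \<epsilon>" using \<open>\<epsilon> > 0\<close> \<psi>[of 0] by (simp add: divide_le_eq)
      finally show "\<bar>measure (\<nu> \<bind> P s) A - measure \<nu> A\<bar> \<le> 0 + \<epsilon>" by simp
    qed
    then have "measure (\<nu> \<bind> P s) A = measure \<nu> A" by simp
    then show "emeasure (\<nu> \<bind> P s) A = emeasure \<nu> A"
      using \<open>prob_space (\<nu> \<bind> P s)\<close> by (simp add: emeasure_eq_measure finite_measure.emeasure_eq_measure prob_space_def)
  qed
qed

text \<open>
  Along times with vanishing \<open>e\<close>, \<open>P\<^sub>t(x, A)\<close> converges to \<open>\<nu>(A)\<close> for every
  \<open>x\<close>; integrate in \<open>x\<close> against another invariant law by dominated convergence.
\<close>

lemma kernel_invariant_unique: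
  assumes "invariant_distribution P \<mu>"
  shows "\<mu> = \<nu>"
proof (rule measure_eqI)
  have \<mu>: "\<mu> \<in> space (prob_algebra borel)" and inv: "\<And>t. t \<ge> 0 \<Longrightarrow> \<mu> \<bind> P t = \<mu>"
    using assms by (auto simp: invariant_distribution_def)
  have sets_\<mu>: "sets \<mu> = sets borel" and "prob_space \<mu>" using \<mu> by (auto simp: space_prob_algebra)
  have sets_\<nu>: "sets \<nu> = sets borel" and "prob_space \<nu>" using \<nu> by (auto simp: space_prob_algebra)
  interpret m: prob_space \<mu> by fact
  interpret n: prob_space \<nu> by fact
  show "sets \<mu> = sets \<nu>" using sets_\<mu> sets_\<nu> by simp
  fix A assume "A \<in> sets \<mu>"
  then have A: "A \<in> sets borel" using sets_\<mu> by simp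
  obtain \<tau> where \<tau>: "\<And>n. \<tau> n \<ge> 0" "(\<lambda>n. e (\<tau> n)) \<longlonglongrightarrow> 0" using vanishing_times by blast
  have lim: "(\<lambda>n. measure (P (\<tau> n) x) A) \<longlonglongrightarrow> measure \<nu> A" for x
  proof -
    have "(\<lambda>n. \<psi> x * e (\<tau> n)) \<longlonglongrightarrow> \<psi> x * 0" by (intro tendsto_intros \<tau>)
    then have "(\<lambda>n. \<psi> x * e (\<tau> n)) \<longlonglongrightarrow> 0" by simp
    then have "(\<lambda>n. measure (P (\<tau> n) x) A - measure \<nu> A) \<longlonglongrightarrow> 0"
      by (rule Lim_null_comparison[rotated])
         (use kernel_measure_deviation[OF \<tau>(1) A] in \<open>auto intro!: always_eventually\<close>)
    then show ?thesis by (simp add: LIM_zero_iff)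
  qed
  have Pt: "P (\<tau> n) \<in> \<mu> \<rightarrow>\<^sub>M subprob_algebra borel" for n
    using kernel_measurable[OF \<tau>(1)] sets_\<mu> by (auto intro: measurable_prob_algebraD cong: measurable_cong_sets)
  have "(\<lambda>n. \<integral>x. measure (P (\<tau> n) x) A \<partial>\<mu>) \<longlonglongrightarrow> (\<integral>x. measure \<nu> A \<partial>\<mu>)"
  proof (rule integral_dominated_convergence[where w = "\<lambda>_. 1"])
    show "(\<lambda>x. measure (P (\<tau> n) x) A) \<in> borel_measurable \<mu>" for n
      by (rule measurable_compose[OF Pt measurable_measure_subprob_algebra[OF A]])
    show "AE x in \<mu>. norm (measure (P (\<tau> n) x) A) \<le> 1" for n
      using prob_space.prob_le_1[of "P (\<tau> n) _"] kernel_space[OF \<tau>(1), of n]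
      by (intro AE_I2) (simp add: space_prob_algebra)
  qed (use lim in auto)
  moreover have "(\<integral>x. measure (P (\<tau> n) x) A \<partial>\<mu>) = measure \<mu> A" for n
    using m.measure_bind[OF Pt A, of n] inv[OF \<tau>(1)] by simp
  ultimately have "measure \<mu> A = measure \<nu> A"
    by (simp add: LIMSEQ_const_iff m.prob_space)
  then show "emeasure \<mu> A = emeasure \<nu> A"
    by (simp add: m.emeasure_eq_measure n.emeasure_eq_measure)
qed

text \<open>
  Total variation convergence passes to bounded functions only. Hence the norm is truncated at \<open>k\<close> and normalized to
  take values in \<open>[0, 1]\<close>, Fatou's lemma is applied to the starting law, and \<open>k\<close> tends to infinity by
  monotone convergence.
\<close>

lemma kernel_limit_moment:
  assumes \<mu>: "\<mu> \<in> space (prob_algebra borel)"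
    and S: "\<And>t. t \<ge> 0 \<Longrightarrow> moment (\<mu> \<bind> P t) q \<le> S"
  shows "moment \<nu> q \<le> S"
proof -
  have sets_\<mu>: "sets \<mu> = sets borel" and "prob_space \<mu>" using \<mu> by (auto simp: space_prob_algebra)
  have sets_\<nu>[measurable_cong]: "sets \<nu> = sets borel" and "prob_space \<nu>" using \<nu> by (auto simp: space_prob_algebra)
  interpret m: prob_space \<mu> by fact
  interpret n: prob_space \<nu> by fact
  obtain \<tau> where \<tau>: "\<And>n. \<tau> n \<ge> 0" "(\<lambda>n. e (\<tau> n)) \<longlonglongrightarrow> 0" using vanishing_times by blast
  have Pt: "P (\<tau> n) \<in> \<mu> \<rightarrow>\<^sub>M subprob_algebra borel" for n
    using kernel_measurable[OF \<tau>(1)] sets_\<mu> by (auto intro: measurable_prob_algebraD cong: measurable_cong_sets)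
  have trunc: "(\<integral>\<^sup>+x. ennreal (min (norm x powr q) (real k)) \<partial>\<nu>) \<le> S" for k
  proof -
    define f where "f x = min (norm x powr q) (real k) / (real k + 1)" for x :: 'a
    have f[measurable]: "f \<in> borel_measurable borel" unfolding f_def by measurable
    have f0: "0 \<le> f x" and f1: "\<bar>f x\<bar> \<le> 1" for x by (auto simp: f_def divide_le_eq min_def)
    have eq: "(\<integral>\<^sup>+x. ennreal (f x) \<partial>\<rho>) = ennreal (\<integral>x. f x \<partial>\<rho>)"
      if "\<rho> \<in> space (prob_algebra borel)" for \<rho> :: "'a measure"
    proof -
      have sets_\<rho>[measurable_cong]: "sets \<rho> = sets borel" and "prob_space \<rho>" using that by (auto simp: space_prob_algebra)
      interpret prob_space \<rho> by fact
      have "integrable \<rho> f" using f1 by (intro integrable_const_bound[of _ 1]) auto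
      then show ?thesis using f0 by (intro nn_integral_eq_integral) auto
    qed
    have "(\<lambda>n. \<integral>\<^sup>+y. ennreal (f y) \<partial>P (\<tau> n) x) \<longlonglongrightarrow> (\<integral>\<^sup>+y. ennreal (f y) \<partial>\<nu>)" for x
      unfolding eq[OF \<nu>] eq[OF kernel_space[OF \<tau>(1)]]
      by (intro tendsto_ennrealI kernel_integral_tendsto \<tau> f f1)
    then have lim: "liminf (\<lambda>n. \<integral>\<^sup>+y. ennreal (f y) \<partial>P (\<tau> n) x) = (\<integral>\<^sup>+y. ennreal (f y) \<partial>\<nu>)" for x
      by (intro lim_imp_Liminf) auto
    have "(\<integral>\<^sup>+y. ennreal (f y) \<partial>\<nu>) = (\<integral>\<^sup>+x. liminf (\<lambda>n. \<integral>\<^sup>+y. ennreal (f y) \<partial>P (\<tau> n) x) \<partial>\<mu>)"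
      by (simp add: lim m.emeasure_space_1)
    also have "\<dots> \<le> liminf (\<lambda>n. \<integral>\<^sup>+x. \<integral>\<^sup>+y. ennreal (f y) \<partial>P (\<tau> n) x \<partial>\<mu>)"
      by (intro nn_integral_liminf measurable_compose[OF Pt nn_integral_measurable_subprob_algebra]) measurable
    also have "\<dots> \<le> liminf (\<lambda>n. ennreal (1 / (real k + 1)) * S)"
    proof (intro Liminf_mono always_eventually allI)
      fix n
      have "(\<integral>\<^sup>+x. \<integral>\<^sup>+y. ennreal (f y) \<partial>P (\<tau> n) x \<partial>\<mu>) = (\<integral>\<^sup>+y. ennreal (f y) \<partial>(\<mu> \<bind> P (\<tau> n)))"
        by (intro nn_integral_bind[symmetric, OF _ Pt]) measurable
      also have "\<dots> \<le> (\<integral>\<^sup>+y. ennreal (1 / (real k + 1)) * ennreal (norm y powr q) \<partial>(\<mu> \<bind> P (\<tau> n)))"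
        by (intro nn_integral_mono) (auto simp: f_def ennreal_mult[symmetric] intro!: ennreal_leI divide_right_mono)
      also have "\<dots> = ennreal (1 / (real k + 1)) * moment (\<mu> \<bind> P (\<tau> n)) q"
        unfolding moment_def using sets_bind[OF subprob_measurableD(2)[OF Pt] m.not_empty]
        by (intro nn_integral_cmult) (auto cong: measurable_cong_sets)
      also have "\<dots> \<le> ennreal (1 / (real k + 1)) * S"
        by (intro mult_left_mono S \<tau>) auto
      finally show "(\<integral>\<^sup>+x. \<integral>\<^sup>+y. ennreal (f y) \<partial>P (\<tau> n) x \<partial>\<mu>) \<le> ennreal (1 / (real k + 1)) * S" .
    qed
    also have "\<dots> = ennreal (1 / (real k + 1)) * S" by (simp add: Liminf_const)
    finally have "ennreal (real k + 1) * (\<integral>\<^sup>+y. ennreal (f y) \<partial>\<nu>) \<le> ennreal (real k + 1) * (ennreal (1 / (real k + 1)) * S)"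
      by (intro mult_left_mono) auto
    also have "\<dots> = S"
    proof -
      have "ennreal (real k + 1) * ennreal (1 / (real k + 1)) = 1"
        by (subst ennreal_mult[symmetric]) auto
      then show ?thesis by (simp only: mult.assoc[symmetric] mult_1_left)
    qed
    also have "ennreal (real k + 1) * (\<integral>\<^sup>+y. ennreal (f y) \<partial>\<nu>) = (\<integral>\<^sup>+x. ennreal (real k + 1) * ennreal (f x) \<partial>\<nu>)"
      by (intro nn_integral_cmult[symmetric]) measurable
    also have "\<dots> = (\<integral>\<^sup>+x. ennreal (min (norm x powr q) (real k)) \<partial>\<nu>)"
    proof (intro nn_integral_cong)
      fix x :: 'a
      have "ennreal (real k + 1) * ennreal (f x) = ennreal ((real k + 1) * f x)"
        using f0 by (subst ennreal_mult) auto
      then show "ennreal (real k + 1) * ennreal (f x) = ennreal (min (norm x powr q) (real k))"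
        by (simp only: f_def) simp
    qed
    finally show ?thesis .
  qed
  have "moment \<nu> q = (\<integral>\<^sup>+x. (SUP k. ennreal (min (norm x powr q) (real k))) \<partial>\<nu>)"
    unfolding moment_def
  proof (intro nn_integral_cong antisym SUP_least)
    fix x :: 'a
    obtain k where "norm x powr q \<le> real k" using real_arch_simple by blast
    then show "ennreal (norm x powr q) \<le> (SUP k. ennreal (min (norm x powr q) (real k)))"
      by (intro SUP_upper2[of k]) auto
  qed (auto intro: ennreal_leI)
  also have "\<dots> = (SUP k. \<integral>\<^sup>+x. ennreal (min (norm x powr q) (real k)) \<partial>\<nu>)"
    by (intro nn_integral_monotone_convergence_SUP)
       (auto simp: incseq_def le_fun_def intro!: ennreal_leI)
  also have "\<dots> \<le> S" using trunc by (intro SUP_least) auto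
  finally show ?thesis .
qed

end

section \<open>Occupation measures of right continuous processes\<close>

locale right_continuous_process = prob_space M
  for M :: "'w measure" and X :: "real \<Rightarrow> 'w \<Rightarrow> 'a::euclidean_space" +
  assumes X_measurable: "\<And>t. t \<ge> 0 \<Longrightarrow> X t \<in> borel_measurable M"
    and right_continuous: "\<And>\<omega> t. \<omega> \<in> space M \<Longrightarrow> t \<ge> 0 \<Longrightarrow> continuous (at_right t) (\<lambda>s. X s \<omega>)"
begin

abbreviation horizon :: "real \<Rightarrow> real measure" where
  "horizon t \<equiv> restrict_space lborel {0..t}"

text \<open>
  Approximate \<open>X\<^sub>s\<close> by the values at the grid points \<open>(k + 1) / (n + 1)\<close> that lie strictly to the
  right of \<open>s\<close>: these are countably many random variables, and right continuity gives convergence. Times are cut at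
  \<open>0\<close> because nothing is known about negative times.
\<close>

lemma jointly_measurable: "(\<lambda>(s, \<omega>). X (max 0 s) \<omega>) \<in> borel_measurable (lborel \<Otimes>\<^sub>M M)"
proof (rule borel_measurable_LIMSEQ_metric)
  define k where "k n s = nat \<lfloor>real (Suc n) * max 0 s\<rfloor>" for n and s :: real
  define f where "f n = (\<lambda>(s, \<omega>). X ((real (k n s) + 1) / real (Suc n)) \<omega>)" for n
  show "f n \<in> borel_measurable (lborel \<Otimes>\<^sub>M M)" for n
  proof -
    have "(\<lambda>z. X ((real i + 1) / real (Suc n)) (snd z)) \<in> borel_measurable (lborel \<Otimes>\<^sub>M M)" for i
      by (intro measurable_compose[OF measurable_snd X_measurable]) auto
    moreover have "(\<lambda>z. k n (fst z)) \<in> lborel \<Otimes>\<^sub>M M \<rightarrow>\<^sub>M count_space UNIV"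
      unfolding k_def by measurable
    ultimately have "(\<lambda>z. X ((real (k n (fst z)) + 1) / real (Suc n)) (snd z)) \<in> borel_measurable (lborel \<Otimes>\<^sub>M M)"
      by (rule measurable_compose_countable)
    then show ?thesis by (simp add: f_def case_prod_beta')
  qed
  fix z :: "real \<times> 'w" assume z: "z \<in> space (lborel \<Otimes>\<^sub>M M)"
  define u where "u = max 0 (fst z)"
  have u: "u \<ge> 0" by (simp add: u_def)
  have upper: "u < (real (k n (fst z)) + 1) / real (Suc n)" for n
  proof -
    have "real (Suc n) * u < real (k n (fst z)) + 1"
      unfolding k_def u_def[symmetric] using u by (simp add: of_nat_nat)
    then show ?thesis by (simp add: field_simps)
  qed
  have lower: "(real (k n (fst z)) + 1) / real (Suc n) \<le> u + inverse (real (Suc n))" for n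
  proof -
    have "0 \<le> real (Suc n) * u" using u by simp
    then have "real (k n (fst z)) \<le> real (Suc n) * u"
      unfolding k_def u_def[symmetric] by linarith
    then have "real (k n (fst z)) / real (Suc n) \<le> u"
      by (simp add: divide_le_eq mult.commute del: of_nat_Suc)
    then show ?thesis by (simp add: add_divide_distrib inverse_eq_divide)
  qed
  have "(\<lambda>n. (real (k n (fst z)) + 1) / real (Suc n)) \<longlonglongrightarrow> u"
  proof (rule tendsto_sandwich)
    show "(\<lambda>_. u) \<longlonglongrightarrow> u" by simp
    show "(\<lambda>n. u + inverse (real (Suc n))) \<longlonglongrightarrow> u"
      using tendsto_add[OF tendsto_const[of u] LIMSEQ_inverse_real_of_nat] by simp
  qed (use upper lower in \<open>auto intro!: always_eventually less_imp_le\<close>)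
  then have "filterlim (\<lambda>n. (real (k n (fst z)) + 1) / real (Suc n)) (at_right u) sequentially"
    unfolding filterlim_at using upper by (auto intro!: always_eventually simp: less_imp_neq[symmetric])
  moreover have "((\<lambda>s. X s (snd z)) \<longlongrightarrow> X u (snd z)) (at_right u)"
    using right_continuous[of "snd z" u] z u
    by (auto simp: continuous_within space_pair_measure)
  ultimately have "(\<lambda>n. X ((real (k n (fst z)) + 1) / real (Suc n)) (snd z)) \<longlonglongrightarrow> X u (snd z)"
    by (rule filterlim_compose[rotated])
  then show "(\<lambda>n. f n z) \<longlonglongrightarrow> (case z of (s, \<omega>) \<Rightarrow> X (max 0 s) \<omega>)"
    by (simp add: f_def u_def case_prod_beta')
qed

lemma horizon_jointly_measurable[measurable]:
  "(\<lambda>z. X (fst z) (snd z)) \<in> borel_measurable (horizon t \<Otimes>\<^sub>M M)"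
proof -
  have "(\<lambda>z. (fst z, snd z)) \<in> horizon t \<Otimes>\<^sub>M M \<rightarrow>\<^sub>M lborel \<Otimes>\<^sub>M M"
  proof (rule measurable_Pair)
    have "(\<lambda>s. s) \<in> horizon t \<rightarrow>\<^sub>M lborel" by (rule measurable_restrict_space1) simp
    from measurable_compose[OF measurable_fst this]
    show "fst \<in> horizon t \<Otimes>\<^sub>M M \<rightarrow>\<^sub>M lborel" by simp
  qed simp
  from measurable_compose[OF this jointly_measurable]
  have "(\<lambda>z. X (max 0 (fst z)) (snd z)) \<in> borel_measurable (horizon t \<Otimes>\<^sub>M M)" by simp
  then show ?thesis
    by (rule measurable_cong[THEN iffD1, rotated]) (auto simp: space_pair_measure space_restrict_space max_def)
qed

lemma path_measurable: "\<omega> \<in> space M \<Longrightarrow> (\<lambda>s. X s \<omega>) \<in> borel_measurable (horizon t)"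
  using measurable_compose[OF measurable_Pair2'[of \<omega> M "horizon t"] horizon_jointly_measurable] by simp

lemma space_horizon: "space (horizon t) = {0..t}"
  by (simp add: space_restrict_space)

lemma finite_measure_horizon: "finite_measure (horizon t)"
  by (intro finite_measureI) (simp add: space_horizon emeasure_restrict_space emeasure_lborel_Icc_eq)

lemma emeasure_horizon: "t \<ge> 0 \<Longrightarrow> emeasure (horizon t) (space (horizon t)) = ennreal t"
  by (simp add: space_horizon emeasure_restrict_space)

lemma measure_horizon: "t \<ge> 0 \<Longrightarrow> measure (horizon t) (space (horizon t)) = t"
  using emeasure_horizon[of t] by (simp add: measure_def)

lemma nn_integral_occupation:
  assumes "\<omega> \<in> space M" "f \<in> borel_measurable borel"
  shows "(\<integral>\<^sup>+x. f x \<partial>occupation X t \<omega>) = ennreal (1 / t) * (\<integral>\<^sup>+s. f (X s \<omega>) \<partial>horizon t)"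
  unfolding occupation_def using assms path_measurable[OF assms(1)]
  by (simp add: nn_integral_scale_measure nn_integral_distr)

lemma sets_occupation[simp]: "sets (occupation X t \<omega>) = sets borel"
  by (simp add: occupation_def)

lemma emeasure_occupation:
  assumes "\<omega> \<in> space M" "A \<in> sets borel"
  shows "emeasure (occupation X t \<omega>) A = ennreal (1 / t) * (\<integral>\<^sup>+s. indicator A (X s \<omega>) \<partial>horizon t)"
  using nn_integral_occupation[OF assms(1), of "indicator A"] assms(2) by simp

text \<open>
  As a random measure, the occupation measure is a Markov kernel from the probability space, and its mean is the composition of
  the law with this kernel.
\<close>

lemma occupation_kernel:
  assumes t: "t > 0"
  shows "occupation X t \<in> M \<rightarrow>\<^sub>M prob_algebra borel"
proof (rule measurable_prob_algebraI)
  have prob: "prob_space (occupation X t \<omega>)" if "\<omega> \<in> space M" for \<omega>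
  proof (rule prob_spaceI)
    have "space (occupation X t \<omega>) = UNIV" using sets_eq_imp_space_eq[OF sets_occupation] by simp
    then have "emeasure (occupation X t \<omega>) (space (occupation X t \<omega>)) = ennreal (1 / t) * ennreal t"
      using emeasure_occupation[OF that, of UNIV t] emeasure_horizon[of t] t by simp
    then show "emeasure (occupation X t \<omega>) (space (occupation X t \<omega>)) = 1"
      using t by (simp add: ennreal_mult[symmetric])
  qed
  then show "\<omega> \<in> space M \<Longrightarrow> prob_space (occupation X t \<omega>)" for \<omega> .
  interpret L: finite_measure "horizon t" by (rule finite_measure_horizon)
  show "occupation X t \<in> M \<rightarrow>\<^sub>M subprob_algebra borel"
  proof (rule measurable_subprob_algebra)
    fix A :: "'a set" assume A[measurable]: "A \<in> sets borel"
    have "(\<lambda>z. indicator A (X (snd z) (fst z)) :: ennreal) \<in> borel_measurable (M \<Otimes>\<^sub>M horizon t)"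
      using measurable_compose[OF measurable_pair_swap'[of M "horizon t"]
          measurable_compose[OF horizon_jointly_measurable borel_measurable_indicator[OF A]]]
      by (simp add: case_prod_beta')
    then have "(\<lambda>\<omega>. \<integral>\<^sup>+s. indicator A (X s \<omega>) \<partial>horizon t) \<in> borel_measurable M"
      by (intro L.borel_measurable_nn_integral) (simp add: case_prod_beta')
    then have "(\<lambda>\<omega>. ennreal (1 / t) * (\<integral>\<^sup>+s. indicator A (X s \<omega>) \<partial>horizon t)) \<in> borel_measurable M"
      by measurable
    then show "(\<lambda>\<omega>. emeasure (occupation X t \<omega>) A) \<in> borel_measurable M"
      by (rule measurable_cong[THEN iffD1, rotated]) (simp add: emeasure_occupation[OF _ A])
  qed (use prob in \<open>auto intro: prob_space_imp_subprob_space\<close>)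
qed

lemma nn_integral_bind_occupation:
  fixes f :: "'a \<Rightarrow> ennreal"
  assumes t: "t > 0" and f[measurable]: "f \<in> borel_measurable borel"
  shows "(\<integral>\<^sup>+x. f x \<partial>(M \<bind> occupation X t)) = ennreal (1 / t) * (\<integral>\<^sup>+s. (\<integral>\<^sup>+\<omega>. f (X s \<omega>) \<partial>M) \<partial>horizon t)"
proof -
  interpret L: finite_measure "horizon t" by (rule finite_measure_horizon)
  interpret pair_sigma_finite "horizon t" M ..
  have joint: "(\<lambda>z. f (X (fst z) (snd z))) \<in> borel_measurable (horizon t \<Otimes>\<^sub>M M)"
    by (rule measurable_compose[OF horizon_jointly_measurable f])
  have "(\<integral>\<^sup>+x. f x \<partial>(M \<bind> occupation X t)) = (\<integral>\<^sup>+\<omega>. (\<integral>\<^sup>+x. f x \<partial>occupation X t \<omega>) \<partial>M)"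
    by (rule nn_integral_bind[OF f measurable_prob_algebraD[OF occupation_kernel[OF t]]])
  also have "\<dots> = (\<integral>\<^sup>+\<omega>. ennreal (1 / t) * (\<integral>\<^sup>+s. f (X s \<omega>) \<partial>horizon t) \<partial>M)"
    by (intro nn_integral_cong nn_integral_occupation f)
  also have "\<dots> = ennreal (1 / t) * (\<integral>\<^sup>+\<omega>. (\<integral>\<^sup>+s. f (X s \<omega>) \<partial>horizon t) \<partial>M)"
  proof (rule nn_integral_cmult)
    have "(\<lambda>z. f (X (snd z) (fst z))) \<in> borel_measurable (M \<Otimes>\<^sub>M horizon t)"
      using measurable_compose[OF measurable_pair_swap'[of M "horizon t"] joint] by (simp add: case_prod_beta')
    then show "(\<lambda>\<omega>. \<integral>\<^sup>+s. f (X s \<omega>) \<partial>horizon t) \<in> borel_measurable M"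
      by (intro L.borel_measurable_nn_integral) (simp add: case_prod_beta')
  qed
  also have "(\<integral>\<^sup>+\<omega>. (\<integral>\<^sup>+s. f (X s \<omega>) \<partial>horizon t) \<partial>M) = (\<integral>\<^sup>+s. (\<integral>\<^sup>+\<omega>. f (X s \<omega>) \<partial>M) \<partial>horizon t)"
    using Fubini[OF joint] by simp
  finally show ?thesis .
qed

lemma bind_occupation_space: "t > 0 \<Longrightarrow> M \<bind> occupation X t \<in> space (prob_algebra borel)"
  using measurable_prob_algebraD[OF occupation_kernel] occupation_kernel[of t]
  by (auto simp: space_prob_algebra intro!: prob_space_bind[where S = borel] AE_I2 sets_bind not_empty
      dest: measurable_space)

text \<open>
  Identifying the set function with the values of an existing measure yields its countable additivity.
\<close>

lemma mean_occupation_eq_bind: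
  assumes t: "t > 0"
  shows "mean_occupation M X t = M \<bind> occupation X t"
proof -
  have sets: "sets (M \<bind> occupation X t) = sets borel"
    using bind_occupation_space[OF t] by (simp add: space_prob_algebra)
  have "mean_occupation M X t = measure_of UNIV (sets borel) (emeasure (M \<bind> occupation X t))"
    unfolding mean_occupation_def
  proof (rule measure_of_eq)
    fix A :: "'a set" assume "A \<in> sigma_sets UNIV (sets borel)"
    then have A: "A \<in> sets borel" using sets.sigma_sets_eq[of "borel :: 'a measure"] by simp
    have "emeasure (M \<bind> occupation X t) A = (\<integral>\<^sup>+x. indicator A x \<partial>(M \<bind> occupation X t))"
      using A sets by simp
    also have "\<dots> = ennreal (1 / t) * (\<integral>\<^sup>+s. (\<integral>\<^sup>+\<omega>. indicator A (X s \<omega>) \<partial>M) \<partial>horizon t)"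
      using A by (intro nn_integral_bind_occupation t) auto
    also have "(\<integral>\<^sup>+s. (\<integral>\<^sup>+\<omega>. indicator A (X s \<omega>) \<partial>M) \<partial>horizon t)
        = (\<integral>\<^sup>+s\<in>{0..t}. (\<integral>\<^sup>+\<omega>. indicator A (X s \<omega>) \<partial>M) \<partial>lborel)"
      by (rule nn_integral_restrict_space) simp
    finally show "ennreal (1 / t) * (\<integral>\<^sup>+s\<in>{0..t}. (\<integral>\<^sup>+\<omega>. indicator A (X s \<omega>) \<partial>M) \<partial>lborel)
        = emeasure (M \<bind> occupation X t) A" by simp
  qed simp
  also have "\<dots> = M \<bind> occupation X t"
    using measure_of_of_measure[of "M \<bind> occupation X t"] sets sets_eq_imp_space_eq[OF sets] by simp
  finally show ?thesis .
qed

text \<open>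
  The square is removed in two steps, exchanging the expectation first with one time integral and then with the other; all
  integrands are bounded on a finite measure space.
\<close>

lemma second_moment_time_integral:
  fixes f :: "'a \<Rightarrow> real"
  assumes f[measurable]: "f \<in> borel_measurable borel" and f1: "\<And>x. \<bar>f x\<bar> \<le> 1" and t: "t > 0"
  defines "I \<equiv> \<lambda>\<omega>. \<integral>s. f (X s \<omega>) \<partial>horizon t"
  shows "I \<in> borel_measurable M" and "integrable M (\<lambda>\<omega>. (I \<omega>)\<^sup>2)"
    and "(\<integral>\<omega>. (I \<omega>)\<^sup>2 \<partial>M) = (\<integral>s. (\<integral>u. (\<integral>\<omega>. f (X s \<omega>) * f (X u \<omega>) \<partial>M) \<partial>horizon t) \<partial>horizon t)"
proof -
  interpret L: finite_measure "horizon t" by (rule finite_measure_horizon)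
  interpret pair_sigma_finite "horizon t" M ..
  interpret LM: finite_measure "horizon t \<Otimes>\<^sub>M M"
    by (intro finite_measure_pair_measure L.finite_measure_axioms finite_measure_axioms)
  have joint[measurable]: "(\<lambda>z. f (X (fst z) (snd z))) \<in> borel_measurable (horizon t \<Otimes>\<^sub>M M)"
    by (rule measurable_compose[OF horizon_jointly_measurable f])
  have swapped: "(\<lambda>z. f (X (snd z) (fst z))) \<in> borel_measurable (M \<Otimes>\<^sub>M horizon t)"
    using measurable_compose[OF measurable_pair_swap'[of M "horizon t"] joint] by (simp add: case_prod_beta')
  show I_m[measurable]: "I \<in> borel_measurable M"
    unfolding I_def using swapped by (intro L.borel_measurable_lebesgue_integral) (simp add: case_prod_beta')
  have fX[measurable]: "(\<lambda>\<omega>. f (X s \<omega>)) \<in> borel_measurable M" if "s \<in> {0..t}" for s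
    using that by (intro measurable_compose[OF X_measurable f]) auto
  have I_bound: "\<bar>I \<omega>\<bar> \<le> t" if "\<omega> \<in> space M" for \<omega>
  proof -
    have "integrable (horizon t) (\<lambda>s. f (X s \<omega>))"
      using measurable_compose[OF path_measurable[OF that] f] f1 by (intro L.integrable_const_bound[of _ 1]) auto
    then have "\<bar>I \<omega>\<bar> \<le> (\<integral>s. 1 \<partial>horizon t)"
      unfolding I_def using f1 by (intro integral_abs_bound[THEN order_trans] integral_mono) auto
    also have "\<dots> = t" using t measure_horizon[of t] by simp
    finally show ?thesis .
  qed
  show "integrable M (\<lambda>\<omega>. (I \<omega>)\<^sup>2)"
  proof (rule integrable_const_bound)
    show "AE \<omega> in M. norm ((I \<omega>)\<^sup>2) \<le> t\<^sup>2"
      using I_bound t by (intro AE_I2) (simp add: abs_le_square_iff[symmetric])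
  qed measurable
  have int1: "integrable (horizon t \<Otimes>\<^sub>M M) (case_prod (\<lambda>s \<omega>. f (X s \<omega>) * I \<omega>))"
  proof (rule LM.integrable_const_bound)
    show "AE z in horizon t \<Otimes>\<^sub>M M. norm (case z of (s, \<omega>) \<Rightarrow> f (X s \<omega>) * I \<omega>) \<le> 1 * t"
    proof (intro AE_I2)
      fix z assume "z \<in> space (horizon t \<Otimes>\<^sub>M M)"
      then have "snd z \<in> space M" by (auto simp: space_pair_measure)
      then have "\<bar>f (X (fst z) (snd z))\<bar> * \<bar>I (snd z)\<bar> \<le> 1 * t"
        using f1 I_bound by (intro mult_mono) auto
      then show "norm (case z of (s, \<omega>) \<Rightarrow> f (X s \<omega>) * I \<omega>) \<le> 1 * t"
        by (simp add: case_prod_beta' abs_mult)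
    qed
    have "(\<lambda>z. f (X (fst z) (snd z)) * I (snd z)) \<in> borel_measurable (horizon t \<Otimes>\<^sub>M M)" by measurable
    then show "(\<lambda>(s, \<omega>). f (X s \<omega>) * I \<omega>) \<in> borel_measurable (horizon t \<Otimes>\<^sub>M M)"
      by (simp add: case_prod_beta')
  qed
  have "(\<integral>\<omega>. (I \<omega>)\<^sup>2 \<partial>M) = (\<integral>\<omega>. (\<integral>s. f (X s \<omega>) * I \<omega> \<partial>horizon t) \<partial>M)"
    by (simp add: I_def power2_eq_square)
  also have "\<dots> = (\<integral>s. (\<integral>\<omega>. f (X s \<omega>) * I \<omega> \<partial>M) \<partial>horizon t)"
    by (rule Fubini_integral[OF int1])
  also have "\<dots> = (\<integral>s. (\<integral>u. (\<integral>\<omega>. f (X s \<omega>) * f (X u \<omega>) \<partial>M) \<partial>horizon t) \<partial>horizon t)"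
  proof (intro Bochner_Integration.integral_cong refl)
    fix s assume "s \<in> space (horizon t)"
    then have s: "s \<in> {0..t}" by (simp add: space_horizon)
    note [measurable] = fX[OF s]
    have int2: "integrable (horizon t \<Otimes>\<^sub>M M) (case_prod (\<lambda>u \<omega>. f (X s \<omega>) * f (X u \<omega>)))"
    proof (rule LM.integrable_const_bound)
      show "AE z in horizon t \<Otimes>\<^sub>M M. norm (case z of (u, \<omega>) \<Rightarrow> f (X s \<omega>) * f (X u \<omega>)) \<le> 1 * 1"
        using f1 by (intro AE_I2) (auto simp: abs_mult intro!: mult_le_one)
      have "(\<lambda>z. f (X s (snd z)) * f (X (fst z) (snd z))) \<in> borel_measurable (horizon t \<Otimes>\<^sub>M M)" by measurable
      then show "(\<lambda>(u, \<omega>). f (X s \<omega>) * f (X u \<omega>)) \<in> borel_measurable (horizon t \<Otimes>\<^sub>M M)"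
        by (simp add: case_prod_beta')
    qed
    have "(\<integral>\<omega>. f (X s \<omega>) * I \<omega> \<partial>M) = (\<integral>\<omega>. (\<integral>u. f (X s \<omega>) * f (X u \<omega>) \<partial>horizon t) \<partial>M)"
      by (simp add: I_def)
    also have "\<dots> = (\<integral>u. (\<integral>\<omega>. f (X s \<omega>) * f (X u \<omega>) \<partial>M) \<partial>horizon t)"
      by (rule Fubini_integral[OF int2])
    finally show "(\<integral>\<omega>. f (X s \<omega>) * I \<omega> \<partial>M) = (\<integral>u. (\<integral>\<omega>. f (X s \<omega>) * f (X u \<omega>) \<partial>M) \<partial>horizon t)" .
  qed
  finally show "(\<integral>\<omega>. (I \<omega>)\<^sup>2 \<partial>M) = (\<integral>s. (\<integral>u. (\<integral>\<omega>. f (X s \<omega>) * f (X u \<omega>) \<partial>M) \<partial>horizon t) \<partial>horizon t)" .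
qed

text \<open>
  By symmetry the square of the time interval consists of two triangles. On each of them the integral of \<open>E (u - s)\<close>
  over the later time is at most the integral of \<open>E\<close> over the line, uniformly in the earlier time.
\<close>

lemma second_moment_le_covariance:
  fixes f h :: "'a \<Rightarrow> real" and E :: "real \<Rightarrow> real"
  assumes f[measurable]: "f \<in> borel_measurable borel" and f1: "\<And>x. \<bar>f x\<bar> \<le> 1" and t: "t > 0"
    and h[measurable]: "h \<in> borel_measurable borel" and E[measurable]: "E \<in> borel_measurable borel"
    and cov: "\<And>s u. 0 \<le> s \<Longrightarrow> s \<le> u \<Longrightarrow>
        ennreal \<bar>\<integral>\<omega>. f (X s \<omega>) * f (X u \<omega>) \<partial>M\<bar> \<le> ennreal (E (u - s)) * (\<integral>\<^sup>+\<omega>. ennreal (h (X s \<omega>)) \<partial>M)"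
  shows "ennreal (\<integral>\<omega>. (\<integral>s. f (X s \<omega>) \<partial>horizon t)\<^sup>2 \<partial>M)
    \<le> 2 * (\<integral>\<^sup>+r. ennreal (E r) \<partial>lborel) * (\<integral>\<^sup>+s. (\<integral>\<^sup>+\<omega>. ennreal (h (X s \<omega>)) \<partial>M) \<partial>horizon t)"
proof -
  interpret L: finite_measure "horizon t" by (rule finite_measure_horizon)
  interpret LL: pair_sigma_finite "horizon t" "horizon t" ..
  define H where "H s = (\<integral>\<^sup>+\<omega>. ennreal (h (X s \<omega>)) \<partial>M)" for s
  define G where "G s u = (\<integral>\<omega>. f (X s \<omega>) * f (X u \<omega>) \<partial>M)" for s u
  define C where "C = (\<integral>\<^sup>+r. ennreal (E r) \<partial>lborel)"
  have H_m[measurable]: "H \<in> borel_measurable (horizon t)"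
  proof -
    have "(\<lambda>z. ennreal (h (X (fst z) (snd z)))) \<in> borel_measurable (horizon t \<Otimes>\<^sub>M M)" by measurable
    then show ?thesis unfolding H_def[abs_def] by (intro borel_measurable_nn_integral) (simp add: case_prod_beta')
  qed
  have id_m[measurable]: "(\<lambda>s. s) \<in> borel_measurable (horizon t)" by (rule measurable_restrict_space1) simp
  have shift: "(\<integral>\<^sup>+u. ennreal (E (u - s)) \<partial>horizon t) \<le> C" for s
  proof -
    have "(\<integral>\<^sup>+u. ennreal (E (u - s)) \<partial>horizon t) \<le> (\<integral>\<^sup>+u. ennreal (E (u - s)) \<partial>lborel)"
      by (subst nn_integral_restrict_space) (auto intro!: nn_integral_mono simp: indicator_def)
    also have "\<dots> = C"
      using nn_integral_real_affine[of "\<lambda>r. ennreal (E r)" 1 "- s"] by (simp add: C_def)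
    finally show ?thesis .
  qed
  have G_le: "ennreal \<bar>G s u\<bar> \<le> ennreal (E (u - s)) * H s + ennreal (E (s - u)) * H u"
    if "s \<in> {0..t}" "u \<in> {0..t}" for s u
  proof (cases "s \<le> u")
    case True
    then have "ennreal \<bar>G s u\<bar> \<le> ennreal (E (u - s)) * H s"
      using that cov[of s u] by (simp add: G_def H_def)
    then show ?thesis by (rule add_increasing2[rotated]) simp
  next
    case False
    then have "ennreal \<bar>G u s\<bar> \<le> ennreal (E (s - u)) * H u"
      using that cov[of u s] by (simp add: G_def H_def)
    moreover have "G s u = G u s" by (simp add: G_def mult.commute)
    ultimately show ?thesis by (simp add: add_increasing)
  qed
  have norm_int: "ennreal \<bar>\<integral>x. g x \<partial>N\<bar> \<le> (\<integral>\<^sup>+x. ennreal \<bar>g x\<bar> \<partial>N)" for g :: "real \<Rightarrow> real" and N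
    using integral_norm_bound_ennreal[of N g] by (cases "integrable N g") (auto simp: not_integrable_integral_eq)
  have "ennreal (\<integral>\<omega>. (\<integral>s. f (X s \<omega>) \<partial>horizon t)\<^sup>2 \<partial>M) = ennreal (\<integral>s. (\<integral>u. G s u \<partial>horizon t) \<partial>horizon t)"
    using second_moment_time_integral(3)[OF f f1 t] by (simp add: G_def)
  also have "\<dots> \<le> ennreal \<bar>\<integral>s. (\<integral>u. G s u \<partial>horizon t) \<partial>horizon t\<bar>" by (intro ennreal_leI) simp
  also have "\<dots> \<le> (\<integral>\<^sup>+s. ennreal \<bar>\<integral>u. G s u \<partial>horizon t\<bar> \<partial>horizon t)" by (rule norm_int)
  also have "\<dots> \<le> (\<integral>\<^sup>+s. (\<integral>\<^sup>+u. ennreal \<bar>G s u\<bar> \<partial>horizon t) \<partial>horizon t)"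
    by (intro nn_integral_mono norm_int)
  also have "\<dots> \<le> (\<integral>\<^sup>+s. (\<integral>\<^sup>+u. ennreal (E (u - s)) * H s + ennreal (E (s - u)) * H u \<partial>horizon t) \<partial>horizon t)"
    by (intro nn_integral_mono G_le) (auto simp: space_horizon)
  also have "\<dots> = (\<integral>\<^sup>+s. (\<integral>\<^sup>+u. ennreal (E (u - s)) * H s \<partial>horizon t) + (\<integral>\<^sup>+u. ennreal (E (s - u)) * H u \<partial>horizon t) \<partial>horizon t)"
    by (intro nn_integral_cong nn_integral_add) measurable
  also have "\<dots> = (\<integral>\<^sup>+s. (\<integral>\<^sup>+u. ennreal (E (u - s)) * H s \<partial>horizon t) \<partial>horizon t)
      + (\<integral>\<^sup>+s. (\<integral>\<^sup>+u. ennreal (E (s - u)) * H u \<partial>horizon t) \<partial>horizon t)"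
    by (intro nn_integral_add) measurable
  also have "(\<integral>\<^sup>+s. (\<integral>\<^sup>+u. ennreal (E (s - u)) * H u \<partial>horizon t) \<partial>horizon t)
      = (\<integral>\<^sup>+u. (\<integral>\<^sup>+s. ennreal (E (s - u)) * H u \<partial>horizon t) \<partial>horizon t)"
    by (intro LL.Fubini'[symmetric]) measurable
  also have "(\<integral>\<^sup>+s. (\<integral>\<^sup>+u. ennreal (E (u - s)) * H s \<partial>horizon t) \<partial>horizon t) +
      (\<integral>\<^sup>+s. (\<integral>\<^sup>+u. ennreal (E (u - s)) * H s \<partial>horizon t) \<partial>horizon t)
      \<le> (\<integral>\<^sup>+s. C * H s \<partial>horizon t) + (\<integral>\<^sup>+s. C * H s \<partial>horizon t)"
    by (intro add_mono nn_integral_mono) (simp_all add: nn_integral_multc mult_right_mono shift)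
  also have "\<dots> = 2 * C * (\<integral>\<^sup>+s. H s \<partial>horizon t)"
    by (simp add: nn_integral_cmult mult_2 distrib_right)
  finally show ?thesis by (simp add: C_def H_def)
qed

end

section \<open>Markov property and covariances\<close>

text \<open>
  Half the sum of two laws is the mixture obtained by tossing a fair coin. This exhibits the set function as a probability measure
  and computes its integrals.
\<close>

lemma average_measure_eq_bind:
  fixes \<mu> \<nu> :: "'a::euclidean_space measure"
  assumes "\<mu> \<in> space (prob_algebra borel)" "\<nu> \<in> space (prob_algebra borel)"
  defines "avg \<equiv> measure_pmf (bernoulli_pmf (1 / 2)) \<bind> (\<lambda>b. if b then \<mu> else \<nu>)"
  shows "average_measure \<mu> \<nu> = avg"
    and "avg \<in> space (prob_algebra borel)"
    and "f \<in> borel_measurable borel \<Longrightarrow> (\<integral>\<^sup>+x. f x \<partial>avg) = ennreal (1 / 2) * ((\<integral>\<^sup>+x. f x \<partial>\<mu>) + (\<integral>\<^sup>+x. f x \<partial>\<nu>))"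
proof -
  have K: "(\<lambda>b. if b then \<mu> else \<nu>) \<in> measure_pmf (bernoulli_pmf (1 / 2)) \<rightarrow>\<^sub>M prob_algebra borel"
    using assms(1,2) by simp
  have p: "measure_pmf (bernoulli_pmf (1 / 2)) \<in> space (prob_algebra (count_space UNIV))"
    by (simp add: space_prob_algebra measure_pmf.prob_space_axioms)
  have "(\<lambda>_. avg) \<in> borel \<rightarrow>\<^sub>M prob_algebra borel"
    unfolding avg_def using assms(1,2)
    by (intro measurable_bind_prob_space[OF measurable_const[OF p]]) simp
  from measurable_space[OF this, of "0 :: real"] show in_prob: "avg \<in> space (prob_algebra borel)" by simp
  then have sets: "sets avg = sets borel" by (simp add: space_prob_algebra)
  have int: "(\<integral>\<^sup>+x. f x \<partial>avg) = ennreal (1 / 2) * ((\<integral>\<^sup>+x. f x \<partial>\<mu>) + (\<integral>\<^sup>+x. f x \<partial>\<nu>))"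
    if "f \<in> borel_measurable borel" for f
    unfolding avg_def
    by (subst nn_integral_bind[OF that measurable_prob_algebraD[OF K]])
       (simp add: distrib_left mult.commute)
  then show "f \<in> borel_measurable borel \<Longrightarrow> (\<integral>\<^sup>+x. f x \<partial>avg) = ennreal (1 / 2) * ((\<integral>\<^sup>+x. f x \<partial>\<mu>) + (\<integral>\<^sup>+x. f x \<partial>\<nu>))" .
  have "average_measure \<mu> \<nu> = measure_of UNIV (sets borel) (emeasure avg)"
    unfolding average_measure_def
  proof (rule measure_of_eq)
    fix A :: "'a set" assume "A \<in> sigma_sets UNIV (sets borel)"
    then have A: "A \<in> sets borel" using sets.sigma_sets_eq[of "borel :: 'a measure"] by simp
    then show "ennreal (1 / 2) * (emeasure \<mu> A + emeasure \<nu> A) = emeasure avg A"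
      using int[of "indicator A"] assms(1,2) sets by (simp add: space_prob_algebra)
  qed simp
  also have "\<dots> = avg"
    using measure_of_of_measure[of avg] sets sets_eq_imp_space_eq[OF sets] by simp
  finally show "average_measure \<mu> \<nu> = avg" .
qed

lemma measure_average_measure:
  fixes \<mu> \<nu> :: "'a::euclidean_space measure"
  assumes \<mu>: "\<mu> \<in> space (prob_algebra borel)" and \<nu>: "\<nu> \<in> space (prob_algebra borel)" and A: "A \<in> sets borel"
  shows "2 * emeasure (average_measure \<mu> \<nu>) A = emeasure \<mu> A + emeasure \<nu> A"
    and "2 * measure (average_measure \<mu> \<nu>) A = measure \<mu> A + measure \<nu> A"
proof -
  have sets: "sets (average_measure \<mu> \<nu>) = sets borel" "sets \<mu> = sets borel" "sets \<nu> = sets borel"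
    and prob: "prob_space (average_measure \<mu> \<nu>)" "prob_space \<mu>" "prob_space \<nu>"
    using average_measure_eq_bind(1,2)[OF \<mu> \<nu>] \<mu> \<nu> by (auto simp: space_prob_algebra)
  have "emeasure (average_measure \<mu> \<nu>) A = ennreal (1 / 2) * (emeasure \<mu> A + emeasure \<nu> A)"
    using average_measure_eq_bind(3)[OF \<mu> \<nu>, of "indicator A"] A sets
    by (simp add: average_measure_eq_bind(1)[OF \<mu> \<nu>])
  moreover have "2 * ennreal (1 / 2) = 1"
    by (subst ennreal_numeral[symmetric], subst ennreal_mult[symmetric]) auto
  ultimately show 1: "2 * emeasure (average_measure \<mu> \<nu>) A = emeasure \<mu> A + emeasure \<nu> A"
    by (simp only: mult.assoc[symmetric] mult_1_left)
  interpret a: prob_space "average_measure \<mu> \<nu>" by fact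
  interpret m: prob_space \<mu> by fact
  interpret n: prob_space \<nu> by fact
  have "ennreal (2 * measure (average_measure \<mu> \<nu>) A) = ennreal (measure \<mu> A + measure \<nu> A)"
    using 1 by (simp add: a.emeasure_eq_measure m.emeasure_eq_measure n.emeasure_eq_measure ennreal_mult)
  then show "2 * measure (average_measure \<mu> \<nu>) A = measure \<mu> A + measure \<nu> A"
    by (subst (asm) ennreal_inj) auto
qed

lemma rc_markov_process_imp_right_continuous:
  "rc_markov_process P \<mu>\<^sub>0 M X \<Longrightarrow> right_continuous_process M X"
  unfolding rc_markov_process_def right_continuous_process_def right_continuous_process_axioms_def by auto

text \<open>
  The Markov property is given for indicators as an identity of conditional expectations; testing it against a bounded function of
  the present gives the form needed for covariances.
\<close>

lemma markov_property_integral: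
  fixes X :: "real \<Rightarrow> 'w \<Rightarrow> 'a::euclidean_space" and g :: "'a \<Rightarrow> real"
  assumes X: "rc_markov_process P \<mu>\<^sub>0 M X" and s: "s \<ge> 0" and r: "r \<ge> 0" and A: "A \<in> sets borel"
    and P: "P r \<in> borel \<rightarrow>\<^sub>M prob_algebra borel"
    and g[measurable]: "g \<in> borel_measurable borel" and g_bound: "\<And>x. \<bar>g x\<bar> \<le> B"
  shows "(\<integral>\<omega>. g (X s \<omega>) * indicator A (X (s + r) \<omega>) \<partial>M) = (\<integral>\<omega>. g (X s \<omega>) * measure (P r (X s \<omega>)) A \<partial>M)"
proof -
  have "prob_space M" and X_m: "\<And>t. t \<ge> 0 \<Longrightarrow> X t \<in> borel_measurable M"
    and markov: "AE \<omega> in M. real_cond_exp M (natural_sigma_algebra M X s) (\<lambda>\<omega>'. indicator A (X (s + r) \<omega>')) \<omega>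
          = measure (P r (X s \<omega>)) A"
    using X s r A unfolding rc_markov_process_def by auto
  interpret prob_space M by fact
  let ?F = "natural_sigma_algebra M X s"
  have gen: "{X u -` A \<inter> space M | u A. 0 \<le> u \<and> u \<le> s \<and> A \<in> sets borel} \<subseteq> sets M"
    using X_m by (auto intro: measurable_sets)
  have "subalgebra M ?F"
    unfolding subalgebra_def natural_sigma_algebra_def
    using gen sets.space_closed[of M] sets.sigma_sets_subset[OF gen]
    by (auto simp: sets_measure_of_conv)
  then interpret finite_measure_subalgebra M ?F
    by unfold_locales
  have Xs_F: "X s \<in> borel_measurable ?F"
  proof (rule measurableI)
    fix B :: "'a set" assume "B \<in> sets borel"
    then have "X s -` B \<inter> space M \<in> {X u -` A \<inter> space M | u A. 0 \<le> u \<and> u \<le> s \<and> A \<in> sets borel}"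
      using s by auto
    then show "X s -` B \<inter> space ?F \<in> sets ?F"
      unfolding natural_sigma_algebra_def using gen sets.space_closed[of M]
      by (subst sets_measure_of) (auto simp: space_measure_of_conv)
  qed simp
  have [measurable]: "X s \<in> borel_measurable M" "X (s + r) \<in> borel_measurable M" using X_m s r by auto
  note [measurable] = A
  have gX: "(\<lambda>\<omega>. g (X s \<omega>)) \<in> borel_measurable ?F" by (rule measurable_compose[OF Xs_F g])
  have int: "integrable M (\<lambda>\<omega>. g (X s \<omega>) * indicator A (X (s + r) \<omega>))"
  proof (rule integrable_const_bound)
    show "AE \<omega> in M. norm (g (X s \<omega>) * indicator A (X (s + r) \<omega>)) \<le> B"
      using g_bound order_trans[OF abs_ge_zero g_bound] by (intro AE_I2) (auto simp: indicator_def)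
  qed measurable
  have Pm: "(\<lambda>\<omega>. measure (P r (X s \<omega>)) A) \<in> borel_measurable M"
    by (rule measurable_compose[OF _ measurable_compose[OF P measurable_measure_prob_algebra[OF A]]]) measurable
  have "(\<integral>\<omega>. g (X s \<omega>) * indicator A (X (s + r) \<omega>) \<partial>M)
      = (\<integral>\<omega>. g (X s \<omega>) * real_cond_exp M ?F (\<lambda>\<omega>'. indicator A (X (s + r) \<omega>')) \<omega> \<partial>M)"
    by (rule real_cond_exp_intg(2)[OF int gX, symmetric]) measurable
  also have "\<dots> = (\<integral>\<omega>. g (X s \<omega>) * measure (P r (X s \<omega>)) A \<partial>M)"
    using markov Pm by (intro integral_cong_AE) auto
  finally show ?thesis .
qed

lemma markov_law:
  fixes X :: "real \<Rightarrow> 'w \<Rightarrow> 'a::euclidean_space"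
  assumes X: "rc_markov_process P \<mu>\<^sub>0 M X" and t: "t \<ge> 0" and P: "P t \<in> borel \<rightarrow>\<^sub>M prob_algebra borel"
  shows "distr M borel (X t) = \<mu>\<^sub>0 \<bind> P t"
proof (rule measure_eqI)
  have "prob_space M" and X_m: "\<And>t. t \<ge> 0 \<Longrightarrow> X t \<in> borel_measurable M" and \<mu>\<^sub>0: "distr M borel (X 0) = \<mu>\<^sub>0"
    using X unfolding rc_markov_process_def by auto
  interpret prob_space M by fact
  have Xt[measurable]: "X t \<in> borel_measurable M" and X0[measurable]: "X 0 \<in> borel_measurable M" using X_m t by auto
  interpret m0: prob_space \<mu>\<^sub>0 unfolding \<mu>\<^sub>0[symmetric] by (rule prob_space_distr) fact
  have sets_\<mu>\<^sub>0: "sets \<mu>\<^sub>0 = sets borel" unfolding \<mu>\<^sub>0[symmetric] by simp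
  have K: "P t \<in> \<mu>\<^sub>0 \<rightarrow>\<^sub>M subprob_algebra borel"
    using measurable_prob_algebraD[OF P] sets_\<mu>\<^sub>0 by (simp cong: measurable_cong_sets)
  have sets_bind: "sets (\<mu>\<^sub>0 \<bind> P t) = sets borel"
    using subprob_measurableD(2)[OF K] m0.not_empty by (intro sets_bind) auto
  show "sets (distr M borel (X t)) = sets (\<mu>\<^sub>0 \<bind> P t)" using sets_bind by simp
  fix A assume "A \<in> sets (distr M borel (X t))"
  then have A[measurable]: "A \<in> sets borel" by simp
  have Pm: "(\<lambda>x. measure (P t x) A) \<in> borel_measurable borel"
    by (rule measurable_compose[OF P measurable_measure_prob_algebra[OF A]])
  have "measure (distr M borel (X t)) A = (\<integral>\<omega>. 1 * indicator A (X (0 + t) \<omega>) \<partial>M)"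
    by (simp add: measure_distr indicator_vimage[symmetric] vimage_def)
  also have "\<dots> = (\<integral>\<omega>. 1 * measure (P t (X 0 \<omega>)) A \<partial>M)"
    by (rule markov_property_integral[OF X _ t A P, where B = 1]) auto
  also have "\<dots> = (\<integral>x. measure (P t x) A \<partial>\<mu>\<^sub>0)"
    unfolding \<mu>\<^sub>0[symmetric] using Pm by (simp add: integral_distr)
  also have "\<dots> = measure (\<mu>\<^sub>0 \<bind> P t) A" by (rule m0.measure_bind[OF K A, symmetric])
  finally have "measure (distr M borel (X t)) A = measure (\<mu>\<^sub>0 \<bind> P t) A" .
  moreover have "finite_measure (distr M borel (X t))"
    using prob_space_distr[OF Xt] by (simp add: prob_space_def)
  moreover have "finite_measure (\<mu>\<^sub>0 \<bind> P t)"
    by (rule subprob_space.axioms(1)[OF subprob_space_bind[OF _ K]])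
       (simp add: prob_space_imp_subprob_space m0.prob_space_axioms)
  ultimately show "emeasure (distr M borel (X t)) A = emeasure (\<mu>\<^sub>0 \<bind> P t) A"
    by (simp add: finite_measure.emeasure_eq_measure)
qed

text \<open>
  Conditioning on the past of \<open>s\<close> replaces \<open>f (X u)\<close> by \<open>P\<^sub>u\<^sub>-\<^sub>s(X\<^sub>s, A) -
  \<nu>(A)\<close>, which is at most \<open>\<psi>(X\<^sub>s) e(u - s)\<close>.
\<close>

lemma indicator_covariance_le:
  fixes X :: "real \<Rightarrow> 'w \<Rightarrow> 'a::euclidean_space" and P :: "real \<Rightarrow> 'a \<Rightarrow> 'a measure"
  assumes P: "markov_semigroup P" and \<nu>: "\<nu> \<in> space (prob_algebra borel)"
    and \<psi>[measurable]: "\<psi> \<in> borel_measurable borel" and \<psi>0: "\<And>x. \<psi> x \<ge> 0"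
    and e0: "\<And>t. t \<ge> 0 \<Longrightarrow> e t \<ge> 0" and tv: "\<And>t x. t \<ge> 0 \<Longrightarrow> tv_norm (P t x) \<nu> \<le> \<psi> x * e t"
    and X: "rc_markov_process P \<mu>\<^sub>0 M X" and s: "0 \<le> s" and su: "s \<le> u" and A[measurable]: "A \<in> sets borel"
  defines "f \<equiv> \<lambda>x. indicator A x - measure \<nu> A"
  shows "ennreal \<bar>\<integral>\<omega>. f (X s \<omega>) * f (X u \<omega>) \<partial>M\<bar> \<le> ennreal (e (u - s)) * (\<integral>\<^sup>+\<omega>. ennreal (\<bar>f (X s \<omega>)\<bar> * \<psi> (X s \<omega>)) \<partial>M)"
proof -
  have "prob_space M" and X_m: "\<And>t. t \<ge> 0 \<Longrightarrow> X t \<in> borel_measurable M"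
    using X unfolding rc_markov_process_def by auto
  interpret prob_space M by fact
  have \<nu>1: "0 \<le> measure \<nu> A" "measure \<nu> A \<le> 1"
    using \<nu> prob_space.prob_le_1[of \<nu> A] by (auto simp: space_prob_algebra)
  have f1: "\<bar>f x\<bar> \<le> 1" for x using \<nu>1 by (auto simp: f_def indicator_def)
  have f[measurable]: "f \<in> borel_measurable borel" unfolding f_def by measurable
  have [measurable]: "X s \<in> borel_measurable M" "X u \<in> borel_measurable M" using X_m s su by auto
  have r: "u - s \<ge> 0" using su by simp
  have K: "P (u - s) \<in> borel \<rightarrow>\<^sub>M prob_algebra borel" using P r by (simp add: markov_semigroup_def)
  have K_in: "P (u - s) x \<in> space (prob_algebra borel)" for x using measurable_space[OF K, of x] by simp
  have Pm: "(\<lambda>\<omega>. measure (P (u - s) (X s \<omega>)) A) \<in> borel_measurable M"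
    by (rule measurable_compose[OF _ measurable_compose[OF K measurable_measure_prob_algebra[OF A]]]) measurable
  have P1: "measure (P (u - s) x) A \<le> 1" for x
    using K_in[of x] prob_space.prob_le_1 by (auto simp: space_prob_algebra)
  have int_f: "integrable M (\<lambda>\<omega>. f (X s \<omega>))"
    using f1 by (intro integrable_const_bound[of _ 1]) auto
  have int_fA: "integrable M (\<lambda>\<omega>. f (X s \<omega>) * indicator A (X u \<omega>))"
    using f1 by (intro integrable_const_bound[of _ 1]) (auto simp: indicator_def)
  have int_fP: "integrable M (\<lambda>\<omega>. f (X s \<omega>) * measure (P (u - s) (X s \<omega>)) A)"
    using f1 P1 Pm by (intro integrable_const_bound[of _ 1]) (auto simp: abs_mult intro!: mult_le_one)
  have "(\<integral>\<omega>. f (X s \<omega>) * f (X u \<omega>) \<partial>M)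
      = (\<integral>\<omega>. f (X s \<omega>) * indicator A (X u \<omega>) - f (X s \<omega>) * measure \<nu> A \<partial>M)"
    by (intro Bochner_Integration.integral_cong refl) (simp add: f_def algebra_simps)
  also have "\<dots> = (\<integral>\<omega>. f (X s \<omega>) * indicator A (X u \<omega>) \<partial>M) - (\<integral>\<omega>. f (X s \<omega>) * measure \<nu> A \<partial>M)"
    using int_f int_fA by (intro Bochner_Integration.integral_diff) auto
  also have "(\<integral>\<omega>. f (X s \<omega>) * indicator A (X u \<omega>) \<partial>M) = (\<integral>\<omega>. f (X s \<omega>) * measure (P (u - s) (X s \<omega>)) A \<partial>M)"
    using markov_property_integral[OF X s r A K f f1] by simp
  also have "\<dots> - (\<integral>\<omega>. f (X s \<omega>) * measure \<nu> A \<partial>M)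
      = (\<integral>\<omega>. f (X s \<omega>) * measure (P (u - s) (X s \<omega>)) A - f (X s \<omega>) * measure \<nu> A \<partial>M)"
    using int_f int_fP by (intro Bochner_Integration.integral_diff[symmetric]) auto
  also have "\<dots> = (\<integral>\<omega>. f (X s \<omega>) * (measure (P (u - s) (X s \<omega>)) A - measure \<nu> A) \<partial>M)"
    by (simp add: right_diff_distrib)
  finally have eq: "(\<integral>\<omega>. f (X s \<omega>) * f (X u \<omega>) \<partial>M)
      = (\<integral>\<omega>. f (X s \<omega>) * (measure (P (u - s) (X s \<omega>)) A - measure \<nu> A) \<partial>M)" .
  have "integrable M (\<lambda>\<omega>. f (X s \<omega>) * (measure (P (u - s) (X s \<omega>)) A - measure \<nu> A))"
    using int_f int_fP by (simp add: right_diff_distrib)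
  from integral_norm_bound_ennreal[OF this]
  have "ennreal \<bar>\<integral>\<omega>. f (X s \<omega>) * f (X u \<omega>) \<partial>M\<bar>
      \<le> (\<integral>\<^sup>+\<omega>. ennreal \<bar>f (X s \<omega>) * (measure (P (u - s) (X s \<omega>)) A - measure \<nu> A)\<bar> \<partial>M)"
    unfolding eq by simp
  also have "\<dots> \<le> (\<integral>\<^sup>+\<omega>. ennreal (e (u - s)) * ennreal (\<bar>f (X s \<omega>)\<bar> * \<psi> (X s \<omega>)) \<partial>M)"
  proof (intro nn_integral_mono)
    fix \<omega>
    have "\<bar>measure (P (u - s) (X s \<omega>)) A - measure \<nu> A\<bar> \<le> \<psi> (X s \<omega>) * e (u - s)"
      using tv_norm_measure_bound[OF K_in \<nu> A, of "X s \<omega>"] tv[OF r, of "X s \<omega>"] by linarith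
    then have "\<bar>f (X s \<omega>)\<bar> * \<bar>measure (P (u - s) (X s \<omega>)) A - measure \<nu> A\<bar> \<le> \<bar>f (X s \<omega>)\<bar> * (\<psi> (X s \<omega>) * e (u - s))"
      by (intro mult_left_mono) auto
    then show "ennreal \<bar>f (X s \<omega>) * (measure (P (u - s) (X s \<omega>)) A - measure \<nu> A)\<bar>
        \<le> ennreal (e (u - s)) * ennreal (\<bar>f (X s \<omega>)\<bar> * \<psi> (X s \<omega>))"
      using e0[OF r] \<psi>0 by (simp add: ennreal_mult[symmetric] abs_mult mult_ac ennreal_leI)
  qed
  also have "\<dots> = ennreal (e (u - s)) * (\<integral>\<^sup>+\<omega>. ennreal (\<bar>f (X s \<omega>)\<bar> * \<psi> (X s \<omega>)) \<partial>M)"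
    by (rule nn_integral_cmult) measurable
  finally show ?thesis .
qed

section \<open>Deviations of occupation measures\<close>

lemma nn_integral_mean_occupation_le:
  fixes X :: "real \<Rightarrow> 'w \<Rightarrow> 'a::euclidean_space" and f :: "'a \<Rightarrow> ennreal"
  assumes P: "markov_semigroup P" and X: "rc_markov_process P \<mu>\<^sub>0 M X" and t: "t > 0"
    and f[measurable]: "f \<in> borel_measurable borel"
    and S: "\<And>s. s \<ge> 0 \<Longrightarrow> (\<integral>\<^sup>+x. f x \<partial>(\<mu>\<^sub>0 \<bind> P s)) \<le> S"
  shows "(\<integral>\<^sup>+x. f x \<partial>mean_occupation M X t) \<le> S"
proof -
  interpret right_continuous_process M X by (rule rc_markov_process_imp_right_continuous[OF X])
  have marginal: "(\<integral>\<^sup>+\<omega>. f (X s \<omega>) \<partial>M) \<le> S" if "s \<ge> 0" for s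
  proof -
    have "P s \<in> borel \<rightarrow>\<^sub>M prob_algebra borel" using P that by (simp add: markov_semigroup_def)
    from markov_law[OF X that this] have "(\<integral>\<^sup>+x. f x \<partial>(\<mu>\<^sub>0 \<bind> P s)) = (\<integral>\<^sup>+x. f x \<partial>distr M borel (X s))" by simp
    also have "\<dots> = (\<integral>\<^sup>+\<omega>. f (X s \<omega>) \<partial>M)"
      using X_measurable[OF that] by (intro nn_integral_distr) auto
    finally show ?thesis using S[OF that] by simp
  qed
  have "(\<integral>\<^sup>+x. f x \<partial>mean_occupation M X t) = ennreal (1 / t) * (\<integral>\<^sup>+s. (\<integral>\<^sup>+\<omega>. f (X s \<omega>) \<partial>M) \<partial>horizon t)"
    using mean_occupation_eq_bind[OF t] nn_integral_bind_occupation[OF t f] by simp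
  also have "\<dots> \<le> ennreal (1 / t) * (\<integral>\<^sup>+s. S \<partial>horizon t)"
    by (intro mult_left_mono nn_integral_mono marginal) (auto simp: space_horizon)
  also have "\<dots> = ennreal (1 / t) * ennreal t * S"
    using emeasure_horizon[of t] t by (simp add: mult_ac)
  also have "\<dots> = S" using t by (simp add: ennreal_mult[symmetric])
  finally show ?thesis .
qed

text \<open>
  Above the level \<open>\<theta>\<close>, \<open>y = y powr (1 - q) * y powr q\<close> and \<open>1 - q\<close> is negative. This
  inequality replaces the Hoelder inequality below, once \<open>\<theta>\<close> is optimized.
\<close>

lemma le_truncation:
  fixes y \<theta> q :: real
  assumes "0 \<le> y" "0 < \<theta>" "q > 1"
  shows "y \<le> \<theta> + \<theta> powr (1 - q) * y powr q"
proof (cases "y \<le> \<theta>")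
  case False
  then have y: "y > \<theta>" "y > 0" using assms by auto
  have "y = y powr (1 - q) * y powr q" using y by (simp add: powr_add[symmetric])
  also have "\<dots> \<le> \<theta> powr (1 - q) * y powr q"
    using assms y by (intro mult_right_mono powr_mono2') auto
  finally show ?thesis using assms by linarith
qed (use assms in \<open>simp add: add_increasing2\<close>)

text \<open>
  The first entry of the minimum is the triangle inequality: \<open>\<nu>\<^sub>t(A)\<close> and \<open>\<nu>(A)\<close> have
  means adding up to \<open>2 \<pi>\<^sub>t(A)\<close>. The second one is the square root of the variance bound obtained from the
  covariances.
\<close>

lemma occupation_deviation:
  fixes X :: "real \<Rightarrow> 'w \<Rightarrow> 'a::euclidean_space" and P :: "real \<Rightarrow> 'a \<Rightarrow> 'a measure"
  assumes P: "markov_semigroup P" and \<nu>: "\<nu> \<in> space (prob_algebra borel)"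
    and \<psi>[measurable]: "\<psi> \<in> borel_measurable borel" and \<psi>0: "\<And>x. \<psi> x \<ge> 0"
    and e: "set_integrable lborel {0..} e" and e0: "\<And>t. t \<ge> 0 \<Longrightarrow> e t \<ge> 0"
    and tv: "\<And>t x. t \<ge> 0 \<Longrightarrow> tv_norm (P t x) \<nu> \<le> \<psi> x * e t"
    and X: "rc_markov_process P \<mu>\<^sub>0 M X" and t: "t > 0" and q: "q > 1" and A[measurable]: "A \<in> sets borel"
    and S: "S \<ge> 0" "\<And>s. s \<ge> 0 \<Longrightarrow> (\<integral>\<^sup>+x. ennreal (\<psi> x powr q) \<partial>(\<mu>\<^sub>0 \<bind> P s)) \<le> ennreal S"
  defines "\<pi> \<equiv> average_measure (mean_occupation M X t) \<nu>"
    and "E \<equiv> \<integral>r. indicator {0..} r * e r \<partial>lborel"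
  shows "(\<integral>\<^sup>+\<omega>. ennreal \<bar>measure (occupation X t \<omega>) A - measure \<nu> A\<bar> \<partial>M)
    \<le> ennreal ((2 + 4 * E * (1 + S)) *
        min (measure \<pi> A) (measure \<pi> A powr (1 / 2 * (1 - 1 / q)) * t powr (- (1 / 2))))"
proof -
  interpret right_continuous_process M X by (rule rc_markov_process_imp_right_continuous[OF X])
  interpret L: finite_measure "horizon t" by (rule finite_measure_horizon)
  define m where "m = mean_occupation M X t"
  have m_bind: "m = M \<bind> occupation X t" unfolding m_def by (rule mean_occupation_eq_bind[OF t])
  have m_in: "m \<in> space (prob_algebra borel)" unfolding m_bind by (rule bind_occupation_space[OF t])
  then have sets_m[measurable_cong]: "sets m = sets borel" and "prob_space m" by (auto simp: space_prob_algebra)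
  then interpret m: prob_space m by simp
  have sets_\<nu>: "sets \<nu> = sets borel" and "prob_space \<nu>" using \<nu> by (auto simp: space_prob_algebra)
  then interpret n: prob_space \<nu> by simp
  define x where "x = measure \<pi> A"
  define a where "a = measure \<nu> A"
  have x: "2 * x = measure m A + a"
    unfolding x_def a_def \<pi>_def m_def[symmetric] by (rule measure_average_measure(2)[OF m_in \<nu> A])
  have a: "0 \<le> a" "a \<le> 1" by (auto simp: a_def)
  have x0: "0 \<le> x" by (simp add: x_def)
  define w where "w = x powr (1 - 1 / q)"
  define f where "f y = indicator A y - a" for y
  have f1: "\<bar>f y\<bar> \<le> 1" for y using a by (auto simp: f_def indicator_def)
  have f[measurable]: "f \<in> borel_measurable borel" unfolding f_def by measurable
  have E0: "0 \<le> E" unfolding E_def by (intro Bochner_Integration.integral_nonneg) (auto simp: e0 indicator_def)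
  have K[measurable]: "occupation X t \<in> M \<rightarrow>\<^sub>M subprob_algebra borel"
    by (rule measurable_prob_algebraD[OF occupation_kernel[OF t]])
  have occ_m[measurable]: "(\<lambda>\<omega>. measure (occupation X t \<omega>) A) \<in> borel_measurable M"
    by (rule measurable_compose[OF K measurable_measure_subprob_algebra[OF A]])
  have occ_prob: "prob_space (occupation X t \<omega>)" if "\<omega> \<in> space M" for \<omega>
    using measurable_space[OF occupation_kernel[OF t] that] by (simp add: space_prob_algebra)
  have crude: "(\<integral>\<^sup>+\<omega>. ennreal \<bar>measure (occupation X t \<omega>) A - a\<bar> \<partial>M) \<le> ennreal (2 * x)"
  proof -
    have "(\<integral>\<^sup>+\<omega>. ennreal \<bar>measure (occupation X t \<omega>) A - a\<bar> \<partial>M) \<le> (\<integral>\<^sup>+\<omega>. emeasure (occupation X t \<omega>) A + ennreal a \<partial>M)"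
    proof (intro nn_integral_mono)
      fix \<omega> assume "\<omega> \<in> space M"
      then interpret o: prob_space "occupation X t \<omega>" by (rule occ_prob)
      have "\<bar>measure (occupation X t \<omega>) A - a\<bar> \<le> measure (occupation X t \<omega>) A + a"
        using a measure_nonneg[of "occupation X t \<omega>" A] by linarith
      then show "ennreal \<bar>measure (occupation X t \<omega>) A - a\<bar> \<le> emeasure (occupation X t \<omega>) A + ennreal a"
        using a by (simp add: o.emeasure_eq_measure ennreal_plus[symmetric] ennreal_leI del: ennreal_plus)
    qed
    also have "\<dots> = (\<integral>\<^sup>+\<omega>. emeasure (occupation X t \<omega>) A \<partial>M) + ennreal a"
      using measurable_compose[OF K measurable_emeasure_subprob_algebra[OF A]]
      by (subst nn_integral_add) (auto simp: emeasure_space_1)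
    also have "(\<integral>\<^sup>+\<omega>. emeasure (occupation X t \<omega>) A \<partial>M) = ennreal (measure m A)"
      using emeasure_bind[OF not_empty K A] by (simp add: m_bind[symmetric] m.emeasure_eq_measure)
    also have "ennreal (measure m A) + ennreal a = ennreal (2 * x)"
      unfolding x using a by simp
    finally show ?thesis .
  qed
  have fine: "(\<integral>\<^sup>+\<omega>. ennreal \<bar>measure (occupation X t \<omega>) A - a\<bar> \<partial>M)
      \<le> ennreal ((1 + 4 * E * (1 + S)) * (x powr (1 / 2 * (1 - 1 / q)) * t powr (- (1 / 2))))" if x_pos: "x > 0"
  proof -
    define I where "I \<omega> = (\<integral>s. f (X s \<omega>) \<partial>horizon t)" for \<omega>
    note I = second_moment_time_integral(1,2)[OF f f1 t, folded I_def[abs_def]]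
    have I_m[measurable]: "I \<in> borel_measurable M" using I(1) by (simp add: I_def[abs_def])
    have I_sq: "integrable M (\<lambda>\<omega>. (I \<omega>)\<^sup>2)" using second_moment_time_integral(2)[OF f f1 t] by (simp add: I_def)
    have Z: "measure (occupation X t \<omega>) A - a = I \<omega> / t" if "\<omega> \<in> space M" for \<omega>
    proof -
      interpret o: prob_space "occupation X t \<omega>" by (rule occ_prob[OF that])
      note [measurable] = path_measurable[OF that, of t]
      have int: "integrable (horizon t) (\<lambda>s. indicator A (X s \<omega>) :: real)"
        by (intro L.integrable_const_bound[of _ 1]) (auto simp: indicator_def)
      have "ennreal (measure (occupation X t \<omega>) A) = ennreal (1 / t) * (\<integral>\<^sup>+s. ennreal (indicator A (X s \<omega>)) \<partial>horizon t)"
        using emeasure_occupation[OF that A, of t] unfolding o.emeasure_eq_measure by (simp add: ennreal_indicator)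
      also have "\<dots> = ennreal (1 / t * (\<integral>s. indicator A (X s \<omega>) \<partial>horizon t))"
        using t by (subst nn_integral_eq_integral[OF int]) (auto simp: ennreal_mult[symmetric])
      finally have "measure (occupation X t \<omega>) A = 1 / t * (\<integral>s. indicator A (X s \<omega>) \<partial>horizon t)"
        using t by (subst (asm) ennreal_inj) (auto intro!: Bochner_Integration.integral_nonneg mult_nonneg_nonneg)
      moreover have "I \<omega> = (\<integral>s. indicator A (X s \<omega>) \<partial>horizon t) - a * t"
        unfolding I_def f_def using int measure_horizon[of t] t
        by (subst Bochner_Integration.integral_diff) (auto simp: mult.commute)
      ultimately show ?thesis using t by (simp add: field_simps)
    qed
    define h where "h y = \<bar>f y\<bar> * \<psi> y" for y
    have h_m[measurable]: "h \<in> borel_measurable borel" unfolding h_def by measurable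
    have h_int: "(\<integral>\<^sup>+y. ennreal (h y) \<partial>m) \<le> ennreal (2 * (1 + S) * w)"
    proof -
      \<comment> \<open>With this level the two terms of the truncation contribute the same power of \<open>x\<close>.\<close>
      define \<theta> where "\<theta> = x powr (- (1 / q))"
      have \<theta>: "\<theta> > 0" using x_pos by (simp add: \<theta>_def)
      have h_le: "h y \<le> \<theta> * (indicator A y + a) + 2 * \<theta> powr (1 - q) * \<psi> y powr q" for y
      proof -
        have "h y \<le> (indicator A y + a) * \<psi> y"
          unfolding h_def f_def using a \<psi>0 by (intro mult_right_mono) (auto simp: indicator_def)
        also have "\<dots> \<le> (indicator A y + a) * (\<theta> + \<theta> powr (1 - q) * \<psi> y powr q)"
          using a \<psi>0 q \<theta> by (intro mult_left_mono le_truncation) auto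
        also have "\<dots> \<le> \<theta> * (indicator A y + a) + 2 * (\<theta> powr (1 - q) * \<psi> y powr q)"
        proof -
          have "(indicator A y + a) * (\<theta> powr (1 - q) * \<psi> y powr q) \<le> 2 * (\<theta> powr (1 - q) * \<psi> y powr q)"
            using a by (intro mult_right_mono) (auto simp: indicator_def)
          then show ?thesis by (simp add: algebra_simps)
        qed
        finally show ?thesis by simp
      qed
      have "(\<integral>\<^sup>+y. ennreal (h y) \<partial>m)
          \<le> (\<integral>\<^sup>+y. ennreal \<theta> * (indicator A y + ennreal a) + ennreal (2 * \<theta> powr (1 - q)) * ennreal (\<psi> y powr q) \<partial>m)"
      proof (intro nn_integral_mono)
        fix y
        have "ennreal (h y) \<le> ennreal (\<theta> * (indicator A y + a) + 2 * \<theta> powr (1 - q) * \<psi> y powr q)"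
          by (intro ennreal_leI h_le)
        also have "\<dots> = ennreal \<theta> * (indicator A y + ennreal a) + ennreal (2 * \<theta> powr (1 - q)) * ennreal (\<psi> y powr q)"
          using a \<theta> by (simp add: ennreal_mult ennreal_indicator)
        finally show "ennreal (h y) \<le> ennreal \<theta> * (indicator A y + ennreal a) + ennreal (2 * \<theta> powr (1 - q)) * ennreal (\<psi> y powr q)" .
      qed
      also have "\<dots> = ennreal \<theta> * (emeasure m A + ennreal a) + ennreal (2 * \<theta> powr (1 - q)) * (\<integral>\<^sup>+y. ennreal (\<psi> y powr q) \<partial>m)"
        using sets_m by (simp add: nn_integral_add nn_integral_cmult m.emeasure_space_1)
      also have "\<dots> \<le> ennreal \<theta> * (emeasure m A + ennreal a) + ennreal (2 * \<theta> powr (1 - q)) * ennreal S"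
        unfolding m_def using S by (intro add_left_mono mult_left_mono nn_integral_mean_occupation_le[OF P X t]) auto
      also have "emeasure m A + ennreal a = ennreal (2 * x)"
        unfolding x using a by (simp add: m.emeasure_eq_measure)
      also have "ennreal \<theta> * ennreal (2 * x) + ennreal (2 * \<theta> powr (1 - q)) * ennreal S
          = ennreal (\<theta> * (2 * x) + 2 * \<theta> powr (1 - q) * S)"
        using \<theta> x0 S by (simp add: ennreal_mult[symmetric] ennreal_plus[symmetric] del: ennreal_plus)
      also have "\<theta> * (2 * x) + 2 * \<theta> powr (1 - q) * S = 2 * (1 + S) * w"
      proof -
        have "\<theta> * x = w" using x_pos powr_mult_base[of x "- (1 / q)"] by (simp add: \<theta>_def w_def mult.commute)
        moreover have "\<theta> powr (1 - q) = w"
        proof -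
          have "- (1 / q) * (1 - q) = 1 - 1 / q" using q by (simp add: field_simps)
          then show ?thesis unfolding \<theta>_def w_def powr_powr by simp
        qed
        ultimately show ?thesis by (simp add: algebra_simps)
      qed
      finally show ?thesis .
    qed
    have I2: "ennreal (\<integral>\<omega>. (I \<omega>)\<^sup>2 \<partial>M) \<le> ennreal (2 * E * (t * (2 * (1 + S) * w)))"
    proof -
      have e_int: "integrable lborel (\<lambda>r. indicator {0..} r * e r)"
        using e by (simp add: set_integrable_def)
      then have e_m: "(\<lambda>r. indicator {0..} r * e r) \<in> borel_measurable borel"
        using borel_measurable_integrable by fastforce
      have e_eq: "(\<integral>\<^sup>+r. ennreal (indicator {0..} r * e r) \<partial>lborel) = ennreal E"
        unfolding E_def using e0 by (intro nn_integral_eq_integral[OF e_int]) (auto simp: indicator_def)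
      \<comment> \<open>The rate is extended by zero to negative times, where it carries no information.\<close>
      have cov: "ennreal \<bar>\<integral>\<omega>. f (X s \<omega>) * f (X u \<omega>) \<partial>M\<bar>
          \<le> ennreal (indicator {0..} (u - s) * e (u - s)) * (\<integral>\<^sup>+\<omega>. ennreal (h (X s \<omega>)) \<partial>M)"
        if "0 \<le> s" "s \<le> u" for s u
        using indicator_covariance_le[OF P \<nu> \<psi> \<psi>0 e0 tv X that A] that unfolding f_def h_def a_def by simp
      have "ennreal (\<integral>\<omega>. (I \<omega>)\<^sup>2 \<partial>M) \<le> 2 * ennreal E * (\<integral>\<^sup>+s. (\<integral>\<^sup>+\<omega>. ennreal (h (X s \<omega>)) \<partial>M) \<partial>horizon t)"
        using second_moment_le_covariance[OF f f1 t h_m e_m cov] unfolding I_def e_eq .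
      also have "(\<integral>\<^sup>+s. (\<integral>\<^sup>+\<omega>. ennreal (h (X s \<omega>)) \<partial>M) \<partial>horizon t) = ennreal t * (\<integral>\<^sup>+y. ennreal (h y) \<partial>m)"
      proof -
        have "(\<integral>\<^sup>+y. ennreal (h y) \<partial>m) = ennreal (1 / t) * (\<integral>\<^sup>+s. (\<integral>\<^sup>+\<omega>. ennreal (h (X s \<omega>)) \<partial>M) \<partial>horizon t)"
          unfolding m_bind by (rule nn_integral_bind_occupation[OF t]) measurable
        moreover have "ennreal t * ennreal (1 / t) = 1" using t by (simp add: ennreal_mult[symmetric])
        ultimately show ?thesis by (simp add: mult.assoc[symmetric])
      qed
      also have "2 * ennreal E * (ennreal t * (\<integral>\<^sup>+y. ennreal (h y) \<partial>m)) \<le> 2 * ennreal E * (ennreal t * ennreal (2 * (1 + S) * w))"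
        by (intro mult_left_mono h_int) auto
      also have "\<dots> = ennreal (2 * E * (t * (2 * (1 + S) * w)))"
        using E0 t S by (simp add: ennreal_mult w_def)
      finally show ?thesis .
    qed
    then have I2': "(\<integral>\<omega>. (I \<omega>)\<^sup>2 \<partial>M) \<le> 2 * E * (t * (2 * (1 + S) * w))"
      using E0 t S by (subst (asm) ennreal_le_iff) (auto simp: w_def)
    define v where "v = x powr (1 / 2 * (1 - 1 / q)) * t powr (- (1 / 2))"
    have v: "v > 0" using x_pos t by (simp add: v_def)
    have v2: "v * v = w / t"
    proof -
      have "v * v = (x powr (1 / 2 * (1 - 1 / q)) * x powr (1 / 2 * (1 - 1 / q))) * (t powr (- (1 / 2)) * t powr (- (1 / 2)))"
        by (simp add: v_def mult_ac)
      also have "\<dots> = x powr (1 - 1 / q) * t powr (- 1)"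
      proof -
        have "1 / 2 * c + 1 / 2 * c = c" for c :: real by simp
        then show ?thesis unfolding powr_add[symmetric] by simp
      qed
      finally show ?thesis using t by (simp add: w_def powr_minus_divide)
    qed
    have "(\<integral>\<^sup>+\<omega>. ennreal \<bar>measure (occupation X t \<omega>) A - a\<bar> \<partial>M) \<le> (\<integral>\<^sup>+\<omega>. ennreal (v + (I \<omega>)\<^sup>2 / (t\<^sup>2 * v)) \<partial>M)"
    proof (intro nn_integral_mono ennreal_leI)
      fix \<omega> assume "\<omega> \<in> space M"
      define z where "z = \<bar>I \<omega> / t\<bar>"
      \<comment> \<open>Instead of the Cauchy--Schwarz inequality: \<open>v\<close> is the expected order of magnitude of \<open>z\<close>.\<close>
      have "z \<le> v + z * z / v"
      proof (cases "z \<le> v")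
        case True
        then show ?thesis using v by (simp add: add_increasing2)
      next
        case False
        then have "z * v \<le> z * z" using v by (intro mult_left_mono) auto
        then have "z \<le> z * z / v" using v by (simp add: field_simps)
        then show ?thesis using v by linarith
      qed
      also have "z * z = (I \<omega>)\<^sup>2 / t\<^sup>2" by (simp add: z_def power2_eq_square abs_mult[symmetric])
      finally show "\<bar>measure (occupation X t \<omega>) A - a\<bar> \<le> v + (I \<omega>)\<^sup>2 / (t\<^sup>2 * v)"
        using Z[OF \<open>\<omega> \<in> space M\<close>] by (simp add: z_def)
    qed
    also have "\<dots> = ennreal (\<integral>\<omega>. v + (I \<omega>)\<^sup>2 / (t\<^sup>2 * v) \<partial>M)"
      using I_sq v by (intro nn_integral_eq_integral) auto
    also have "(\<integral>\<omega>. v + (I \<omega>)\<^sup>2 / (t\<^sup>2 * v) \<partial>M) = v + (\<integral>\<omega>. (I \<omega>)\<^sup>2 \<partial>M) / (t\<^sup>2 * v)"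
      using I_sq by (subst Bochner_Integration.integral_add) (auto simp: prob_space)
    also have "ennreal \<dots> \<le> ennreal (v + 2 * E * (t * (2 * (1 + S) * w)) / (t\<^sup>2 * v))"
      using I2' v by (intro ennreal_leI add_left_mono divide_right_mono) auto
    also have "2 * E * (t * (2 * (1 + S) * w)) / (t\<^sup>2 * v) = 4 * E * (1 + S) * ((w / t) / v)"
      using t v by (simp add: field_simps power2_eq_square)
    also have "(w / t) / v = v" using v by (simp add: v2[symmetric])
    also have "v + 4 * E * (1 + S) * v = (1 + 4 * E * (1 + S)) * v" by (simp add: algebra_simps)
    finally show ?thesis by (simp only: v_def)
  qed
  show ?thesis
  proof (cases "x > 0")
    case False
    then have "x = 0" using x0 by simp
    then show ?thesis using crude by (simp add: x_def[symmetric] a_def[symmetric])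
  next
    case True
    let ?y = "x powr (1 / 2 * (1 - 1 / q)) * t powr (- (1 / 2))"
    have ES: "0 \<le> 4 * E * (1 + S)" using E0 S by simp
    have "2 * x \<le> (2 + 4 * E * (1 + S)) * x" using ES x0 by (intro mult_right_mono) auto
    then have 1: "(\<integral>\<^sup>+\<omega>. ennreal \<bar>measure (occupation X t \<omega>) A - a\<bar> \<partial>M) \<le> ennreal ((2 + 4 * E * (1 + S)) * x)"
      using crude ennreal_leI order_trans by blast
    have "(1 + 4 * E * (1 + S)) * ?y \<le> (2 + 4 * E * (1 + S)) * ?y" by (intro mult_right_mono) auto
    then have 2: "(\<integral>\<^sup>+\<omega>. ennreal \<bar>measure (occupation X t \<omega>) A - a\<bar> \<partial>M) \<le> ennreal ((2 + 4 * E * (1 + S)) * ?y)"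
      using fine[OF True] ennreal_leI order_trans by blast
    show ?thesis using 1 2 unfolding x_def[symmetric] a_def[symmetric] by (auto simp: min_def)
  qed
qed

section \<open>Convergence of occupation measures\<close>

text \<open>
  Property A is the deviation hypothesis of the multiscale bound, with the occupation measure as random measure; both its mean and
  \<open>\<nu>\<close> are at most \<open>2 \<pi>\<^sub>t\<close>.
\<close>

lemma expected_wasserstein_rate:
  fixes X :: "real \<Rightarrow> 'w \<Rightarrow> 'a::euclidean_space"
  assumes A: "property_A M (occupation X) \<nu> \<pi> t\<^sub>0 (1 / 2 * (1 - 1 / q)) q (1 / 2)"
    and X: "right_continuous_process M X" and \<nu>: "\<nu> \<in> space (prob_algebra borel)"
    and \<pi>: "\<And>t. \<pi> t = average_measure (mean_occupation M X t) \<nu>"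
    and par: "rate_parameters (real DIM('a)) q p t\<^sub>0"
    and r: "rate_parameters.multiscale_rate (real DIM('a)) q p t\<^sub>0 r"
    and r0: "\<And>t. t \<ge> t\<^sub>0 \<Longrightarrow> r t \<ge> 0"
  shows "\<exists>K>0. \<forall>t\<ge>t\<^sub>0. (\<integral>\<^sup>+\<omega>. ennreal_powr (wasserstein p (occupation X t \<omega>) \<nu>) p \<partial>M)
    \<le> ennreal K * sup_moment \<pi> t\<^sub>0 q * ennreal (r t)"
proof -
  interpret right_continuous_process M X by (rule X)
  interpret rate_parameters "real DIM('a)" q p t\<^sub>0 by (rule par)
  obtain C\<^sub>0 where C\<^sub>0: "C\<^sub>0 > 0" and dev: "\<And>t A. t \<ge> t\<^sub>0 \<Longrightarrow> A \<in> sets borel \<Longrightarrow>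
        (\<integral>\<^sup>+\<omega>. ennreal \<bar>measure (occupation X t \<omega>) A - measure \<nu> A\<bar> \<partial>M)
          \<le> ennreal (C\<^sub>0 * min (measure (\<pi> t) A) (measure (\<pi> t) A powr (1 / 2 * (1 - 1 / q)) * t powr (- (1 / 2))))"
    and \<pi>_in: "\<And>t. t \<ge> t\<^sub>0 \<Longrightarrow> \<pi> t \<in> space (prob_algebra borel)" and fin: "sup_moment \<pi> t\<^sub>0 q < \<infinity>"
    using A unfolding property_A_def by blast
  obtain K where K: "K > 0" and sums: "\<And>t N. t \<ge> t\<^sub>0 \<Longrightarrow> (\<Sum>n\<le>N. \<Sum>l\<le>N.
     multiscale_term p q ((q - 1) / 2) (real DIM('a) / 2 * (1 + 1 / q)) (t powr (- (1 / 2))) n l) \<le> K * r t"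
    using r unfolding multiscale_rate_def by blast
  define m where "m = enn2real (sup_moment \<pi> t\<^sub>0 q)"
  have m: "sup_moment \<pi> t\<^sub>0 q = ennreal m" using fin by (simp add: m_def)
  have "1 \<le> sup_moment \<pi> t\<^sub>0 q" by (simp add: sup_moment_def)
  then have m1: "1 \<le> m" unfolding m by (metis ennreal_1 ennreal_le_iff2 not_one_le_zero)
  have q\<beta>: "q * (1 / 2 * (1 - 1 / q)) = (q - 1) / 2" using q by (simp add: field_simps)
  have d\<beta>: "real DIM('a) * (1 - 1 / 2 * (1 - 1 / q)) = real DIM('a) / 2 * (1 + 1 / q)" by (simp add: field_simps)
  define c where "c = 2 * real (2 * DIM('a)) powr p * (C\<^sub>0 * (2 * 3 ^ DIM('a) * 2 powr q))"
  have c: "c > 0" using C\<^sub>0 by (simp add: c_def)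
  show ?thesis
  proof (intro exI[of _ "c * K"] conjI allI impI)
    show "0 < c * K" using c K by simp
    fix t assume t: "t\<^sub>0 \<le> t"
    then have t_pos: "t > 0" using t\<^sub>0 by simp
    have mean: "mean_occupation M X t \<in> space (prob_algebra borel)"
      using mean_occupation_eq_bind[OF t_pos] bind_occupation_space[OF t_pos] by simp
    have two: "2 * emeasure (\<pi> t) B = emeasure (mean_occupation M X t) B + emeasure \<nu> B" if "B \<in> sets borel" for B
      unfolding \<pi> by (rule measure_average_measure(1)[OF mean \<nu> that])
    have "(\<integral>\<^sup>+\<omega>. ennreal_powr (wasserstein p (occupation X t \<omega>) \<nu>) p \<partial>M)
        \<le> ennreal (2 * real (2 * DIM('a)) powr p * (C\<^sub>0 * (2 * 3 ^ DIM('a) * 2 powr q)) * m * (K * r t))"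
    proof (rule expected_wasserstein_le_multiscale[where \<pi> = "\<pi> t" and q = q
          and \<beta> = "1 / 2 * (1 - 1 / q)" and h = "t powr (- (1 / 2))"])
      show "prob_space M" by (rule prob_space_axioms)
      show "occupation X t \<in> M \<rightarrow>\<^sub>M prob_algebra borel" by (rule occupation_kernel[OF t_pos])
      show "\<nu> \<in> space (prob_algebra borel)" "\<pi> t \<in> space (prob_algebra borel)" using \<nu> \<pi>_in[OF t] by auto
      show "0 < p" "p < q" using p by auto
      show "0 < 1 / 2 * (1 - 1 / q)" "1 / 2 * (1 - 1 / q) < 1" using q by (auto simp: field_simps)
      show "0 < t powr (- (1 / 2))" using t_pos by simp
      show "C\<^sub>0 > 0" "1 \<le> m" by fact+
      have "moment (\<pi> t) q \<le> (SUP t\<in>{t\<^sub>0..}. moment (\<pi> t) q)" using t by (intro SUP_upper) auto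
      also have "\<dots> \<le> ennreal m" unfolding m[symmetric] sup_moment_def by simp
      finally show "moment (\<pi> t) q \<le> ennreal m" .
      show "(\<integral>\<^sup>+\<omega>. ennreal \<bar>measure (occupation X t \<omega>) B - measure \<nu> B\<bar> \<partial>M)
          \<le> ennreal (C\<^sub>0 * min (measure (\<pi> t) B) (measure (\<pi> t) B powr (1 / 2 * (1 - 1 / q)) * t powr (- (1 / 2))))"
        if "B \<in> sets borel" for B by (rule dev[OF t that])
      show "emeasure (M \<bind> occupation X t) B \<le> 2 * emeasure (\<pi> t) B" if "B \<in> sets borel" for B
        unfolding two[OF that] mean_occupation_eq_bind[OF t_pos] by simp
      show "emeasure \<nu> B \<le> 2 * emeasure (\<pi> t) B" if "B \<in> sets borel" for B
        unfolding two[OF that] by simp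
      show "(\<Sum>n\<le>N. \<Sum>l\<le>N. multiscale_term p q (q * (1 / 2 * (1 - 1 / q)))
          (real DIM('a) * (1 - 1 / 2 * (1 - 1 / q))) (t powr (- (1 / 2))) n l) \<le> K * r t" for N
        unfolding q\<beta> d\<beta> by (rule sums[OF t])
    qed
    also have "\<dots> = ennreal (c * K) * ennreal m * ennreal (r t)"
      unfolding c_def[symmetric] using c K m1 r0[OF t] by (simp add: ennreal_mult[symmetric] mult_ac)
    finally show "(\<integral>\<^sup>+\<omega>. ennreal_powr (wasserstein p (occupation X t \<omega>) \<nu>) p \<partial>M)
        \<le> ennreal (c * K) * sup_moment \<pi> t\<^sub>0 q * ennreal (r t)" unfolding m .
  qed
qed

text \<open>
  The bound \<open>S\<close> on the moments along \<open>\<mu>\<^sub>0P\<^sub>t\<close> is inherited by the time average and by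
  \<open>\<nu>\<close>, hence by their mean, uniformly in \<open>t\<close>.
\<close>

lemma occupation_property_A:
  fixes P :: "real \<Rightarrow> 'a::euclidean_space \<Rightarrow> 'a measure" and X :: "real \<Rightarrow> 'w \<Rightarrow> 'a"
  assumes P: "markov_semigroup P" and \<nu>: "\<nu> \<in> space (prob_algebra borel)" and q: "q > 1"
    and \<psi>: "\<psi> \<in> borel_measurable borel" "\<And>x. \<psi> x \<ge> 0"
    and e: "set_integrable lborel {0..} e" "\<And>t. t \<ge> 0 \<Longrightarrow> e t \<ge> 0"
    and tv: "\<And>t x. t \<ge> 0 \<Longrightarrow> tv_norm (P t x) \<nu> \<le> \<psi> x * e t"
    and X: "rc_markov_process P \<mu>\<^sub>0 M X" and S0: "S \<ge> 0"
    and S\<psi>: "\<And>t. t \<ge> 0 \<Longrightarrow> (\<integral>\<^sup>+x. ennreal (\<psi> x powr q) \<partial>(\<mu>\<^sub>0 \<bind> P t)) \<le> ennreal S"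
    and Sq: "\<And>t. t \<ge> 0 \<Longrightarrow> moment (\<mu>\<^sub>0 \<bind> P t) q \<le> ennreal S"
    and S\<nu>: "moment \<nu> q \<le> ennreal S" and t\<^sub>0: "t\<^sub>0 > 0"
  shows "property_A M (occupation X) \<nu> (\<lambda>t. average_measure (mean_occupation M X t) \<nu>) t\<^sub>0 (1 / 2 * (1 - 1 / q)) q (1 / 2)"
proof -
  interpret right_continuous_process M X by (rule rc_markov_process_imp_right_continuous[OF X])
  define E where "E = (\<integral>r. indicator {0..} r * e r \<partial>lborel)"
  have E0: "0 \<le> E" unfolding E_def using e by (intro Bochner_Integration.integral_nonneg) (auto simp: indicator_def)
  have mean: "mean_occupation M X t \<in> space (prob_algebra borel)" if "t \<ge> t\<^sub>0" for t
    using mean_occupation_eq_bind[of t] bind_occupation_space[of t] that t\<^sub>0 by simp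
  have norm_m: "(\<lambda>x :: 'a. ennreal (norm x powr q)) \<in> borel_measurable borel" by measurable
  have moment_le: "moment (average_measure (mean_occupation M X t) \<nu>) q \<le> ennreal S" if "t \<ge> t\<^sub>0" for t
  proof -
    have "moment (mean_occupation M X t) q \<le> ennreal S"
      unfolding moment_def using that t\<^sub>0 Sq[unfolded moment_def]
      by (intro nn_integral_mean_occupation_le[OF P X _ norm_m]) auto
    then have "ennreal (1 / 2) * (moment (mean_occupation M X t) q + moment \<nu> q) \<le> ennreal (1 / 2) * (ennreal S + ennreal S)"
      using S\<nu> by (intro mult_left_mono add_mono) auto
    also have "\<dots> = ennreal S"
    proof -
      have "ennreal (1 / 2) * (ennreal S + ennreal S) = ennreal (1 / 2 * (S + S))"
        using S0 by (simp only: ennreal_plus[symmetric]) (subst ennreal_mult, auto)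
      then show ?thesis by simp
    qed
    finally show ?thesis
      using average_measure_eq_bind(1,3)[OF mean[OF that] \<nu>] norm_m unfolding moment_def by simp
  qed
  show ?thesis
    unfolding property_A_def
  proof (intro conjI allI impI ballI exI[of _ "2 + 4 * E * (1 + S)"])
    show "average_measure (mean_occupation M X t) \<nu> \<in> space (prob_algebra borel)" if "t\<^sub>0 \<le> t" for t
      using average_measure_eq_bind(1,2)[OF mean[OF that] \<nu>] by simp
    show "0 < 2 + 4 * E * (1 + S)" using E0 S0 by (intro add_pos_nonneg) auto
    show "(\<integral>\<^sup>+\<omega>. ennreal \<bar>measure (occupation X t \<omega>) A - measure \<nu> A\<bar> \<partial>M)
      \<le> ennreal ((2 + 4 * E * (1 + S)) * min (measure (average_measure (mean_occupation M X t) \<nu>) A)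
            (measure (average_measure (mean_occupation M X t) \<nu>) A powr (1 / 2 * (1 - 1 / q)) * t powr (- (1 / 2))))"
      if "t\<^sub>0 \<le> t" "A \<in> sets borel" for t A
      unfolding E_def using that t\<^sub>0
      by (intro occupation_deviation[OF P \<nu> \<psi> e tv X _ q that(2) S0 S\<psi>]) auto
    have "sup_moment (\<lambda>t. average_measure (mean_occupation M X t) \<nu>) t\<^sub>0 q \<le> max 1 (ennreal S)"
      unfolding sup_moment_def using moment_le by (intro max.mono SUP_least) auto
    also have "\<dots> < \<infinity>" by (simp add: max_def)
    finally show "sup_moment (\<lambda>t. average_measure (mean_occupation M X t) \<nu>) t\<^sub>0 q < \<infinity>" .
  qed
qed

theorem proposition2p6:
  fixes P :: "real \<Rightarrow> 'a::euclidean_space \<Rightarrow> 'a measure"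
    and \<nu> \<mu>\<^sub>0 :: "'a measure"
    and q :: real
    and \<psi> :: "'a \<Rightarrow> real"
    and e :: "real \<Rightarrow> real"
  assumes "markov_semigroup P"
    and "\<nu> \<in> space (prob_algebra borel)"
    and "q > 1"
    and "\<mu>\<^sub>0 \<in> prob_moment q"
    and "\<psi> \<in> borel_measurable borel" and "\<And>x. \<psi> x \<ge> 0"
    and "set_integrable lborel {0..} e" and "\<And>t. t \<ge> 0 \<Longrightarrow> e t \<ge> 0"
    and "\<And>t x. t \<ge> 0 \<Longrightarrow> tv_norm (P t x) \<nu> \<le> \<psi> x * e t"
    and "(SUP t\<in>{0..}. \<integral>\<^sup>+x. ennreal (\<psi> x powr q + norm x powr q) \<partial>(bind \<mu>\<^sub>0 (P t))) < \<infinity>"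
  shows
    "(invariant_distribution P \<nu> \<and> (\<forall>\<mu>. invariant_distribution P \<mu> \<longrightarrow> \<mu> = \<nu>)) \<and>
     \<nu> \<in> prob_moment q \<and>
     (\<forall>(M :: 'w measure) X. rc_markov_process P \<mu>\<^sub>0 M X \<longrightarrow>
       (let \<pi> = (\<lambda>t. average_measure (mean_occupation M X t) \<nu>);
            EW = (\<lambda>p t. \<integral>\<^sup>+\<omega>. ennreal_powr (wasserstein p (occupation X t \<omega>) \<nu>) p \<partial>M);
            d = real DIM('a);
            d_minus = (d + sqrt (d\<^sup>2 + 8 * d)) / 4;
            d_plus = (d + 1 + sqrt ((d + 1)\<^sup>2 + 4 * d)) / 2
        in
        (\<forall>t\<^sub>0>0. property_A M (occupation X) \<nu> \<pi> t\<^sub>0 (1/2 * (1 - 1/q)) q (1/2)) \<and>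
        (\<forall>p t\<^sub>0. 0 < p \<and> p < q \<and> 0 < t\<^sub>0 \<longrightarrow>
          (\<exists>K>0. \<forall>t\<ge>t\<^sub>0.
            (let bound = (\<lambda>r. EW p t \<le> ennreal K * sup_moment \<pi> t\<^sub>0 q * ennreal r) in
             (p < d/2 * (1 + 1/q) \<longrightarrow>
               (p < d * q / (d + q) \<longrightarrow> bound (t powr (- (p * q / ((q + 1) * d))))) \<and>
               (d * q / (d + q) < p \<and> p < q \<longrightarrow> bound (t powr (- ((q - p) / (q + 1)))))) \<and>
             (p = d/2 * (1 + 1/q) \<longrightarrow>
               (d_minus < q \<and> q < d_plus \<longrightarrow> bound (t powr (- ((q - p) / (q + 1))))) \<and>
               (q > d_plus \<longrightarrow> bound (t powr (- (1/2)) * ln (1 + t)))) \<and>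
             (p > d/2 * (1 + 1/q) \<longrightarrow>
               (p < (q - 1) / 2 \<longrightarrow> bound (t powr (- (1/2)))) \<and>
               ((q - 1) / 2 < p \<and> p < q \<longrightarrow> bound (t powr (- ((q - p) / (q + 1)))))))))))"
proof -
  note P = assms(1) and \<nu> = assms(2) and q = assms(3) and \<psi> = assms(5,6) and e = assms(7,8) and tv = assms(9)
  have \<mu>\<^sub>0: "\<mu>\<^sub>0 \<in> space (prob_algebra borel)" using assms(4) by (simp add: prob_moment_def)
  define S where "S = enn2real (SUP t\<in>{0..}. \<integral>\<^sup>+x. ennreal (\<psi> x powr q + norm x powr q) \<partial>(bind \<mu>\<^sub>0 (P t)))"
  have S0: "S \<ge> 0" by (simp add: S_def)
  have S: "(\<integral>\<^sup>+x. ennreal (\<psi> x powr q + norm x powr q) \<partial>(bind \<mu>\<^sub>0 (P t))) \<le> ennreal S" if "t \<ge> 0" for t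
    using SUP_upper[of t "{0..}" "\<lambda>t. \<integral>\<^sup>+x. ennreal (\<psi> x powr q + norm x powr q) \<partial>(bind \<mu>\<^sub>0 (P t))"] assms(10) that
    by (simp add: S_def)
  have S\<psi>: "(\<integral>\<^sup>+x. ennreal (\<psi> x powr q) \<partial>(\<mu>\<^sub>0 \<bind> P t)) \<le> ennreal S" if "t \<ge> 0" for t
    by (rule order_trans[OF _ S[OF that]]) (intro nn_integral_mono ennreal_leI, simp)
  have Sq: "moment (\<mu>\<^sub>0 \<bind> P t) q \<le> ennreal S" if "t \<ge> 0" for t
    unfolding moment_def by (rule order_trans[OF _ S[OF that]]) (intro nn_integral_mono ennreal_leI, simp)
  have S\<nu>: "moment \<nu> q \<le> ennreal S"
    by (rule kernel_limit_moment[OF P \<nu> \<psi>(2) e tv \<mu>\<^sub>0 Sq])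
  {
    fix M :: "'w measure" and X and p t\<^sub>0 :: real
    assume X: "rc_markov_process P \<mu>\<^sub>0 M X" and p: "0 < p \<and> p < q \<and> 0 < t\<^sub>0"
    have par: "rate_parameters (real DIM('a)) q p t\<^sub>0" using p q by unfold_locales auto
    note rate_parameters.wasserstein_rate_cases[unfolded Let_def, OF par expected_wasserstein_rate[OF
        occupation_property_A[OF P \<nu> q \<psi> e tv X S0 S\<psi> Sq S\<nu> rate_parameters.t\<^sub>0[OF par]]
        rc_markov_process_imp_right_continuous[OF X] \<nu> refl par]]
  }
  note rates = this
  show ?thesis
    unfolding Let_def
  proof (intro conjI allI impI)
    show "invariant_distribution P \<nu>" by (rule kernel_invariant[OF P \<nu> \<psi>(2) e tv])
    show "\<mu> = \<nu>" if "invariant_distribution P \<mu>" for \<mu>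
      by (rule kernel_invariant_unique[OF P \<nu> \<psi>(2) e tv that])
    show "\<nu> \<in> prob_moment q" using \<nu> S\<nu> by (auto simp: prob_moment_def intro: le_less_trans)
  next
    fix M :: "'w measure" and X and t\<^sub>0 :: real
    assume X: "rc_markov_process P \<mu>\<^sub>0 M X" and t\<^sub>0: "0 < t\<^sub>0"
    show "property_A M (occupation X) \<nu> (\<lambda>t. average_measure (mean_occupation M X t) \<nu>) t\<^sub>0 (1/2 * (1 - 1/q)) q (1/2)"
      by (rule occupation_property_A[OF P \<nu> q \<psi> e tv X S0 S\<psi> Sq S\<nu> t\<^sub>0])
  qed (rule rates; assumption)
qed

end
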